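(* The quantum query complexity of fidelity estimation is $\Omega\big(\frac{\sqrt{r}}{\sqrt{\varepsilon}}+\frac{1}{\varepsilon}\big)$.
   Context: Fidelity estimation: given two unknown quantum states $\rho$ and $\sigma$ of rank $r$, estimate $\mathrm{F}(\rho,\sigma) = \tr\big(\sqrt{\sqrt{\sigma}\rho\sqrt{\sigma}}\big)$ to within additive error $\varepsilon$ with success probability at least $2/3$. Query complexity is measured in the purified quantum query access model: for each state, e.g. $\rho$, the oracle is a unitary $U$ acting on subsystems $\mathsf{A}$ and $\mathsf{B}$ with $\rho = \tr_{\mathsf{B}}\big(U_{\mathsf{AB}}\, |0\rangle\langle 0|_{\mathsf{AB}}\, U_{\mathsf{AB}}^\dagger\big)$, and a query means one use of (controlled-)$U$ or (controlled-)$U^\dagger$. *)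

theory Defs
  imports "Jordan_Normal_Form.Matrix" "Jordan_Normal_Form.DL_Rank"
begin

definition adj :: "complex mat \<Rightarrow> complex mat" where
  "adj A = mat (dim_col A) (dim_row A) (\<lambda>(i,j). cnj (A $$ (j,i)))"

definition mtrace :: "complex mat \<Rightarrow> complex" where
  "mtrace A = (\<Sum>i<dim_row A. A $$ (i,i))"

definition unitary_mat :: "nat \<Rightarrow> complex mat \<Rightarrow> bool" where
  "unitary_mat d U \<longleftrightarrow> U \<in> carrier_mat d d \<and> U * adj U = 1\<^sub>m d \<and> adj U * U = 1\<^sub>m d"

definition psd :: "nat \<Rightarrow> complex mat \<Rightarrow> bool" where
  "psd d A \<longleftrightarrow> A \<in> carrier_mat d d \<and> adj A = A \<and>
     (\<forall>v \<in> carrier_vec d. Im ((A *\<^sub>v v) \<bullet>c v) = 0 \<and> 0 \<le> Re ((A *\<^sub>v v) \<bullet>c v))"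

definition msqrt :: "nat \<Rightarrow> complex mat \<Rightarrow> complex mat" where
  "msqrt d A = (THE B. psd d B \<and> B * B = A)"

definition density :: "nat \<Rightarrow> complex mat \<Rightarrow> bool" where
  "density d \<rho> \<longleftrightarrow> psd d \<rho> \<and> mtrace \<rho> = 1"

definition mrank :: "nat \<Rightarrow> complex mat \<Rightarrow> nat" where
  "mrank d A = vec_space.rank d A"

definition fidelity :: "nat \<Rightarrow> complex mat \<Rightarrow> complex mat \<Rightarrow> real" where
  "fidelity d \<rho> \<sigma> = Re (mtrace (msqrt d (msqrt d \<sigma> * \<rho> * msqrt d \<sigma>)))"

(* ---------- tensor products and partial trace ----------
   The bipartite space C^n (x) C^m is identified with C^(n*m) via |a>|b> ~ e_(a*m+b). *)

definition kron :: "complex mat \<Rightarrow> complex mat \<Rightarrow> complex mat" where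
  "kron A B = mat (dim_row A * dim_row B) (dim_col A * dim_col B)
     (\<lambda>(x,y). A $$ (x div dim_row B, y div dim_col B) * B $$ (x mod dim_row B, y mod dim_col B))"

definition ptrace_B :: "nat \<Rightarrow> nat \<Rightarrow> complex mat \<Rightarrow> complex mat" where
  "ptrace_B n m M = mat n n (\<lambda>(a,a'). \<Sum>b<m. M $$ (a*m+b, a'*m+b))"

definition proj0 :: "nat \<Rightarrow> complex mat" where
  "proj0 d = mat d d (\<lambda>(i,j). if i = 0 \<and> j = 0 then 1 else 0)"

definition purifies :: "nat \<Rightarrow> nat \<Rightarrow> complex mat \<Rightarrow> complex mat \<Rightarrow> bool" where
  "purifies n m U \<rho> \<longleftrightarrow> unitary_mat (n*m) U \<and> ptrace_B n m (U * proj0 (n*m) * adj U) = \<rho>"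

(* ---------- quantum query algorithms ----------
   The algorithm's register is the oracle register AB (dimension n*m) tensor a workspace
   (dimension W); basis index i*W + w.  A query is (s, d, P):
     s = False: oracle for rho, s = True: oracle for sigma;
     d = False: use U, d = True: use U^dagger;
     P: orthogonal projector on the workspace; the query applies  G (x) P + I (x) (I - P),
        i.e. G controlled on the subspace range(P) of the workspace (P = I: uncontrolled;
        P = |1><1| on a qubit of the workspace: ordinary controlled-G). *)

type_synonym query = "bool \<times> bool \<times> complex mat"

definition orth_proj :: "nat \<Rightarrow> complex mat \<Rightarrow> bool" where
  "orth_proj W P \<longleftrightarrow> P \<in> carrier_mat W W \<and> P * P = P \<and> adj P = P"

definition query_gate :: "nat \<Rightarrow> complex mat \<Rightarrow> complex mat \<Rightarrow> query \<Rightarrow> complex mat" where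
  "query_gate N U\<^sub>\<rho> U\<^sub>\<sigma> q = (case q of (s, d, P) \<Rightarrow>
     (let U = (if s then U\<^sub>\<sigma> else U\<^sub>\<rho>); G = (if d then adj U else U)
      in kron G P + kron (1\<^sub>m N) (1\<^sub>m (dim_row P) - P)))"

definition valid_alg :: "nat \<Rightarrow> nat \<Rightarrow> complex mat \<Rightarrow> (query \<times> complex mat) list \<Rightarrow> bool" where
  "valid_alg N W V0 steps \<longleftrightarrow> unitary_mat (N*W) V0 \<and>
     (\<forall>(q,V) \<in> set steps. unitary_mat (N*W) V \<and> orth_proj W (snd (snd q)))"

definition final_state :: "nat \<Rightarrow> nat \<Rightarrow> complex mat \<Rightarrow> (query \<times> complex mat) list
      \<Rightarrow> complex mat \<Rightarrow> complex mat \<Rightarrow> complex vec" where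
  "final_state N W V0 steps U\<^sub>\<rho> U\<^sub>\<sigma> =
     foldl (\<lambda>\<psi> (q,V). V *\<^sub>v (query_gate N U\<^sub>\<rho> U\<^sub>\<sigma> q *\<^sub>v \<psi>)) (V0 *\<^sub>v unit_vec (N*W) 0) steps"

(* measure in the computational basis and output est k on outcome k;
   probability that the output lies within eps of x *)
definition success_prob :: "nat \<Rightarrow> complex vec \<Rightarrow> (nat \<Rightarrow> real) \<Rightarrow> real \<Rightarrow> real \<Rightarrow> real" where
  "success_prob K \<psi> est x \<epsilon> = (\<Sum>k \<in> {k. k < K \<and> \<bar>est k - x\<bar> \<le> \<epsilon>}. (cmod (\<psi> $ k))\<^sup>2)"

definition solves_fidelity :: "nat \<Rightarrow> nat \<Rightarrow> nat \<Rightarrow> real \<Rightarrow> nat \<Rightarrow> complex mat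
      \<Rightarrow> (query \<times> complex mat) list \<Rightarrow> (nat \<Rightarrow> real) \<Rightarrow> bool" where
  "solves_fidelity n m r \<epsilon> W V0 steps est \<longleftrightarrow>
     valid_alg (n*m) W V0 steps \<and>
     (\<forall>\<rho> \<sigma> U\<^sub>\<rho> U\<^sub>\<sigma>. density n \<rho> \<and> density n \<sigma> \<and> mrank n \<rho> = r \<and> mrank n \<sigma> = r \<and>
        purifies n m U\<^sub>\<rho> \<rho> \<and> purifies n m U\<^sub>\<sigma> \<sigma> \<longrightarrow>
        success_prob (n*m*W) (final_state (n*m) W V0 steps U\<^sub>\<rho> U\<^sub>\<sigma>) est (fidelity n \<rho> \<sigma>) \<epsilon>
          \<ge> 2/3)"

end

theory Submission
  imports Defs "HOL-Analysis.L2_Norm"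
begin

text \<open>The term \<open>1 / \<epsilon>\<close> is a hybrid argument: rotating one eigenvector of \<open>\<rho>\<close> by an angle of order \<open>\<epsilon>\<close>
  changes the fidelity by more than \<open>2 * \<epsilon>\<close>, but each query changes the state only by \<open>O(\<epsilon>)\<close>.

  The term \<open>sqrt (r / \<epsilon>)\<close>, relevant for \<open>r * \<epsilon> \<ge> 1\<close>, comes from the polynomial method. A word \<open>w\<close> of length
  \<open>L\<close>, a constant multiple of \<open>r / \<epsilon>\<close>, over \<open>G + 1 = r\<close> letters defines the purification of \<open>\<rho>\<close> given by the
  uniform superposition of the vectors \<open>e(w l) \<otimes> e(l)\<close>, \<open>l < L\<close>, so that \<open>\<rho>\<close> is diagonal with the letter frequencies as
  entries, and for a uniform diagonal \<open>\<sigma>\<close> the fidelity is proportional to \<open>\<Sum>j. sqrt (y j)\<close>, with \<open>y j\<close> the number of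
  occurrences of the letter \<open>j\<close>. After \<open>T\<close> queries the acceptance probability, averaged over the rearrangements of
  the word, is a polynomial in the counts \<open>y\<close> of degree at most \<open>2 * T\<close>. Draw the counts independently from one of two
  measures whose moments up to order \<open>D\<close> of order \<open>sqrt L\<close> agree but whose means of the square root differ by a
  constant: if \<open>2 * T \<le> D\<close>, the two expected acceptance probabilities are equal, while the two
  fidelities are typically far apart. Counts of sum at least \<open>L\<close> correspond to no word; there the polynomial may be
  large, but its growth, controlled by its boundedness on the words, is beaten by the
  exponential tails of the two measures.\<close>

section \<open>Divided differences\<close>

text \<open>Conditioning the independent counts on a sum below \<open>L\<close> would destroy the
  equality of the two expectations, so the polynomial has to be bounded also where no word exists.
  With the counts fixed this becomes a problem in one variable, the number of letters actually
  placed: the average is a polynomial in that number, bounded by 1 on \<open>0..L\<close>, and the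
  value to be controlled is the one at the full sum. The prescribed rank shapes the instances. Every
  count must be positive, so 0 cannot be a node of the two measures, and the sum must stay strictly
  below \<open>L\<close>, so that the filler letter 0 occurs. The filler lies outside the support of
  \<sigma> and absorbs the random remainder without entering the fidelity. The nodes are spaced like
  squares because the interpolation weights are then quotients of binomial coefficients, which decay
  like exp(-m^2 / (2 D)). In terms of the node this is an exponential tail of rate 1 / (2 D),
  whereas a polynomial of degree D that is bounded up to L = a D^2 grows only like exp(4 sqrt((S -
  L) / a)); a large constant \<open>a\<close> lets the tail win.\<close>

lemma lagrange_interpolation:
  fixes q :: "'a::field poly"
  assumes fin: "finite A" and deg: "degree q < card A"
  shows "poly q t = (\<Sum>x\<in>A. poly q x * (\<Prod>y\<in>A-{x}. (t - y) / (x - y)))"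
proof -
  define L where "L x = (\<Prod>y\<in>A-{x}. Polynomial.smult (1 / (x - y)) [:- y, 1:])" for x
  define p where "p = q - (\<Sum>x\<in>A. Polynomial.smult (poly q x) (L x))"
  have polyL: "poly (L x) s = (\<Prod>y\<in>A-{x}. (s - y) / (x - y))" for x s
    unfolding L_def by (simp add: poly_prod diff_divide_distrib)
  have degL: "degree (L x) \<le> card A - 1" if "x \<in> A" for x
  proof -
    have "degree (L x) \<le> (\<Sum>y\<in>A-{x}. degree (Polynomial.smult (1 / (x - y)) [:- y, 1:]))"
      unfolding L_def using fin by (intro degree_prod_sum_le[THEN order_trans]) (auto simp: o_def)
    also have "\<dots> \<le> (\<Sum>y\<in>A-{x}. 1)"
      by (intro sum_mono) (rule order_trans[OF degree_smult_le], simp)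
    finally show ?thesis using fin that by simp
  qed
  have "degree (\<Sum>x\<in>A. Polynomial.smult (poly q x) (L x)) \<le> card A - 1"
    using degL by (intro degree_sum_le fin) (rule order_trans[OF degree_smult_le], auto)
  hence degp: "degree p < card A"
    unfolding p_def using deg degree_diff_le[of q "card A - 1"] by (metis Suc_pred' less_Suc_eq_le
      less_nat_zero_code not_gr_zero)
  have root: "poly p s = 0" if "s \<in> A" for s
  proof -
    have "(\<Sum>x\<in>A. poly q x * poly (L x) s) = (\<Sum>x\<in>A. if x = s then poly q s else 0)"
    proof (rule sum.cong[OF refl])
      fix x assume x: "x \<in> A"
      show "poly q x * poly (L x) s = (if x = s then poly q s else 0)"
      proof (cases "x = s")
        case True
        have "poly (L x) s = 1" unfolding polyL True by (intro prod.neutral) auto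
        thus ?thesis using True by simp
      next
        case False
        have "poly (L x) s = 0" unfolding polyL using that False fin
          by (intro prod_zero) (auto intro!: bexI[of _ s])
        thus ?thesis using False by simp
      qed
    qed
    thus ?thesis unfolding p_def using that fin by (simp add: poly_sum)
  qed
  have "p = 0"
  proof (rule ccontr)
    assume "p \<noteq> 0"
    hence "card A \<le> card {s. poly p s = 0}" "card {s. poly p s = 0} \<le> degree p"
      using root poly_roots_finite[of p] by (auto intro!: card_mono card_poly_roots_bound)
    thus False using degp by simp
  qed
  hence "poly p t = 0" by simp
  thus ?thesis unfolding p_def by (simp add: poly_sum polyL)
qed

text \<open>Coefficients of the divided difference over \<open>A\<close>, up to the sign (-1)^(card
  A - 1): the reversed factors \<open>y - x\<close> make the sum positive for
  \<open>1 / (x + t)\<close> on positive nodes, whatever the parity of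
  \<open>card A\<close>.\<close>

definition dd_weight :: "real set \<Rightarrow> real \<Rightarrow> real" where
  "dd_weight A x = (\<Prod>y\<in>A-{x}. 1 / (y - x))"

text \<open>Lagrange interpolation of the constant 1, evaluated at \<open>- t\<close> and divided by
  the product of all \<open>y + t\<close>.\<close>

lemma sum_dd_weight_over_shift:
  assumes fin: "finite A" and "A \<noteq> {}" and pos: "\<And>x. x \<in> A \<Longrightarrow> x + t \<noteq> 0"
  shows "(\<Sum>x\<in>A. dd_weight A x / (x + t)) = (\<Prod>x\<in>A. 1 / (x + t))"
proof -
  have "1 = (\<Sum>x\<in>A. \<Prod>y\<in>A-{x}. (- t - y) / (x - y))"
    using lagrange_interpolation[OF fin, of 1 "-t"] assms(2) fin by (simp add: card_gt_0_iff)
  also have "\<dots> = (\<Sum>x\<in>A. dd_weight A x / (x + t) * (\<Prod>y\<in>A. y + t))"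
  proof (rule sum.cong[OF refl])
    fix x assume x: "x \<in> A"
    have "(\<Prod>y\<in>A-{x}. (- t - y) / (x - y)) = (\<Prod>y\<in>A-{x}. (1 / (y - x)) * (y + t))"
      by (rule prod.cong) (auto simp: divide_simps, auto simp: algebra_simps)
    also have "\<dots> = dd_weight A x * (\<Prod>y\<in>A-{x}. y + t)" by (simp only: dd_weight_def prod.distrib)
    also have "\<dots> = dd_weight A x / (x + t) * (\<Prod>y\<in>A. y + t)"
      using prod.remove[OF fin x, of "\<lambda>y. y + t"] pos[OF x] by simp
    finally show "(\<Prod>y\<in>A-{x}. (- t - y) / (x - y)) = dd_weight A x / (x + t) * (\<Prod>y\<in>A. y + t)" .
  qed
  also have "\<dots> = (\<Sum>x\<in>A. dd_weight A x / (x + t)) * (\<Prod>y\<in>A. y + t)" by (simp add: sum_distrib_right)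
  finally have "1 = (\<Sum>x\<in>A. dd_weight A x / (x + t)) * (\<Prod>y\<in>A. y + t)" .
  moreover have "(\<Prod>y\<in>A. y + t) \<noteq> 0" using pos fin by simp
  ultimately show ?thesis by (simp add: prod_dividef field_simps)
qed

text \<open>Interpolation of q(X) X at the point 0. The extra factor makes the value there vanish
  and supplies the \<open>x\<close> missing from the product over \<open>A - {x}\<close>; it costs
  one degree, whence the \<open>+ 1\<close>.\<close>

lemma sum_dd_weight_poly:
  assumes fin: "finite A" and deg: "degree q + 1 < card A" and pos: "\<And>x. x \<in> A \<Longrightarrow> x > 0"
  shows "(\<Sum>x\<in>A. dd_weight A x * poly q x) = 0"
proof -
  have "0 = (\<Sum>x\<in>A. poly (q * [:0, 1:]) x * (\<Prod>y\<in>A-{x}. (0 - y) / (x - y)))"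
  proof -
    have "degree (q * [:0, 1:]) \<le> degree q + degree [:0, 1::real:]" by (rule degree_mult_le)
    hence "degree (q * [:0, 1:]) < card A" using deg by simp
    from lagrange_interpolation[OF fin this, of 0] show ?thesis by simp
  qed
  also have "\<dots> = (\<Sum>x\<in>A. dd_weight A x * poly q x * (\<Prod>y\<in>A. y))"
  proof (rule sum.cong[OF refl])
    fix x assume x: "x \<in> A"
    have "(\<Prod>y\<in>A-{x}. (0 - y) / (x - y)) = (\<Prod>y\<in>A-{x}. (1 / (y - x)) * y)"
      by (rule prod.cong) (auto simp: divide_simps, auto simp: algebra_simps)
    also have "\<dots> = dd_weight A x * (\<Prod>y\<in>A-{x}. y)" by (simp only: dd_weight_def prod.distrib)
    finally show "poly (q * [:0, 1:]) x * (\<Prod>y\<in>A-{x}. (0 - y) / (x - y))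
        = dd_weight A x * poly q x * (\<Prod>y\<in>A. y)"
      using prod.remove[OF fin x, of "\<lambda>y. y"] by simp
  qed
  also have "\<dots> = (\<Sum>x\<in>A. dd_weight A x * poly q x) * (\<Prod>y\<in>A. y)" by (simp add: sum_distrib_right)
  finally have "(\<Sum>x\<in>A. dd_weight A x * poly q x) * (\<Prod>y\<in>A. y) = 0" by simp
  moreover have "(\<Prod>y\<in>A. y) \<noteq> 0" using pos fin by force
  ultimately show ?thesis by simp
qed

text \<open>Since \<open>sqrt x * arctan (U / sqrt x)\<close> is the integral of \<open>x / (x + u\<^sup>2)\<close> over \<open>[0, U]\<close>, the divided difference
  of the square root is a limit of integrals of the explicit divided differences of \<open>x / (x + u\<^sup>2)\<close>.\<close>

lemma sum_dd_weight_sqrt: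
  assumes fin: "finite A" and card: "1 < card A" and pos: "\<And>x. x \<in> A \<Longrightarrow> x > 0"
  shows "- (\<Sum>x\<in>A. dd_weight A x * sqrt x) \<ge> 2 / (3 * pi) * (\<Prod>x\<in>A. 1 / (x + 1))"
proof -
  have ne: "A \<noteq> {}" using card by auto
  define h where "h U = - (\<Sum>x\<in>A. dd_weight A x * (sqrt x * arctan (U / sqrt x)))" for U :: real
  define Q where "Q U = (\<Prod>x\<in>A. 1 / (x + U\<^sup>2))" for U :: real
  \<comment> \<open>Weights of total 0 remove the constant from
    \<open>x / (x + U\<^sup>2) = 1 - U\<^sup>2 / (x + U\<^sup>2)\<close>; what remains of the
    derivative of \<open>h\<close> is the non-negative \<open>U\<^sup>2 * Q U\<close>.\<close>
  have sum0: "(\<Sum>x\<in>A. dd_weight A x) = 0" using sum_dd_weight_poly[OF fin _ pos, of 1] card by simp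
  have Qpos: "Q U > 0" for U unfolding Q_def using pos
    by (intro prod_pos) (auto intro!: add_pos_nonneg)
  have der: "(h has_real_derivative U\<^sup>2 * Q U) (at U)" for U
  proof -
    have d1: "((\<lambda>U. sqrt x * arctan (U / sqrt x)) has_real_derivative (1 - U\<^sup>2 / (x + U\<^sup>2))) (at U)"
      if "x \<in> A" for x
    proof -
      have x: "x > 0" using pos that by simp
      have "((\<lambda>U. sqrt x * arctan (U / sqrt x)) has_real_derivative
          sqrt x * ((1 / sqrt x) * inverse (1 + (U / sqrt x)\<^sup>2))) (at U)"
        using x by (auto intro!: derivative_eq_intros simp: abs_of_pos) (simp add: mult.assoc)
      moreover have "sqrt x * ((1 / sqrt x) * inverse (1 + (U / sqrt x)\<^sup>2)) = 1 - U\<^sup>2 / (x + U\<^sup>2)"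
      proof -
        have "x + U\<^sup>2 > 0" using x by (intro add_pos_nonneg) auto
        moreover have "1 + (U / sqrt x)\<^sup>2 = (x + U\<^sup>2) / x" using x by (simp add: power_divide field_simps)
        moreover have "sqrt x * ((1 / sqrt x) * inverse ((x + U\<^sup>2) / x)) = inverse ((x + U\<^sup>2) / x)"
          using x by (simp only: mult.assoc[symmetric]) simp
        moreover have "inverse ((x + U\<^sup>2) / x) = 1 - U\<^sup>2 / (x + U\<^sup>2)"
          using \<open>x + U\<^sup>2 > 0\<close> by (simp add: field_simps)
        ultimately show ?thesis by (simp only:)
      qed
      ultimately show ?thesis by simp
    qed
    have "(h has_real_derivative - (\<Sum>x\<in>A. dd_weight A x * (1 - U\<^sup>2 / (x + U\<^sup>2)))) (at U)"
      unfolding h_def by (intro DERIV_minus DERIV_sum DERIV_cmult d1)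
    moreover have "- (\<Sum>x\<in>A. dd_weight A x * (1 - U\<^sup>2 / (x + U\<^sup>2))) = U\<^sup>2 * Q U"
    proof -
      have "- (\<Sum>x\<in>A. dd_weight A x * (1 - U\<^sup>2 / (x + U\<^sup>2)))
          = - (\<Sum>x\<in>A. dd_weight A x) + U\<^sup>2 * (\<Sum>x\<in>A. dd_weight A x / (x + U\<^sup>2))"
        by (simp add: sum_distrib_left algebra_simps sum_subtractf)
      also have "(\<Sum>x\<in>A. dd_weight A x / (x + U\<^sup>2)) = Q U" unfolding Q_def
        by (rule sum_dd_weight_over_shift[OF fin ne]) (metis add_nonneg_eq_0_iff less_irrefl less_le pos zero_le_power2)
      finally show ?thesis using sum0 by simp
    qed
    ultimately show ?thesis by simp
  qed
  have mono: "h U \<le> h V" if "U \<le> V" for U V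
    using that der by (intro DERIV_nonneg_imp_nondecreasing[of U V h])
      (auto intro!: exI mult_nonneg_nonneg simp: less_imp_le[OF Qpos])
  \<comment> \<open>Only [0, 1] is exploited, where \<open>Q U \<ge> Q 1\<close>: the integral of
    U^2 gives 1/3, and the limit pi/2 of arctan turns this into \<open>2 / (3 * pi)\<close>.\<close>
  have h1: "h 1 \<ge> Q 1 / 3"
  proof -
    have "(\<lambda>U. h U - Q 1 * U ^ 3 / 3) 0 \<le> (\<lambda>U. h U - Q 1 * U ^ 3 / 3) 1"
    proof (rule DERIV_nonneg_imp_nondecreasing[of 0 1 "\<lambda>U. h U - Q 1 * U ^ 3 / 3"], simp, intro exI conjI)
      fix U :: real assume U: "0 \<le> U" "U \<le> 1"
      show "((\<lambda>U. h U - Q 1 * U ^ 3 / 3) has_real_derivative (U\<^sup>2 * Q U - Q 1 * U\<^sup>2)) (at U)"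
        using der[of U] by (auto intro!: derivative_eq_intros simp: power2_eq_square)
      have "Q 1 \<le> Q U" unfolding Q_def
      proof (intro prod_mono conjI)
        fix x assume "x \<in> A"
        hence "x > 0" using pos by simp
        moreover have "U\<^sup>2 \<le> 1" using U by (simp add: power_le_one)
        ultimately show "1 / (x + 1\<^sup>2) \<le> 1 / (x + U\<^sup>2)" "0 \<le> 1 / (x + 1\<^sup>2)"
          by (auto intro!: divide_left_mono mult_pos_pos add_pos_nonneg)
      qed
      hence "U\<^sup>2 * Q 1 \<le> U\<^sup>2 * Q U" by (intro mult_left_mono) auto
      thus "0 \<le> U\<^sup>2 * Q U - Q 1 * U\<^sup>2" by (simp add: mult.commute)
    qed
    thus ?thesis by (simp add: h_def)
  qed
  have lim: "(h \<longlongrightarrow> - (\<Sum>x\<in>A. dd_weight A x * (sqrt x * (pi / 2)))) at_top"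
    unfolding h_def
  proof (intro tendsto_minus tendsto_sum tendsto_mult tendsto_const)
    fix x assume "x \<in> A"
    hence "filterlim (\<lambda>U. 1 / sqrt x * U) at_top at_top"
      using pos by (intro filterlim_tendsto_pos_mult_at_top[OF tendsto_const _ filterlim_ident]) auto
    hence "filterlim (\<lambda>U. U / sqrt x) at_top at_top" by simp
    thus "((\<lambda>U. arctan (U / sqrt x)) \<longlongrightarrow> pi / 2) at_top"
      by (rule filterlim_compose[OF tendsto_arctan_at_top])
  qed
  have "Q 1 / 3 \<le> - (\<Sum>x\<in>A. dd_weight A x * (sqrt x * (pi / 2)))"
  proof (rule tendsto_lowerbound[OF lim])
    show "\<forall>\<^sub>F U in at_top. Q 1 / 3 \<le> h U"
      using eventually_ge_at_top[of 1] by eventually_elim (use h1 mono in \<open>meson order_trans\<close>)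
  qed simp
  also have "- (\<Sum>x\<in>A. dd_weight A x * (sqrt x * (pi / 2))) = - (\<Sum>x\<in>A. dd_weight A x * sqrt x) * (pi / 2)"
    by (simp add: sum_distrib_right mult.assoc)
  finally show ?thesis unfolding Q_def by (simp add: field_simps)
qed

section \<open>Quotients of binomial coefficients and products over shifted squares\<close>

lemma divide_le_divideI:
  fixes a b c d :: "'a::linordered_field"
  assumes "a * d \<le> c * b" "0 < b" "0 < d"
  shows "a / b \<le> c / d"
  using assms by (simp add: divide_simps mult.commute)

text \<open>For \<open>m \<le> D\<close> this is binom(2D, D - m) / binom(2D, D).\<close>

definition cratio :: "nat \<Rightarrow> nat \<Rightarrow> real" where
  "cratio D m = fact D * fact D / (fact (D - m) * fact (D + m))"

lemma cratio_nonneg: "0 \<le> cratio D m" by (simp add: cratio_def)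

text \<open>Consecutive values have the quotient 1 - (2m + 1) / (D + m + 1), which is at most
  exp(-(2m + 1) / (2D)), and the odd numbers sum to m^2.\<close>

lemma cratio_le: "m \<le> D \<Longrightarrow> cratio D m \<le> exp (- (real m)\<^sup>2 / (2 * real D))"
proof (induction m)
  case 0
  then show ?case by (simp add: cratio_def)
next
  case (Suc m)
  have D: "D \<ge> 1" "Suc m \<le> D" using Suc by auto
  have f1: "fact (D - m) = real (D - m) * fact (D - Suc m)"
    using D by (metis Suc_diff_Suc Suc_le_eq diff_Suc_Suc fact_Suc of_nat_mult of_nat_fact)
  have f2: "fact (D + Suc m) = real (D + Suc m) * fact (D + m)" by simp
  have "cratio D (Suc m) = cratio D m * (real (D - m) / real (D + Suc m))"
    unfolding cratio_def f1 f2 using D by (simp add: divide_simps del: fact_Suc)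
  also have "real (D - m) / real (D + Suc m) = 1 + - (real (2 * m + 1) / real (D + Suc m))"
    using D by (simp add: field_simps of_nat_diff)
  also have "\<dots> \<le> 1 + - (real (2 * m + 1) / (2 * real D))"
    using D by (intro add_left_mono le_imp_neg_le divide_left_mono) auto
  also have "\<dots> \<le> exp (- (real (2 * m + 1) / (2 * real D)))" by (rule exp_ge_add_one_self)
  finally have "cratio D (Suc m) \<le> cratio D m * exp (- (real (2 * m + 1) / (2 * real D)))"
    by (simp add: mult_left_mono cratio_nonneg)
  also have "\<dots> \<le> exp (- (real m)\<^sup>2 / (2 * real D)) * exp (- (real (2 * m + 1) / (2 * real D)))"
    using Suc by (intro mult_right_mono) auto
  also have "\<dots> = exp (- (real (Suc m))\<^sup>2 / (2 * real D))"
    unfolding exp_add[symmetric] using D by (simp add: power2_eq_square field_simps)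
  finally show ?case .
qed

text \<open>Induction on \<open>D\<close> from \<open>m\<close>, with
  \<open>(m + i) * (m - i)\<close> for the difference of squares. At \<open>D = m\<close> the
  factors \<open>m + i\<close> end at \<open>2 * m - 1\<close>: compared with
  \<open>fact m * fact m / fact (2 * m)\<close> the product lacks \<open>m\<close> above and
  \<open>2 * m\<close> below, which is the factor 2.\<close>

lemma prod_square_ratio:
  assumes "1 \<le> m" "m \<le> D"
  shows "(\<Prod>i\<in>{1..D}-{m}. (real i)\<^sup>2 / \<bar>(real i)\<^sup>2 - (real m)\<^sup>2\<bar>) = 2 * cratio D m"
  using assms(2)
proof (induction D rule: dec_induct)
  case base
  have p1: "(\<Prod>i=1..k. real i / (real (m + i))) = fact k * fact m / fact (m + k)" for k
  proof (induction k)
    case (Suc k)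
    have "fact (m + Suc k) = real (m + Suc k) * fact (m + k)" by simp
    thus ?case using Suc by (simp add: mult_ac add_ac)
  qed simp
  have p2: "(\<Prod>i=1..k. real i / real (m - i)) = fact k * fact (m - Suc k) / fact (m - 1)" if "k < m" for k
    using that
  proof (induction k)
    case (Suc k)
    have "m - Suc k = Suc (m - Suc (Suc k))" using Suc by simp
    hence "fact (m - Suc k) = real (m - Suc k) * fact (m - Suc (Suc k))"
      by (metis fact_Suc of_nat_fact of_nat_mult)
    moreover have "real (m - Suc k) > 0" using Suc by simp
    ultimately show ?case using Suc by simp
  qed (use assms in simp)
  have p: "(\<Prod>i=1..k. real i / (real (m + i))) * (\<Prod>i=1..k. real i / real (m - i))
      = fact k * fact m / fact (m + k) * (fact k * fact (m - Suc k) / fact (m - 1))"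
    if "k < m" for k unfolding p1 p2[OF that] ..
  have "(\<Prod>i\<in>{1..m}-{m}. (real i)\<^sup>2 / \<bar>(real i)\<^sup>2 - (real m)\<^sup>2\<bar>)
      = (\<Prod>i=1..m-1. (real i / (real (m + i))) * (real i / real (m - i)))"
  proof (rule prod.cong)
    show "{1..m}-{m} = {1..m-1}" using assms by auto
    fix i assume i: "i \<in> {1..m-1}"
    have "\<bar>(real i)\<^sup>2 - (real m)\<^sup>2\<bar> = real (m + i) * real (m - i)"
    proof -
      have "(real i)\<^sup>2 \<le> (real m)\<^sup>2" using i by auto
      moreover have "real (m - i) = real m - real i" using i by (intro of_nat_diff) auto
      ultimately show ?thesis by (simp add: abs_if power2_eq_square algebra_simps)
    qed
    thus "(real i)\<^sup>2 / \<bar>(real i)\<^sup>2 - (real m)\<^sup>2\<bar> = (real i / (real (m + i))) * (real i / real (m - i))"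
      by (simp add: power2_eq_square)
  qed
  also have "\<dots> = fact (m-1) * fact m / fact (m + (m-1)) * (fact (m-1) * fact (m - Suc (m-1)) / fact (m - 1))"
    unfolding prod.distrib by (rule p) (use assms in simp)
  also have "\<dots> = 2 * cratio m m"
  proof -
    obtain k where k: "m = Suc k" using assms by (metis Suc_le_D One_nat_def)
    have e: "m + (m - 1) = 2 * k + 1" "m + m = Suc (2 * k + 1)" "m - 1 = k" using k by auto
    have "fact (m + m) = real (Suc (2 * k + 1)) * fact (2 * k + 1)" unfolding e(2) by (rule fact_Suc)
    hence f: "fact (m + m) = (2 * real m) * fact (2 * k + 1)" using k by simp
    have g: "m - Suc (m - 1) = 0" "m - m = 0" "fact m = real m * fact k"
      using k fact_Suc[of k, where 'a = real] by auto
    have m0: "real m > 0" using k by simp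
    have "cratio m m = real m * fact k * fact m / (2 * real m * fact (2 * k + 1))"
      unfolding cratio_def f g(2) using g(3) by simp
    also have "\<dots> = fact k * fact m / fact (2 * k + 1) / 2" using m0 by (simp del: fact_Suc)
    finally have c: "2 * cratio m m = fact k * fact m / fact (2 * k + 1)" by simp
    have "m + k = 2 * k + 1" using k by simp
    thus ?thesis unfolding c g(1) e(3) by (simp add: mult_2 del: fact_Suc)
  qed
  finally show ?case .
next
  case (step D)
  have "{1..Suc D}-{m} = insert (Suc D) ({1..D}-{m})" using step by auto
  hence "(\<Prod>i\<in>{1..Suc D}-{m}. (real i)\<^sup>2 / \<bar>(real i)\<^sup>2 - (real m)\<^sup>2\<bar>)
     = (real (Suc D))\<^sup>2 / \<bar>(real (Suc D))\<^sup>2 - (real m)\<^sup>2\<bar> * (2 * cratio D m)"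
    using step by simp
  also have "\<bar>(real (Suc D))\<^sup>2 - (real m)\<^sup>2\<bar> = real (Suc D + m) * real (Suc D - m)"
  proof -
    have "(real m)\<^sup>2 \<le> (real (Suc D))\<^sup>2" using step by (intro power_mono) auto
    moreover have "real (Suc D - m) = real (Suc D) - real m" using step by (intro of_nat_diff) auto
    ultimately show ?thesis by (simp add: power2_eq_square algebra_simps)
  qed
  also have "(real (Suc D))\<^sup>2 / (real (Suc D + m) * real (Suc D - m)) * (2 * cratio D m) = 2 * cratio (Suc D) m"
  proof -
    have "Suc D - m = Suc (D - m)" using step by simp
    hence f1: "fact (Suc D - m) = real (Suc D - m) * fact (D - m)" by simp
    have f2: "fact (Suc D) = real (Suc D) * fact D" "fact (Suc D + m) = real (Suc D + m) * fact (D + m)"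
      using fact_Suc[of D, where 'a = real] fact_Suc[of "D + m", where 'a = real] by simp_all
    show ?thesis unfolding cratio_def f1 f2 by (simp add: power2_eq_square mult_ac del: of_nat_Suc fact_Suc)
  qed
  finally show ?case .
qed

text \<open>The bound 6 is not inductive, since the factors exceed 1; \<open>6 * D / (D + 4)\<close>
  is, starting with equality at \<open>D = 2\<close>.\<close>

lemma prod_ratio_2: "(\<Prod>i=1..D. (real i)\<^sup>2 / \<bar>(real i)\<^sup>2 - 2\<bar>) \<le> 6"
proof (cases "D < 2")
  case True
  hence "D = 0 \<or> D = 1" by auto
  thus ?thesis by auto
next
  case False
  hence "2 \<le> D" by simp
  hence "(\<Prod>i=1..D. (real i)\<^sup>2 / \<bar>(real i)\<^sup>2 - 2\<bar>) \<le> 6 * real D / (real D + 4)"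
  proof (induction D rule: dec_induct)
    case base
    show ?case by (simp add: numeral_2_eq_2)
  next
    case (step D)
    define n where "n = real (Suc D)"
    have n: "n \<ge> 3" using step unfolding n_def by simp
    have nn: "n\<^sup>2 \<ge> 9" using power_mono[OF n, of 2] by simp
    have "(\<Prod>i=1..Suc D. (real i)\<^sup>2 / \<bar>(real i)\<^sup>2 - 2\<bar>) = n\<^sup>2 / (n\<^sup>2 - 2) * (\<Prod>i=1..D. (real i)\<^sup>2 / \<bar>(real i)\<^sup>2 - 2\<bar>)"
      using nn by (simp add: n_def)
    also have "\<dots> \<le> n\<^sup>2 / (n\<^sup>2 - 2) * (6 * real D / (real D + 4))"
      using step nn by (intro mult_left_mono) auto
    also have "\<dots> = n\<^sup>2 * (6 * (n - 1)) / ((n\<^sup>2 - 2) * (n + 3))" by (simp add: n_def)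
    also have "\<dots> \<le> 6 * n / (n + 4)"
    proof -
      have "n\<^sup>2 * (6 * (n - 1)) * (n + 4) \<le> 6 * n * ((n\<^sup>2 - 2) * (n + 3))"
        using n mult_left_mono[of 3 n n] by (simp add: power2_eq_square algebra_simps)
      thus ?thesis using n nn by (intro divide_le_divideI) auto
    qed
    finally show ?case by (simp add: n_def add.commute)
  qed
  also have "\<dots> \<le> 6" by (simp add: field_simps)
  finally show ?thesis .
qed

text \<open>As for \<open>prod_ratio_2\<close>, with \<open>12 * D / (D + 9)\<close> and equality at
  \<open>D = 3\<close>.\<close>

lemma prod_ratio_3: "(\<Prod>i=1..D. (real i)\<^sup>2 / \<bar>(real i)\<^sup>2 - 3\<bar>) \<le> 12"
proof (cases "D < 3")
  case True
  hence "D = 0 \<or> D = 1 \<or> D = 2" by auto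
  thus ?thesis by (auto simp: numeral_2_eq_2)
next
  case False
  hence "3 \<le> D" by simp
  hence "(\<Prod>i=1..D. (real i)\<^sup>2 / \<bar>(real i)\<^sup>2 - 3\<bar>) \<le> 12 * real D / (real D + 9)"
  proof (induction D rule: dec_induct)
    case base
    show ?case by (simp add: numeral_3_eq_3)
  next
    case (step D)
    define n where "n = real (Suc D)"
    have n: "n \<ge> 4" using step unfolding n_def by simp
    have nn: "n\<^sup>2 \<ge> 16" using power_mono[OF n, of 2] by simp
    have "(\<Prod>i=1..Suc D. (real i)\<^sup>2 / \<bar>(real i)\<^sup>2 - 3\<bar>) = n\<^sup>2 / (n\<^sup>2 - 3) * (\<Prod>i=1..D. (real i)\<^sup>2 / \<bar>(real i)\<^sup>2 - 3\<bar>)"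
      using nn by (simp add: n_def)
    also have "\<dots> \<le> n\<^sup>2 / (n\<^sup>2 - 3) * (12 * real D / (real D + 9))"
      using step nn by (intro mult_left_mono) auto
    also have "\<dots> = n\<^sup>2 * (12 * (n - 1)) / ((n\<^sup>2 - 3) * (n + 8))" by (simp add: n_def)
    also have "\<dots> \<le> 12 * n / (n + 9)"
    proof -
      have "n\<^sup>2 * (12 * (n - 1)) * (n + 9) \<le> 12 * n * ((n\<^sup>2 - 3) * (n + 8))"
        using n mult_left_mono[of 4 n n] by (simp add: power2_eq_square algebra_simps)
      thus ?thesis using n nn by (intro divide_le_divideI) auto
    qed
    finally show ?case by (simp add: n_def add.commute)
  qed
  also have "\<dots> \<le> 12" by (simp add: field_simps)
  finally show ?thesis .
qed

section \<open>Two measures with equal moments\<close>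

text \<open>The nodes \<open>1 + m\<^sup>2\<close> alone give divided-difference weights that decay too slowly for the mean to stay
  bounded; the additional nodes 3 and 4 make them decay like \<open>1 / m ^ 4\<close>.\<close>

definition sq_nodes :: "nat \<Rightarrow> nat set" where
  "sq_nodes D = {1, 3, 4} \<union> (\<lambda>m. 1 + m\<^sup>2) ` {1..D}"

lemma square_neq: "(m::nat)\<^sup>2 \<noteq> 2" "(m::nat)\<^sup>2 \<noteq> 3"
proof -
  have "m = 0 \<or> m = 1 \<or> 2 \<le> m" by auto
  thus "m\<^sup>2 \<noteq> 2" "m\<^sup>2 \<noteq> 3" using power_mono[of 2 m 2] by auto
qed

lemma inj_sq_node: "inj_on (\<lambda>m::nat. 1 + m\<^sup>2) S"
  by (auto simp: inj_on_def)

lemma inj_Suc_square [simp]: "inj_on (\<lambda>m::nat. Suc (m\<^sup>2)) S"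
  by (auto simp: inj_on_def)

lemma sq_node_notin:
  assumes "m \<ge> (1::nat)"
  shows "1 + m\<^sup>2 \<noteq> 1" "1 + m\<^sup>2 \<noteq> 3" "1 + m\<^sup>2 \<noteq> 4"
  using assms square_neq[of m] by auto

lemma finite_sq_nodes [simp]: "finite (sq_nodes D)"
  by (simp add: sq_nodes_def)

lemma sq_nodes_disjoint: "{1, 3, 4} \<inter> (\<lambda>m. 1 + m\<^sup>2) ` {1..D} = ({} :: nat set)"
  using sq_node_notin by fastforce

lemma card_sq_nodes: "card (sq_nodes D) = D + 3"
  unfolding sq_nodes_def
  by (subst card_Un_disjoint) (auto simp: card_image sq_nodes_disjoint[simplified])

lemma sum_sq_nodes:
  fixes f :: "nat \<Rightarrow> real"
  shows "(\<Sum>x\<in>sq_nodes D. f x) = f 1 + f 3 + f 4 + (\<Sum>m=1..D. f (1 + m\<^sup>2))"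
  unfolding sq_nodes_def
  by (subst sum.union_disjoint) (auto simp: sum.reindex sq_nodes_disjoint[simplified] o_def)

lemma prod_sq_nodes:
  fixes f :: "nat \<Rightarrow> real"
  shows "(\<Prod>x\<in>sq_nodes D. f x) = f 1 * f 3 * f 4 * (\<Prod>m=1..D. f (1 + m\<^sup>2))"
  unfolding sq_nodes_def
  by (subst prod.union_disjoint) (auto simp: prod.reindex sq_nodes_disjoint[simplified] o_def)

definition sq_weight :: "nat \<Rightarrow> nat \<Rightarrow> real" where
  "sq_weight D x = (\<Prod>y\<in>sq_nodes D - {x}. 1 / (real y - real x))"

lemma sq_weight_eq_dd_weight: "sq_weight D x = dd_weight (real ` sq_nodes D) (real x)"
proof -
  have "real ` sq_nodes D - {real x} = real ` (sq_nodes D - {x})" by auto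
  thus ?thesis unfolding dd_weight_def sq_weight_def by (simp add: prod.reindex o_def)
qed

lemma fact_square: "(fact D)\<^sup>2 = (\<Prod>m=1..D. (real m)\<^sup>2)"
  by (induction D) (simp_all add: power_mult_distrib)

text \<open>\<open>(fact D)\<^sup>2\<close> is the product of all \<open>m\<^sup>2\<close>;
  distributing it over the factors leaves quotients tending to 1, so the scaled weights stay of
  constant order as \<open>D\<close> grows.\<close>

lemma abs_sq_weight_special:
  assumes "x \<in> {1, 3, 4}"
  shows "\<bar>sq_weight D x\<bar> * (fact D)\<^sup>2
    = (\<Prod>y\<in>{1,3,4}-{x}. 1 / \<bar>real y - real x\<bar>) * (\<Prod>m=1..D. (real m)\<^sup>2 / \<bar>(real m)\<^sup>2 - (real x - 1)\<bar>)"
proof -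
  have "sq_nodes D - {x} = ({1,3,4} - {x}) \<union> (\<lambda>m. 1 + m\<^sup>2) ` {1..D}"
    using assms sq_nodes_disjoint[of D] unfolding sq_nodes_def by blast
  hence "\<bar>sq_weight D x\<bar> = (\<Prod>y\<in>{1,3,4}-{x}. 1 / \<bar>real y - real x\<bar>)
      * (\<Prod>y\<in>(\<lambda>m. 1 + m\<^sup>2) ` {1..D}. 1 / \<bar>real y - real x\<bar>)"
    unfolding sq_weight_def abs_prod
    using sq_nodes_disjoint[of D] by (subst prod.union_disjoint[symmetric]) (auto simp: abs_prod)
  also have "(\<Prod>y\<in>(\<lambda>m. 1 + m\<^sup>2) ` {1..D}. 1 / \<bar>real y - real x\<bar>)
      = (\<Prod>m=1..D. 1 / \<bar>(real m)\<^sup>2 - (real x - 1)\<bar>)"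
    by (subst prod.reindex[OF inj_sq_node]) (auto simp: o_def algebra_simps intro!: prod.cong arg_cong[of _ _ abs])
  finally have eq: "\<bar>sq_weight D x\<bar> = (\<Prod>y\<in>{1,3,4}-{x}. 1 / \<bar>real y - real x\<bar>)
      * (\<Prod>m=1..D. 1 / \<bar>(real m)\<^sup>2 - (real x - 1)\<bar>)" .
  show ?thesis unfolding eq fact_square mult.assoc prod.distrib[symmetric] by simp
qed

text \<open>The node 1 contributes \<open>1 / m\<^sup>2\<close>, which cancels the factor that
  \<open>(fact D)\<^sup>2\<close> has beyond the product over \<open>i \<noteq> m\<close>; the nodes
  3 and 4 contribute the quartic decay.\<close>

lemma abs_sq_weight_square:
  assumes m: "1 \<le> m" "m \<le> D"
  shows "\<bar>sq_weight D (1 + m\<^sup>2)\<bar> * (fact D)\<^sup>2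
    = 2 * cratio D m / (\<bar>(real m)\<^sup>2 - 2\<bar> * \<bar>(real m)\<^sup>2 - 3\<bar>)"
proof -
  have "sq_nodes D - {1 + m\<^sup>2} = {1,3,4} \<union> (\<lambda>m. 1 + m\<^sup>2) ` ({1..D} - {m})"
    using sq_node_notin[OF m(1)] unfolding sq_nodes_def by (auto simp: inj_image_mem_iff)
  hence "\<bar>sq_weight D (1 + m\<^sup>2)\<bar> = (\<Prod>y\<in>{1,3,4}. 1 / \<bar>real y - real (1 + m\<^sup>2)\<bar>)
      * (\<Prod>y\<in>(\<lambda>m. 1 + m\<^sup>2) ` ({1..D} - {m}). 1 / \<bar>real y - real (1 + m\<^sup>2)\<bar>)"
    unfolding sq_weight_def abs_prod
    using sq_nodes_disjoint[of D] by (subst prod.union_disjoint[symmetric]) (auto simp: abs_prod)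
  also have "(\<Prod>y\<in>(\<lambda>m. 1 + m\<^sup>2) ` ({1..D} - {m}). 1 / \<bar>real y - real (1 + m\<^sup>2)\<bar>)
      = (\<Prod>i\<in>{1..D}-{m}. 1 / \<bar>(real i)\<^sup>2 - (real m)\<^sup>2\<bar>)"
    by (subst prod.reindex[OF inj_sq_node]) (auto simp: o_def intro!: prod.cong)
  also have "(\<Prod>y\<in>{1,3,4}. 1 / \<bar>real y - real (1 + m\<^sup>2)\<bar>)
      = 1 / ((real m)\<^sup>2 * (\<bar>(real m)\<^sup>2 - 2\<bar> * \<bar>(real m)\<^sup>2 - 3\<bar>))"
    by (simp add: abs_minus_commute)
  finally have "\<bar>sq_weight D (1 + m\<^sup>2)\<bar> = 1 / ((real m)\<^sup>2 * (\<bar>(real m)\<^sup>2 - 2\<bar> * \<bar>(real m)\<^sup>2 - 3\<bar>))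
      * (\<Prod>i\<in>{1..D}-{m}. 1 / \<bar>(real i)\<^sup>2 - (real m)\<^sup>2\<bar>)" .
  moreover have "(fact D)\<^sup>2 = (real m)\<^sup>2 * (\<Prod>i\<in>{1..D}-{m}. (real i)\<^sup>2)"
    unfolding fact_square using m by (subst prod.remove[of _ m]) auto
  ultimately have "\<bar>sq_weight D (1 + m\<^sup>2)\<bar> * (fact D)\<^sup>2 = 1 / (\<bar>(real m)\<^sup>2 - 2\<bar> * \<bar>(real m)\<^sup>2 - 3\<bar>) *
     ((\<Prod>i\<in>{1..D}-{m}. 1 / \<bar>(real i)\<^sup>2 - (real m)\<^sup>2\<bar>) * (\<Prod>i\<in>{1..D}-{m}. (real i)\<^sup>2))"
    using m by simp
  also have "(\<Prod>i\<in>{1..D}-{m}. 1 / \<bar>(real i)\<^sup>2 - (real m)\<^sup>2\<bar>) * (\<Prod>i\<in>{1..D}-{m}. (real i)\<^sup>2)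
     = (\<Prod>i\<in>{1..D}-{m}. (real i)\<^sup>2 / \<bar>(real i)\<^sup>2 - (real m)\<^sup>2\<bar>)"
    unfolding prod.distrib[symmetric] by simp
  also have "\<dots> = 2 * cratio D m" by (rule prod_square_ratio[OF m])
  finally show ?thesis by simp
qed

text \<open>The constant 8 is dictated by \<open>m = 2\<close>, where equality holds.\<close>

lemma quartic_bound:
  assumes "1 \<le> (m::nat)"
  shows "1 / (\<bar>(real m)\<^sup>2 - 2\<bar> * \<bar>(real m)\<^sup>2 - 3\<bar>) \<le> 8 / real m ^ 4"
proof (cases "m < 3")
  case True
  hence "m = 1 \<or> m = 2" using assms by auto
  thus ?thesis by auto
next
  case False
  define t where "t = (real m)\<^sup>2"
  have t: "t \<ge> 9" unfolding t_def using power_mono[of 3 "real m" 2] False by simp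
  have "t * t \<le> 8 * ((t - 2) * (t - 3))" 
  proof -
    have "9 * t \<le> t * t" using t by (intro mult_right_mono) auto
    moreover have "8 * ((t - 2) * (t - 3)) = 8 * (t * t) - 40 * t + 48" by (simp add: algebra_simps)
    ultimately show ?thesis using t by linarith
  qed
  moreover have "real m ^ 4 = t * t" by (simp add: t_def power2_eq_square power4_eq_xxxx)
  ultimately show ?thesis using t unfolding t_def[symmetric]
    by (simp add: divide_simps)
qed

text \<open>The coefficients at 1, 3 and 4 are 1 / (2 * 3), 6 / (2 * 1) and 12 / (3 * 1): mutual
  distances of these nodes, with 6 and 12 from \<open>prod_ratio_2\<close> and
  \<open>prod_ratio_3\<close>. The last one is 2 from \<open>prod_square_ratio\<close> times 8 from
  \<open>quartic_bound\<close>.\<close>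

lemma sum_sq_weight_le:
  assumes f: "\<And>x. 0 \<le> f x"
  shows "(\<Sum>x\<in>sq_nodes D. \<bar>sq_weight D x\<bar> * (fact D)\<^sup>2 * f x)
    \<le> f 1 / 6 + 3 * f 3 + 4 * f 4 + 16 * (\<Sum>m=1..D. cratio D m * f (1 + m\<^sup>2) / real m ^ 4)"
proof -
  have "(\<Prod>m=Suc 0..D. (real m)\<^sup>2 / (real m)\<^sup>2) = 1" by (intro prod.neutral) auto
  hence w1: "\<bar>sq_weight D 1\<bar> * (fact D)\<^sup>2 = 1/6"
    using abs_sq_weight_special[of 1 D] by (simp add: insert_Diff_if)
  have w3: "\<bar>sq_weight D 3\<bar> * (fact D)\<^sup>2 \<le> 3"
    using abs_sq_weight_special[of 3 D] prod_ratio_2[of D] by (simp add: insert_Diff_if)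
  have w4: "\<bar>sq_weight D 4\<bar> * (fact D)\<^sup>2 \<le> 4"
    using abs_sq_weight_special[of 4 D] prod_ratio_3[of D] by (simp add: insert_Diff_if)
  have wm: "\<bar>sq_weight D (1 + m\<^sup>2)\<bar> * (fact D)\<^sup>2 \<le> 16 * (cratio D m / real m ^ 4)" if "m \<in> {1..D}" for m
  proof -
    have "\<bar>sq_weight D (1 + m\<^sup>2)\<bar> * (fact D)\<^sup>2
        = 2 * cratio D m * (1 / (\<bar>(real m)\<^sup>2 - 2\<bar> * \<bar>(real m)\<^sup>2 - 3\<bar>))"
      using abs_sq_weight_square[of m D] that by simp
    also have "\<dots> \<le> 2 * cratio D m * (8 / real m ^ 4)"
      using quartic_bound[of m] that cratio_nonneg by (intro mult_left_mono) auto
    finally show ?thesis by simp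
  qed
  have "(\<Sum>m=1..D. \<bar>sq_weight D (1 + m\<^sup>2)\<bar> * (fact D)\<^sup>2 * f (1 + m\<^sup>2))
      \<le> (\<Sum>m=1..D. 16 * (cratio D m / real m ^ 4) * f (1 + m\<^sup>2))"
    using wm f by (intro sum_mono mult_right_mono) auto
  also have "\<dots> = 16 * (\<Sum>m=1..D. cratio D m * f (1 + m\<^sup>2) / real m ^ 4)"
    by (simp add: sum_distrib_left mult.assoc)
  finally show ?thesis unfolding sum_sq_nodes w1
    using mult_right_mono[OF w3 f[of 3]] mult_right_mono[OF w4 f[of 4]] by simp
qed

lemma sum_inverse_squares: "(\<Sum>m=1..D. 1 / (real m)\<^sup>2) \<le> 2"
proof -
  have "(\<Sum>m=1..D. 1 / (real m)\<^sup>2) \<le> 2 - 1 / real D"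
  proof (induction D)
    case (Suc D)
    show ?case
    proof (cases "D = 0")
      case False
      have "1 / (real (Suc D))\<^sup>2 \<le> 1 / real D - 1 / real (Suc D)"
        using False by (simp add: divide_simps power2_eq_square)
      thus ?thesis using Suc by simp
    qed simp
  qed simp
  also have "\<dots> \<le> 2" by simp
  finally show ?thesis .
qed

text \<open>The weights sum to 0, so their positive and negative parts both have this mass and
  become probability measures when divided by it.\<close>

definition sq_mass :: "nat \<Rightarrow> real" where
  "sq_mass D = (\<Sum>x\<in>sq_nodes D. \<bar>sq_weight D x\<bar>) / 2"

definition pos_measure :: "nat \<Rightarrow> nat \<Rightarrow> real" where
  "pos_measure D x = max 0 (sq_weight D x) / sq_mass D"

definition neg_measure :: "nat \<Rightarrow> nat \<Rightarrow> real" where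
  "neg_measure D x = max 0 (- sq_weight D x) / sq_mass D"

lemma sq_nodes_pos: "x \<in> sq_nodes D \<Longrightarrow> 0 < x"
  by (auto simp: sq_nodes_def)

lemma sum_sq_weight_poly:
  assumes "degree q \<le> D + 1"
  shows "(\<Sum>x\<in>sq_nodes D. sq_weight D x * poly q (real x)) = 0"
proof -
  have "(\<Sum>x\<in>real ` sq_nodes D. dd_weight (real ` sq_nodes D) x * poly q x) = 0"
  proof (rule sum_dd_weight_poly)
    show "degree q + 1 < card (real ` sq_nodes D)" using assms by (simp add: card_image card_sq_nodes)
    show "\<And>x. x \<in> real ` sq_nodes D \<Longrightarrow> 0 < x" by (auto intro: sq_nodes_pos)
  qed simp
  thus ?thesis by (simp add: sum.reindex o_def sq_weight_eq_dd_weight)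
qed

lemma sq_mass_pos: "sq_mass D > 0"
proof -
  have "sq_weight D x \<noteq> 0" for x unfolding sq_weight_def by simp
  hence "(\<Sum>x\<in>sq_nodes D. \<bar>sq_weight D x\<bar>) > 0"
    by (intro sum_pos) (auto simp: sq_nodes_def)
  thus ?thesis by (simp add: sq_mass_def)
qed

lemma sq_mass_lower: "1 / 12 \<le> sq_mass D * (fact D)\<^sup>2"
proof -
  have "(\<Prod>m=Suc 0..D. (real m)\<^sup>2 / (real m)\<^sup>2) = 1" by (intro prod.neutral) auto
  hence "1/6 = \<bar>sq_weight D 1\<bar> * (fact D)\<^sup>2"
    using abs_sq_weight_special[of 1 D] by (simp add: insert_Diff_if)
  also have "\<dots> \<le> (\<Sum>x\<in>sq_nodes D. \<bar>sq_weight D x\<bar>) * (fact D)\<^sup>2"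
    by (intro mult_right_mono member_le_sum) (auto simp: sq_nodes_def)
  finally show ?thesis by (simp add: sq_mass_def)
qed

lemma sq_mass_upper: "sq_mass D * (fact D)\<^sup>2 \<le> 20"
proof -
  have "(\<Sum>x\<in>sq_nodes D. \<bar>sq_weight D x\<bar> * (fact D)\<^sup>2 * 1)
      \<le> 1 / 6 + 3 * 1 + 4 * 1 + 16 * (\<Sum>m=1..D. cratio D m * 1 / real m ^ 4)"
    by (rule sum_sq_weight_le) simp
  also have "(\<Sum>m=1..D. cratio D m * 1 / real m ^ 4) \<le> (\<Sum>m=1..D. 1 / (real m)\<^sup>2)"
  proof (rule sum_mono)
    fix m assume m: "m \<in> {1..D}"
    have "cratio D m \<le> exp (- (real m)\<^sup>2 / (2 * real D))" using m by (intro cratio_le) auto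
    also have "\<dots> \<le> 1" by simp
    finally have "cratio D m * 1 / real m ^ 4 \<le> 1 / real m ^ 4" by (simp add: divide_right_mono)
    also have "\<dots> \<le> 1 / (real m)\<^sup>2" using m
      by (intro divide_left_mono power_increasing) auto
    finally show "cratio D m * 1 / real m ^ 4 \<le> 1 / (real m)\<^sup>2" .
  qed
  also have "\<dots> \<le> 2" by (rule sum_inverse_squares)
  finally have "(\<Sum>x\<in>sq_nodes D. \<bar>sq_weight D x\<bar> * (fact D)\<^sup>2) \<le> 40" by simp
  hence "(\<Sum>x\<in>sq_nodes D. \<bar>sq_weight D x\<bar>) * (fact D)\<^sup>2 \<le> 40"
    by (simp add: sum_distrib_right)
  thus ?thesis by (simp add: sq_mass_def)
qed

lemma sum_measure_le:
  assumes f: "\<And>x. 0 \<le> f x" and \<nu>: "\<nu> = pos_measure D \<or> \<nu> = neg_measure D"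
  shows "(\<Sum>x\<in>sq_nodes D. \<nu> x * f x)
    \<le> 12 * (f 1 / 6 + 3 * f 3 + 4 * f 4 + 16 * (\<Sum>m=1..D. cratio D m * f (1 + m\<^sup>2) / real m ^ 4))"
proof -
  have "(\<Sum>x\<in>sq_nodes D. \<nu> x * f x) \<le> (\<Sum>x\<in>sq_nodes D. 12 * (\<bar>sq_weight D x\<bar> * (fact D)\<^sup>2 * f x))"
  proof (rule sum_mono)
    fix x
    have "\<nu> x \<le> \<bar>sq_weight D x\<bar> / sq_mass D" using \<nu> sq_mass_pos[of D]
      by (auto simp: pos_measure_def neg_measure_def intro!: divide_right_mono)
    also have "\<dots> \<le> 12 * (\<bar>sq_weight D x\<bar> * (fact D)\<^sup>2)"
      using sq_mass_pos[of D] mult_left_mono[OF sq_mass_lower, of "12 * \<bar>sq_weight D x\<bar>" D]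
      by (simp add: divide_simps mult_ac)
    finally show "\<nu> x * f x \<le> 12 * (\<bar>sq_weight D x\<bar> * (fact D)\<^sup>2 * f x)"
      using mult_right_mono[OF _ f] by (metis mult.assoc)
  qed
  also have "\<dots> = 12 * (\<Sum>x\<in>sq_nodes D. \<bar>sq_weight D x\<bar> * (fact D)\<^sup>2 * f x)" by (simp add: sum_distrib_left)
  also have "\<dots> \<le> 12 * (f 1 / 6 + 3 * f 3 + 4 * f 4 + 16 * (\<Sum>m=1..D. cratio D m * f (1 + m\<^sup>2) / real m ^ 4))"
    using sum_sq_weight_le[OF f] by (intro mult_left_mono) auto
  finally show ?thesis .
qed

lemma measure_diff: "pos_measure D x - neg_measure D x = sq_weight D x / sq_mass D"
  by (simp add: pos_measure_def neg_measure_def max_def diff_divide_distrib[symmetric])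

lemma measure_moment:
  assumes "degree q \<le> D + 1"
  shows "(\<Sum>x\<in>sq_nodes D. pos_measure D x * poly q (real x)) = (\<Sum>x\<in>sq_nodes D. neg_measure D x * poly q (real x))"
proof -
  have "(\<Sum>x\<in>sq_nodes D. pos_measure D x * poly q (real x)) - (\<Sum>x\<in>sq_nodes D. neg_measure D x * poly q (real x))
     = (\<Sum>x\<in>sq_nodes D. (pos_measure D x - neg_measure D x) * poly q (real x))"
    by (simp add: sum_subtractf left_diff_distrib)
  also have "\<dots> = (\<Sum>x\<in>sq_nodes D. sq_weight D x * poly q (real x)) / sq_mass D"
    by (simp add: measure_diff sum_divide_distrib)
  finally show ?thesis using sum_sq_weight_poly[OF assms] by simp
qed

lemma measure_total:
  "(\<Sum>x\<in>sq_nodes D. pos_measure D x) = 1" "(\<Sum>x\<in>sq_nodes D. neg_measure D x) = 1"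
proof -
  have eq: "(\<Sum>x\<in>sq_nodes D. pos_measure D x) = (\<Sum>x\<in>sq_nodes D. neg_measure D x)"
    using measure_moment[of 1 D] by simp
  have "(\<Sum>x\<in>sq_nodes D. pos_measure D x) + (\<Sum>x\<in>sq_nodes D. neg_measure D x)
     = (\<Sum>x\<in>sq_nodes D. \<bar>sq_weight D x\<bar> / sq_mass D)"
    unfolding sum.distrib[symmetric] pos_measure_def neg_measure_def add_divide_distrib[symmetric]
    by (intro sum.cong arg_cong2[of _ _ _ _ "(/)"]) (auto simp: max_def)
  also have "\<dots> = 2" unfolding sum_divide_distrib[symmetric] using sq_mass_pos[of D]
    by (simp add: sq_mass_def)
  finally show "(\<Sum>x\<in>sq_nodes D. pos_measure D x) = 1" "(\<Sum>x\<in>sq_nodes D. neg_measure D x) = 1"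
    using eq by auto
qed

lemma measure_nonneg: "0 \<le> pos_measure D x" "0 \<le> neg_measure D x"
  using sq_mass_pos[of D] by (auto simp: pos_measure_def neg_measure_def)

lemma measure_mean:
  assumes "\<nu> = pos_measure D \<or> \<nu> = neg_measure D"
  shows "(\<Sum>x\<in>sq_nodes D. \<nu> x * real x) \<le> 2400"
proof -
  have "(\<Sum>x\<in>sq_nodes D. \<nu> x * real x) \<le> 12 * (real 1 / 6 + 3 * real 3 + 4 * real 4
      + 16 * (\<Sum>m=1..D. cratio D m * real (1 + m\<^sup>2) / real m ^ 4))"
    by (rule sum_measure_le[OF _ assms]) simp
  also have "(\<Sum>m=1..D. cratio D m * real (1 + m\<^sup>2) / real m ^ 4) \<le> (\<Sum>m=1..D. 2 * (1 / (real m)\<^sup>2))"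
  proof (rule sum_mono)
    fix m assume m: "m \<in> {1..D}"
    have "cratio D m \<le> exp (- (real m)\<^sup>2 / (2 * real D))" using m by (intro cratio_le) auto
    also have "\<dots> \<le> 1" by simp
    finally have "cratio D m * real (1 + m\<^sup>2) \<le> 1 * (2 * (real m)\<^sup>2)"
      using m by (intro mult_mono) auto
    thus "cratio D m * real (1 + m\<^sup>2) / real m ^ 4 \<le> 2 * (1 / (real m)\<^sup>2)"
      using m by (simp add: divide_simps power2_eq_square power4_eq_xxxx mult_ac)
  qed
  also have "\<dots> \<le> 4" using sum_inverse_squares[of D] by (simp only: sum_distrib_left[symmetric])
  finally show ?thesis by simp
qed

text \<open>\<open>1 / (2 * D)\<close> is the rate at which the exponential at the node 1 + m^2 is
  cancelled, up to a constant, by the factor exp(-m^2 / (2D)) of \<open>cratio_le\<close>. Hence the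
  mean of x exp(l x) is bounded by 6000 for every \<open>D\<close>, and exp(t) - 1 \<le> t exp(t)
  leaves only 1 + 6000 l.\<close>

lemma measure_exp:
  assumes \<nu>: "\<nu> = pos_measure D \<or> \<nu> = neg_measure D" and D: "1 \<le> D"
  shows "(\<Sum>x\<in>sq_nodes D. \<nu> x * exp (real x / (2 * real D))) \<le> exp (3000 / real D)"
proof -
  define l where "l = 1 / (2 * real D)"
  have l: "0 < l" "l \<le> 1/2" using D by (auto simp: l_def)
  have e1: "exp (1/2 :: real) \<le> 2"
    using exp_bound_lemma[of "1/2::real"] by simp
  have el: "exp l \<le> 2" using l e1 by (meson exp_le_cancel_iff order_trans)
  have e3: "exp (3 * l) \<le> 8" "exp (4 * l) \<le> 16"
    using power_mono[OF el, of 3] power_mono[OF el, of 4] exp_of_nat_mult[of 3 l] exp_of_nat_mult[of 4 l]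
    by simp_all
  define f where "f x = real x * exp (l * real x)" for x
  have sub: "exp (l * real x) - 1 \<le> l * f x" for x
  proof -
    have "1 + (- (l * real x)) \<le> exp (- (l * real x))" by (rule exp_ge_add_one_self)
    hence "exp (l * real x) * (1 - l * real x) \<le> exp (l * real x) * exp (- (l * real x))"
      by (intro mult_left_mono) auto
    moreover have "exp (l * real x) * exp (- (l * real x)) = 1" by (simp add: exp_minus)
    ultimately show ?thesis by (simp add: f_def algebra_simps)
  qed
  have "(\<Sum>x\<in>sq_nodes D. \<nu> x * f x) \<le> 12 * (f 1 / 6 + 3 * f 3 + 4 * f 4
      + 16 * (\<Sum>m=1..D. cratio D m * f (1 + m\<^sup>2) / real m ^ 4))"
    by (rule sum_measure_le[OF _ \<nu>]) (simp add: f_def)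
  also have "(\<Sum>m=1..D. cratio D m * f (1 + m\<^sup>2) / real m ^ 4) \<le> (\<Sum>m=1..D. 4 * (1 / (real m)\<^sup>2))"
  proof (rule sum_mono)
    fix m assume m: "m \<in> {1..D}"
    have "cratio D m * exp (l * real (1 + m\<^sup>2))
        \<le> exp (- (real m)\<^sup>2 / (2 * real D)) * exp (l * real (1 + m\<^sup>2))"
      using m by (intro mult_right_mono cratio_le) auto
    also have "\<dots> = exp l" unfolding exp_add[symmetric] by (simp add: l_def add_divide_distrib)
    finally have "cratio D m * exp (l * real (1 + m\<^sup>2)) \<le> 2" using el by simp
    hence "cratio D m * exp (l * real (1 + m\<^sup>2)) * real (1 + m\<^sup>2) \<le> 2 * (2 * (real m)\<^sup>2)"
      using m by (intro mult_mono) auto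
    hence "cratio D m * f (1 + m\<^sup>2) \<le> 4 * (real m)\<^sup>2" by (simp add: f_def mult_ac)
    thus "cratio D m * f (1 + m\<^sup>2) / real m ^ 4 \<le> 4 * (1 / (real m)\<^sup>2)"
      using m by (simp add: divide_simps power2_eq_square power4_eq_xxxx mult_ac)
  qed
  also have "\<dots> \<le> 8" using sum_inverse_squares[of D] by (simp only: sum_distrib_left[symmetric])
  also have "f 1 \<le> 2" using el by (simp add: f_def)
  also have "f 3 \<le> 24" using e3 by (simp add: f_def mult.commute)
  also have "f 4 \<le> 64" using e3 by (simp add: f_def mult.commute)
  finally have fb: "(\<Sum>x\<in>sq_nodes D. \<nu> x * f x) \<le> 6000" by simp
  have tot: "(\<Sum>x\<in>sq_nodes D. \<nu> x) = 1" and nn: "\<nu> x \<ge> 0" for x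
    using \<nu> measure_total measure_nonneg by auto
  have "(\<Sum>x\<in>sq_nodes D. \<nu> x * exp (l * real x)) \<le> (\<Sum>x\<in>sq_nodes D. \<nu> x * (1 + l * f x))"
    using sub nn by (intro sum_mono mult_left_mono) (auto simp: algebra_simps)
  also have "\<dots> = 1 + l * (\<Sum>x\<in>sq_nodes D. \<nu> x * f x)"
    using tot by (simp add: distrib_left sum.distrib sum_distrib_left mult_ac)
  also have "\<dots> \<le> 1 + l * 6000" using fb l by (intro add_left_mono mult_left_mono) auto
  also have "\<dots> \<le> exp (l * 6000)" by (rule exp_ge_add_one_self)
  finally show ?thesis by (simp add: l_def)
qed

text \<open>800 is 40 * 20: the product of \<open>x + 1\<close> over the nodes 1, 3, 4 and the bound
  of \<open>sq_mass_upper\<close>. \<open>exp 4\<close> bounds the product of all 1 + 2 / m^2, and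
  \<open>2 / (3 * pi)\<close> comes from \<open>sum_dd_weight_sqrt\<close>.\<close>

definition sqrt_gap :: real where
  "sqrt_gap = 1 / (800 * exp 4) * (2 / (3 * pi))"

text \<open>The divided difference of the square root and the mass \<open>sq_mass D\<close> are both
  of order \<open>1 / (fact D)\<^sup>2\<close>, so their quotient has a lower bound independent of
  \<open>D\<close>. The sign in \<open>sum_dd_weight_sqrt\<close> gives \<open>neg_measure\<close>
  the larger mean.\<close>

lemma measure_sqrt_gap:
  "(\<Sum>x\<in>sq_nodes D. neg_measure D x * sqrt (real x)) - (\<Sum>x\<in>sq_nodes D. pos_measure D x * sqrt (real x)) \<ge> sqrt_gap"
proof -
  have "2 / (3 * pi) * (\<Prod>x\<in>real ` sq_nodes D. 1 / (x + 1))
     \<le> - (\<Sum>x\<in>real ` sq_nodes D. dd_weight (real ` sq_nodes D) x * sqrt x)"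
    by (rule sum_dd_weight_sqrt) (auto simp: card_image card_sq_nodes intro: sq_nodes_pos)
  also have "\<dots> = - (\<Sum>x\<in>sq_nodes D. sq_weight D x * sqrt (real x))"
    by (simp add: sum.reindex o_def sq_weight_eq_dd_weight)
  also have "(\<Prod>x\<in>real ` sq_nodes D. 1 / (x + 1)) = (\<Prod>x\<in>sq_nodes D. 1 / (real x + 1))"
    by (simp add: prod.reindex o_def)
  also have "\<dots> = 1 / 40 * (\<Prod>m=1..D. 1 / ((real m)\<^sup>2 + 2))"
    unfolding prod_sq_nodes by (simp add: add_ac)
  finally have 1: "2 / (3 * pi) * (1 / 40 * (\<Prod>m=1..D. 1 / ((real m)\<^sup>2 + 2)))
     \<le> - (\<Sum>x\<in>sq_nodes D. sq_weight D x * sqrt (real x))" .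
  have "(\<Prod>m=1..D. (real m)\<^sup>2 + 2) \<le> (\<Prod>m=1..D. (real m)\<^sup>2 * exp (2 * (1 / (real m)\<^sup>2)))"
  proof (rule prod_mono, intro conjI)
    fix m assume m: "m \<in> {1..D}"
    have "(real m)\<^sup>2 + 2 = (real m)\<^sup>2 * (1 + 2 * (1 / (real m)\<^sup>2))" using m by (simp add: field_simps)
    also have "\<dots> \<le> (real m)\<^sup>2 * exp (2 * (1 / (real m)\<^sup>2))"
      by (intro mult_left_mono exp_ge_add_one_self) auto
    finally show "(real m)\<^sup>2 + 2 \<le> (real m)\<^sup>2 * exp (2 * (1 / (real m)\<^sup>2))" .
  qed simp
  also have "\<dots> = (fact D)\<^sup>2 * exp (2 * (\<Sum>m=1..D. 1 / (real m)\<^sup>2))"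
    by (simp add: prod.distrib fact_square exp_sum sum_distrib_left)
  also have "\<dots> \<le> (fact D)\<^sup>2 * exp 4" using sum_inverse_squares[of D] by (intro mult_left_mono) auto
  finally have 2: "(\<Prod>m=1..D. (real m)\<^sup>2 + 2) \<le> (fact D)\<^sup>2 * exp 4" .
  have pp: "(\<Prod>m=1..D. (real m)\<^sup>2 + 2) > 0" by (intro prod_pos) (auto intro: add_nonneg_pos)
  have 3: "1 / ((fact D)\<^sup>2 * exp 4) \<le> (\<Prod>m=1..D. 1 / ((real m)\<^sup>2 + 2))"
  proof -
    have "1 / ((fact D)\<^sup>2 * exp 4) \<le> 1 / (\<Prod>m=1..D. (real m)\<^sup>2 + 2)"
      using 2 pp by (intro divide_left_mono) auto
    thus ?thesis by (simp add: prod_dividef)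
  qed
  have "sqrt_gap * sq_mass D = 2 / (3 * pi) * (sq_mass D / (800 * exp 4))" by (simp add: sqrt_gap_def)
  also have "\<dots> \<le> 2 / (3 * pi) * (1 / 40 * (1 / ((fact D)\<^sup>2 * exp 4)))"
    using sq_mass_upper[of D] by (intro mult_left_mono) (auto simp: field_simps)
  also have "\<dots> \<le> 2 / (3 * pi) * (1 / 40 * (\<Prod>m=1..D. 1 / ((real m)\<^sup>2 + 2)))"
    using 3 by (intro mult_left_mono) auto
  also have "\<dots> \<le> - (\<Sum>x\<in>sq_nodes D. sq_weight D x * sqrt (real x))" by (rule 1)
  finally have "sqrt_gap \<le> - (\<Sum>x\<in>sq_nodes D. sq_weight D x * sqrt (real x)) / sq_mass D"
    using sq_mass_pos[of D] by (simp add: field_simps)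
  also have "\<dots> = (\<Sum>x\<in>sq_nodes D. - (pos_measure D x - neg_measure D x) * sqrt (real x))"
    by (simp add: measure_diff sum_negf sum_divide_distrib)
  finally show ?thesis by (simp add: sum_subtractf left_diff_distrib)
qed

lemma sqrt_gap_pos: "sqrt_gap > 0" by (simp add: sqrt_gap_def)

section \<open>Averages over random words\<close>

definition ffall :: "real \<Rightarrow> nat \<Rightarrow> real" where
  "ffall x k = (\<Prod>i<k. x - real i)"

lemma ffall_0 [simp]: "ffall x 0 = 1" by (simp add: ffall_def)

lemma ffall_Suc: "ffall x (Suc k) = ffall x k * (x - real k)" by (simp add: ffall_def)

lemma ffall_Suc_left: "ffall x (Suc k) = x * ffall (x - 1) k"
  unfolding ffall_def by (subst prod.lessThan_Suc_shift) (simp add: algebra_simps)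

lemma ffall_shift: "x * ffall (x - 1) k = (x - real k) * ffall x k"
  using ffall_Suc[of x k] ffall_Suc_left[of x k] by simp

lemma ffall_pos: "k \<le> n \<Longrightarrow> 0 < ffall (real n) k"
  unfolding ffall_def by (intro prod_pos) auto

definition ffall_poly :: "nat \<Rightarrow> real poly" where
  "ffall_poly k = (\<Prod>i<k. [:- real i, 1:])"

lemma poly_ffall_poly [simp]: "poly (ffall_poly k) x = ffall x k"
  by (simp add: ffall_poly_def ffall_def poly_prod)

lemma degree_ffall_poly [simp]: "degree (ffall_poly k) = k"
  unfolding ffall_poly_def by (subst degree_prod_eq_sum_degree) auto

text \<open>A monomial is encoded by a finite set of pairs (position, letter).\<close>

definition mono_ind :: "(nat \<times> nat) set \<Rightarrow> (nat \<Rightarrow> nat) \<Rightarrow> real" where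
  "mono_ind \<mu> w = (if \<forall>(l, j)\<in>\<mu>. w l = j then 1 else 0)"

definition mult_of :: "(nat \<times> nat) set \<Rightarrow> nat \<Rightarrow> nat" where
  "mult_of \<mu> j = card {p\<in>\<mu>. snd p = j}"

definition letter_sum :: "nat \<Rightarrow> (nat \<Rightarrow> nat) \<Rightarrow> nat" where
  "letter_sum G y = (\<Sum>j=1..G. y j)"

text \<open>The number of ways to assign distinct balls of the prescribed colours to the pairs of
  \<mu>.\<close>

definition ffall_prod :: "nat \<Rightarrow> (nat \<times> nat) set \<Rightarrow> (nat \<Rightarrow> nat) \<Rightarrow> real" where
  "ffall_prod G \<mu> y = (\<Prod>j=1..G. ffall (real (y j)) (mult_of \<mu> j))"

text \<open>The average over a random placement, on \<open>L\<close> positions, of \<open>s\<close> balls drawn without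
  replacement from an urn with \<open>y j\<close> balls of colour \<open>j\<close>; the other positions get the letter 0.\<close>

primrec urn_avg :: "nat \<Rightarrow> nat \<Rightarrow> (nat \<Rightarrow> nat) \<Rightarrow> nat \<Rightarrow> ((nat \<Rightarrow> nat) \<Rightarrow> real) \<Rightarrow> real" where
  "urn_avg G 0 y s a = a (\<lambda>_. 0)"
| "urn_avg G (Suc L) y s a = (1 - real s / real (Suc L)) * urn_avg G L y s (\<lambda>w. a (w(L := 0)))
    + real s / real (Suc L) * (\<Sum>j=1..G. real (y j) / real (letter_sum G y)
        * urn_avg G L (y(j := y j - 1)) (s - 1) (\<lambda>w. a (w(L := j))))"

lemma letter_sum_upd:
  assumes "1 \<le> j" "j \<le> G" "y j \<ge> 1"
  shows "letter_sum G (y(j := y j - 1)) = letter_sum G y - 1" "letter_sum G y \<ge> 1"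
proof -
  have "letter_sum G y = y j + (\<Sum>i\<in>{1..G}-{j}. y i)" unfolding letter_sum_def using assms by (intro sum.remove) auto
  moreover have "letter_sum G (y(j := y j - 1)) = (y j - 1) + (\<Sum>i\<in>{1..G}-{j}. y i)"
    unfolding letter_sum_def using assms by (subst sum.remove[of _ j]) auto
  ultimately show "letter_sum G (y(j := y j - 1)) = letter_sum G y - 1" "letter_sum G y \<ge> 1" using assms by auto
qed

lemma urn_avg_sum:
  "urn_avg G L y s (\<lambda>w. \<Sum>i\<in>F. c i * a i w) = (\<Sum>i\<in>F. c i * urn_avg G L y s (a i))"
proof (induction L arbitrary: y s a)
  case (Suc L)
  have sw: "(\<Sum>j=1..G. q j * (\<Sum>i\<in>F. c i * r i j)) = (\<Sum>i\<in>F. c i * (\<Sum>j=1..G. q j * r i j))"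
    for q :: "nat \<Rightarrow> real" and r
    by (simp add: sum_distrib_left, subst sum.swap) (simp add: mult_ac)
  show ?case
    by (simp only: urn_avg.simps Suc sw)
       (simp add: sum_distrib_left sum.distrib distrib_left mult_ac)
qed simp

text \<open>Every word that occurs with positive probability has the prescribed letter counts.\<close>

lemma urn_avg_bounds:
  assumes "s \<le> L" "s \<le> letter_sum G y"
    and "\<And>w. (\<forall>l. w l \<le> G) \<Longrightarrow> (\<forall>l\<ge>L. w l = 0) \<Longrightarrow>
      (s = letter_sum G y \<Longrightarrow> (\<forall>j\<in>{1..G}. card {l. l < L \<and> w l = j} = y j)) \<Longrightarrow> lo \<le> a w \<and> a w \<le> hi"
  shows "lo \<le> urn_avg G L y s a \<and> urn_avg G L y s a \<le> hi"
  using assms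
proof (induction L arbitrary: y s a)
  case 0
  show ?case unfolding urn_avg.simps
    by (rule 0(3)) (use 0 in \<open>auto simp: letter_sum_def\<close>)
next
  case (Suc L)
  define p where "p = real s / real (Suc L)"
  define q where "q j = real (y j) / real (letter_sum G y)" for j
  have p: "0 \<le> p" "p \<le> 1" using Suc.prems by (auto simp: p_def)
  have A: "lo \<le> urn_avg G L y s (\<lambda>w. a (w(L := 0))) \<and> urn_avg G L y s (\<lambda>w. a (w(L := 0))) \<le> hi"
    if "p \<noteq> 1"
  proof (rule Suc.IH)
    show "s \<le> L" using that Suc.prems(1) by (cases "s = Suc L") (auto simp: p_def)
    show "s \<le> letter_sum G y" by fact
    fix w assume w: "\<forall>l. w l \<le> G" "\<forall>l\<ge>L. w l = 0"
      "s = letter_sum G y \<Longrightarrow> (\<forall>j\<in>{1..G}. card {l. l < L \<and> w l = j} = y j)"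
    have "{l. l < Suc L \<and> (w(L := 0)) l = j} = {l. l < L \<and> w l = j}" if "j \<ge> 1" for j
      using that by (auto simp: less_Suc_eq)
    thus "lo \<le> a (w(L := 0)) \<and> a (w(L := 0)) \<le> hi"
      using w by (intro Suc.prems(3)) auto
  qed
  have B: "lo \<le> urn_avg G L (y(j := y j - 1)) (s - 1) (\<lambda>w. a (w(L := j)))
      \<and> urn_avg G L (y(j := y j - 1)) (s - 1) (\<lambda>w. a (w(L := j))) \<le> hi"
    if j: "j \<in> {1..G}" and yj: "y j \<ge> 1" and s: "s \<ge> 1" for j
  proof (rule Suc.IH)
    show "s - 1 \<le> L" using Suc.prems(1) by simp
    show "s - 1 \<le> letter_sum G (y(j := y j - 1))" using letter_sum_upd[of j G y] j yj Suc.prems(2) by simp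
    fix w assume w: "\<forall>l. w l \<le> G" "\<forall>l\<ge>L. w l = 0"
      "s - 1 = letter_sum G (y(j := y j - 1)) \<Longrightarrow> (\<forall>i\<in>{1..G}. card {l. l < L \<and> w l = i} = (y(j := y j - 1)) i)"
    show "lo \<le> a (w(L := j)) \<and> a (w(L := j)) \<le> hi"
    proof (rule Suc.prems(3))
      show "\<forall>l. (w(L := j)) l \<le> G" using w j by auto
      show "\<forall>l\<ge>Suc L. (w(L := j)) l = 0" using w by auto
      assume "s = letter_sum G y"
      hence c: "\<forall>i\<in>{1..G}. card {l. l < L \<and> w l = i} = (y(j := y j - 1)) i"
        using w(3) letter_sum_upd[of j G y] j yj by simp
      show "\<forall>i\<in>{1..G}. card {l. l < Suc L \<and> (w(L := j)) l = i} = y i"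
      proof
        fix i assume i: "i \<in> {1..G}"
        have "{l. l < Suc L \<and> (w(L := j)) l = i} = (if i = j then insert L {l. l < L \<and> w l = i} else {l. l < L \<and> w l = i})"
          by (auto simp: less_Suc_eq)
        thus "card {l. l < Suc L \<and> (w(L := j)) l = i} = y i" using c i yj by auto
      qed
    qed
  qed
  \<comment> \<open>A branch of weight 0 is left unconstrained: for \<open>s = Suc L\<close> the
    unoccupied branch and for \<open>s = 0\<close> the occupied one fall outside the induction
    hypothesis.\<close>
  have bnd: "lo \<le> (1 - p) * u + p * v \<and> (1 - p) * u + p * v \<le> hi"
    if "p \<noteq> 1 \<Longrightarrow> lo \<le> u \<and> u \<le> hi" "p \<noteq> 0 \<Longrightarrow> lo \<le> v \<and> v \<le> hi" for u v
  proof (cases "p = 0 \<or> p = 1")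
    case False
    have "(1 - p) * lo + p * lo \<le> (1 - p) * u + p * v" "(1 - p) * u + p * v \<le> (1 - p) * hi + p * hi"
      using that p False by (auto intro!: add_mono mult_left_mono)
    thus ?thesis by (simp add: algebra_simps)
  qed (use that in auto)
  show ?case unfolding urn_avg.simps p_def[symmetric] q_def[symmetric]
  proof (rule bnd[OF A])
    assume "p \<noteq> 0"
    hence s: "s \<ge> 1" by (auto simp: p_def intro: Suc_leI)
    hence tp: "letter_sum G y > 0" using Suc.prems(2) by simp
    have qs: "(\<Sum>j=1..G. q j) = 1" using tp unfolding q_def sum_divide_distrib[symmetric] letter_sum_def of_nat_sum[symmetric]
      by (intro divide_self, unfold of_nat_eq_0_iff) linarith
    have "(\<Sum>j=1..G. q j * lo) \<le> (\<Sum>j=1..G. q j * urn_avg G L (y(j := y j - 1)) (s - 1) (\<lambda>w. a (w(L := j))))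
       \<and> (\<Sum>j=1..G. q j * urn_avg G L (y(j := y j - 1)) (s - 1) (\<lambda>w. a (w(L := j)))) \<le> (\<Sum>j=1..G. q j * hi)"
    proof (intro conjI sum_mono)
      fix j assume j: "j \<in> {1..G}"
      show "q j * lo \<le> q j * urn_avg G L (y(j := y j - 1)) (s - 1) (\<lambda>w. a (w(L := j)))"
        using B[OF j _ s] by (cases "y j = 0") (simp_all add: q_def mult_left_mono divide_right_mono)
      show "q j * urn_avg G L (y(j := y j - 1)) (s - 1) (\<lambda>w. a (w(L := j))) \<le> q j * hi"
        using B[OF j _ s] by (cases "y j = 0") (simp_all add: q_def mult_left_mono divide_right_mono)
    qed
    thus "lo \<le> (\<Sum>j=1..G. q j * urn_avg G L (y(j := y j - 1)) (s - 1) (\<lambda>w. a (w(L := j))))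
       \<and> (\<Sum>j=1..G. q j * urn_avg G L (y(j := y j - 1)) (s - 1) (\<lambda>w. a (w(L := j)))) \<le> hi"
      using qs by (simp flip: sum_distrib_right)
  qed
qed


lemma mult_of_remove:
  assumes "finite \<mu>" "(l, j) \<in> \<mu>"
  shows "i \<noteq> j \<Longrightarrow> mult_of (\<mu> - {(l, j)}) i = mult_of \<mu> i"
    and "mult_of \<mu> j = Suc (mult_of (\<mu> - {(l, j)}) j)"
proof -
  show "mult_of (\<mu> - {(l, j)}) i = mult_of \<mu> i" if "i \<noteq> j"
    unfolding mult_of_def using that by (intro arg_cong[of _ _ card]) auto
  have "{p\<in>\<mu>. snd p = j} = insert (l, j) {p \<in> \<mu> - {(l, j)}. snd p = j}" using assms by auto
  thus "mult_of \<mu> j = Suc (mult_of (\<mu> - {(l, j)}) j)"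
    unfolding mult_of_def using assms by simp
qed

lemma sum_mult_of:
  assumes "finite \<mu>" "snd ` \<mu> \<subseteq> {1..G}"
  shows "(\<Sum>j=1..G. mult_of \<mu> j) = card \<mu>"
  unfolding mult_of_def using assms
  by (subst card_UN_disjoint[symmetric]) (auto intro!: arg_cong[of _ _ card])

lemma ffall_prod_upd:
  assumes j: "j \<in> {1..G}"
  shows "real (y j) * ffall_prod G \<mu> (y(j := y j - 1)) = (real (y j) - real (mult_of \<mu> j)) * ffall_prod G \<mu> y"
proof (cases "y j = 0")
  case True
  have "ffall_prod G \<mu> y * real (mult_of \<mu> j) = 0"
  proof (cases "mult_of \<mu> j")
    case (Suc k)
    have "ffall (real (y j)) (mult_of \<mu> j) = 0" unfolding Suc ffall_Suc_left True by simp
    hence "ffall_prod G \<mu> y = 0" unfolding ffall_prod_def using j by (intro prod_zero) auto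
    thus ?thesis by simp
  qed simp
  thus ?thesis using True by auto
next
  case False
  define R where "R = (\<Prod>i\<in>{1..G}-{j}. ffall (real (y i)) (mult_of \<mu> i))"
  have "ffall_prod G \<mu> (y(j := y j - 1)) = ffall (real (y j - 1)) (mult_of \<mu> j) * R"
    unfolding ffall_prod_def R_def using j by (subst prod.remove[of _ j]) auto
  moreover have "ffall_prod G \<mu> y = ffall (real (y j)) (mult_of \<mu> j) * R"
    unfolding ffall_prod_def R_def using j by (subst prod.remove[of _ j]) auto
  moreover have "real (y j - 1) = real (y j) - 1" using False by (simp add: of_nat_diff)
  ultimately show ?thesis using ffall_shift[of "real (y j)" "mult_of \<mu> j"] by (simp add: mult.assoc[symmetric])
qed

lemma ffall_prod_remove:
  assumes "finite \<mu>" "(l, j) \<in> \<mu>" "j \<in> {1..G}" "y j \<ge> 1"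
  shows "real (y j) * ffall_prod G (\<mu> - {(l, j)}) (y(j := y j - 1)) = ffall_prod G \<mu> y"
proof -
  define R where "R = (\<Prod>i\<in>{1..G}-{j}. ffall (real (y i)) (mult_of \<mu> i))"
  have "ffall_prod G (\<mu> - {(l, j)}) (y(j := y j - 1))
      = ffall (real (y j - 1)) (mult_of (\<mu> - {(l, j)}) j) * R"
    unfolding ffall_prod_def R_def using assms mult_of_remove(1)[OF assms(1,2)]
    by (subst prod.remove[of _ j]) (auto intro!: prod.cong arg_cong2[of _ _ _ _ "(*)"])
  moreover have "ffall_prod G \<mu> y = ffall (real (y j)) (Suc (mult_of (\<mu> - {(l, j)}) j)) * R"
    unfolding ffall_prod_def R_def using assms mult_of_remove(2)[OF assms(1,2)]
    by (subst prod.remove[of _ j]) auto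
  moreover have "real (y j - 1) = real (y j) - 1" using assms by (simp add: of_nat_diff)
  ultimately show ?thesis by (simp add: ffall_Suc_left)
qed

text \<open>Double counting: a ball may be removed beside an assignment of balls to \<mu> exactly if
  it is one of the \<open>letter_sum G y - card \<mu>\<close> unassigned balls.\<close>

lemma sum_ffall_prod_upd:
  assumes "finite \<mu>" "snd ` \<mu> \<subseteq> {1..G}"
  shows "(\<Sum>j=1..G. real (y j) * ffall_prod G \<mu> (y(j := y j - 1)))
      = (real (letter_sum G y) - real (card \<mu>)) * ffall_prod G \<mu> y"
proof -
  have "(\<Sum>j=1..G. real (y j) * ffall_prod G \<mu> (y(j := y j - 1)))
     = (\<Sum>j=1..G. real (y j) - real (mult_of \<mu> j)) * ffall_prod G \<mu> y"
    unfolding sum_distrib_right by (intro sum.cong refl ffall_prod_upd)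
  also have "(\<Sum>j=1..G. real (y j) - real (mult_of \<mu> j)) = real (letter_sum G y) - real (card \<mu>)"
    unfolding sum_subtractf sum_mult_of[OF assms, symmetric] letter_sum_def by simp
  finally show ?thesis .
qed

lemma urn_avg_0: "urn_avg G L y s (\<lambda>_. 0) = 0"
  by (induction L arbitrary: y s) simp_all

text \<open>The two hypotheses \<open>s \<le> L\<close> and \<open>s \<le> letter_sum G y\<close> keep the truncated subtractions and the
  divisions by zero in \<open>urn_avg\<close> harmless.\<close>

lemma urn_avg_mono_ind:
  assumes "s \<le> L" "s \<le> letter_sum G y" "finite \<mu>" "inj_on fst \<mu>" "snd ` \<mu> \<subseteq> {1..G}" "fst ` \<mu> \<subseteq> {..<L}"
  shows "urn_avg G L y s (mono_ind \<mu>)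
    = ffall (real s) (card \<mu>) * ffall_prod G \<mu> y / (ffall (real L) (card \<mu>) * ffall (real (letter_sum G y)) (card \<mu>))"
  using assms
proof (induction L arbitrary: y s \<mu>)
  case 0
  hence "\<mu> = {}" by auto
  thus ?case by (simp add: mono_ind_def ffall_prod_def mult_of_def)
next
  case (Suc L)
  note prems = Suc.prems
  define k where "k = card \<mu>"
  define N where "N = ffall_prod G \<mu> y"
  define S where "S = letter_sum G y"
  have kL: "card \<nu> \<le> M" if "inj_on fst \<nu>" "fst ` \<nu> \<subseteq> {..<M}" for \<nu> :: "(nat \<times> nat) set" and M
    using card_inj_on_le[OF that] by simp
  \<comment> \<open>The formula is the probability \<open>ffall s k / ffall L k\<close> that
    \<open>k\<close> given positions are occupied, times the probability that \<open>k\<close> balls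
    drawn in order have given colours. If \<mu> prescribes the letter \<open>j\<close> at position
    \<open>L\<close>, only the branch \<open>j\<close> survives and every falling factorial loses
    its first factor. Otherwise both branches keep \<mu>, and their weights combine to (L + 1 - k) /
    (L + 1).\<close>
  show ?case
  proof (cases "L \<in> fst ` \<mu>")
    case True
    then obtain j where j: "(L, j) \<in> \<mu>" by auto
    define \<mu>' where "\<mu>' = \<mu> - {(L, j)}"
    have jG: "j \<in> {1..G}" using prems(5) j by auto
    have \<mu>': "finite \<mu>'" "inj_on fst \<mu>'" "snd ` \<mu>' \<subseteq> {1..G}" using prems unfolding \<mu>'_def
      by (auto intro: inj_on_subset)
    have notL: "L \<notin> fst ` \<mu>'" unfolding \<mu>'_def using inj_onD[OF prems(4), of _ "(L, j)"] j by force
    have \<mu>'L: "fst ` \<mu>' \<subseteq> {..<L}"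
    proof
      fix l assume l: "l \<in> fst ` \<mu>'"
      hence "l < Suc L" using prems(6) unfolding \<mu>'_def by auto
      thus "l \<in> {..<L}" using l notL by (cases "l = L") auto
    qed
    have "card \<mu> = Suc (card \<mu>')" unfolding \<mu>'_def by (rule card.remove[OF prems(3) j])
    hence kk: "k = Suc (card \<mu>')" by (simp only: k_def)
    have ind: "(\<lambda>w. mono_ind \<mu> (w(L := i))) = (if i = j then mono_ind \<mu>' else (\<lambda>_. 0))" for i
    proof (cases "i = j")
      case True
      have "mono_ind \<mu> (w(L := j)) = mono_ind \<mu>' w" for w
      proof -
        have ne: "l \<noteq> L" if "(l, i) \<in> \<mu>'" for l i using notL that by (metis fst_conv imageI)
        have "\<mu> = insert (L, j) \<mu>'" using j unfolding \<mu>'_def by auto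
        hence "(\<forall>(l, i)\<in>\<mu>. (w(L := j)) l = i) \<longleftrightarrow> (\<forall>(l, i)\<in>\<mu>'. (w(L := j)) l = i)" by simp
        also have "\<dots> \<longleftrightarrow> (\<forall>(l, i)\<in>\<mu>'. w l = i)"
          by (intro ball_cong refl) (auto dest: ne)
        finally have "(\<forall>(l, i)\<in>\<mu>. (w(L := j)) l = i) \<longleftrightarrow> (\<forall>(l, i)\<in>\<mu>'. w l = i)" .
        thus ?thesis by (simp add: mono_ind_def)
      qed
      thus ?thesis using True by auto
    next
      case False
      hence "\<not> (\<forall>(l, b)\<in>\<mu>. (w(L := i)) l = b)" for w
        using j by (intro notI) (auto dest!: bspec[OF _ j])
      thus ?thesis using False by (simp only: mono_ind_def if_False)
    qed
    have term0: "urn_avg G L y' s' (if b then f else (\<lambda>_. 0)) = (if b then urn_avg G L y' s' f else 0)"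
      for y' s' b and f :: "(nat \<Rightarrow> nat) \<Rightarrow> real" by (simp add: urn_avg_0)
    define U where "U i = urn_avg G L (y(i := y i - 1)) (s - 1) (mono_ind \<mu>')" for i
    have "(\<Sum>i=1..G. real (y i) / real S * (if i = j then U i else 0))
        = (\<Sum>i=1..G. if i = j then real (y i) / real S * U i else 0)" by (intro sum.cong) auto
    also have "\<dots> = real (y j) / real S * U j" using jG by (simp add: sum.delta)
    finally have delta: "(\<Sum>i=1..G. real (y i) / real S * (if i = j then U i else 0)) = real (y j) / real S * U j" .
    have "0 \<noteq> j" using jG by simp
    hence "urn_avg G (Suc L) y s (mono_ind \<mu>)
        = real s / real (Suc L) * (\<Sum>i=1..G. real (y i) / real S * (if i = j then U i else 0))"
      unfolding urn_avg.simps ind term0 S_def U_def by simp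
    also have "\<dots> = real s / real (Suc L) * (real (y j) / real S * urn_avg G L (y(j := y j - 1)) (s - 1) (mono_ind \<mu>'))"
      unfolding delta by (simp only: U_def)
    finally have eq: "urn_avg G (Suc L) y s (mono_ind \<mu>) =
      real s / real (Suc L) * (real (y j) / real S * urn_avg G L (y(j := y j - 1)) (s - 1) (mono_ind \<mu>'))" .
    show ?thesis
    proof (cases "s = 0 \<or> y j = 0")
      case True
      have "ffall (real s) k * N = 0"
      proof (cases "s = 0")
        case True
        thus ?thesis unfolding kk ffall_Suc_left by simp
      next
        case False
        hence "ffall (real (y j)) (mult_of \<mu> j) = 0" using \<open>s = 0 \<or> y j = 0\<close>
          unfolding mult_of_remove(2)[OF prems(3) j] ffall_Suc_left by simp
        hence "N = 0" unfolding N_def ffall_prod_def using jG by (intro prod_zero) auto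
        thus ?thesis by simp
      qed
      thus ?thesis unfolding eq N_def[symmetric] k_def[symmetric] using True by auto
    next
      case False
      have tot: "letter_sum G (y(j := y j - 1)) = S - 1" "S \<ge> 1"
        using letter_sum_upd[of j G y] jG False unfolding S_def by auto
      have "urn_avg G L (y(j := y j - 1)) (s - 1) (mono_ind \<mu>')
         = ffall (real (s - 1)) (card \<mu>') * ffall_prod G \<mu>' (y(j := y j - 1)) / (ffall (real L) (card \<mu>') * ffall (real (S - 1)) (card \<mu>'))"
        unfolding tot(1)[symmetric]
      proof (rule Suc.IH[OF _ _ \<mu>' \<mu>'L])
        show "s - 1 \<le> L" using prems(1) by simp
        show "s - 1 \<le> letter_sum G (y(j := y j - 1))" unfolding tot(1) using prems(2) by (simp add: S_def)
      qed
      hence "urn_avg G (Suc L) y s (mono_ind \<mu>) = (real s * ffall (real s - 1) (card \<mu>')) * (real (y j) * ffall_prod G \<mu>' (y(j := y j - 1)))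
         / ((real (Suc L) * ffall (real (Suc L) - 1) (card \<mu>')) * (real S * ffall (real S - 1) (card \<mu>')))"
        unfolding eq using False tot by (simp add: of_nat_diff mult_ac)
      also have "\<dots> = ffall (real s) k * N / (ffall (real (Suc L)) k * ffall (real S) k)"
        unfolding kk ffall_Suc_left N_def \<mu>'_def
        using ffall_prod_remove[of \<mu> L j G y] prems(3) j jG False by simp
      finally show ?thesis unfolding k_def N_def S_def .
    qed
  next
    case False
    have fL: "fst ` \<mu> \<subseteq> {..<L}"
    proof
      fix l assume l: "l \<in> fst ` \<mu>"
      hence "l < Suc L" using prems(6) by auto
      thus "l \<in> {..<L}" using l False by (cases "l = L") auto
    qed
    have kL': "k \<le> L" using kL[OF prems(4) fL] by (simp add: k_def)
    have ind: "(\<lambda>w. mono_ind \<mu> (w(L := i))) = mono_ind \<mu>" for i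
    proof
      fix w
      have ne: "l \<noteq> L" if "(l, i) \<in> \<mu>" for l i using False that by (metis fst_conv imageI)
      have "(\<forall>(l, b)\<in>\<mu>. (w(L := i)) l = b) \<longleftrightarrow> (\<forall>(l, b)\<in>\<mu>. w l = b)"
        by (intro ball_cong refl) (auto dest: ne)
      thus "mono_ind \<mu> (w(L := i)) = mono_ind \<mu> w" by (simp only: mono_ind_def)
    qed
    define u where "u = ffall (real s) k * N / (ffall (real L) k * ffall (real S) k)"
    have e1: "(1 - real s / real (Suc L)) * urn_avg G L y s (mono_ind \<mu>) = (1 - real s / real (Suc L)) * u"
    proof (cases "s = Suc L")
      case False
      thus ?thesis unfolding u_def k_def N_def S_def using prems fL Suc.IH[of s y \<mu>] by simp
    qed simp
    have e2: "real s * (\<Sum>j=1..G. real (y j) / real S * urn_avg G L (y(j := y j - 1)) (s - 1) (mono_ind \<mu>))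
       = (real s - real k) * u"
    proof (cases "s = 0")
      case True
      thus ?thesis unfolding u_def by (cases k) (auto simp: ffall_Suc_left)
    next
      case s: False
      hence S: "S \<ge> 1" "real (S - 1) = real S - 1" "real (s - 1) = real s - 1"
        using prems(2) by (auto simp: S_def of_nat_diff)
      have "(\<Sum>j=1..G. real (y j) / real S * urn_avg G L (y(j := y j - 1)) (s - 1) (mono_ind \<mu>))
        = (\<Sum>j=1..G. real (y j) * ffall_prod G \<mu> (y(j := y j - 1)) * (ffall (real s - 1) k / (real S * (ffall (real L) k * ffall (real S - 1) k))))"
      proof (rule sum.cong[OF refl])
        fix j assume j: "j \<in> {1..G}"
        show "real (y j) / real S * urn_avg G L (y(j := y j - 1)) (s - 1) (mono_ind \<mu>)
          = real (y j) * ffall_prod G \<mu> (y(j := y j - 1)) * (ffall (real s - 1) k / (real S * (ffall (real L) k * ffall (real S - 1) k)))"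
        proof (cases "y j = 0")
          case False
          have tot: "letter_sum G (y(j := y j - 1)) = S - 1" using letter_sum_upd[of j G y] j False unfolding S_def by auto
          have "urn_avg G L (y(j := y j - 1)) (s - 1) (mono_ind \<mu>)
            = ffall (real (s - 1)) (card \<mu>) * ffall_prod G \<mu> (y(j := y j - 1)) / (ffall (real L) (card \<mu>) * ffall (real (S - 1)) (card \<mu>))"
            unfolding tot[symmetric]
          proof (rule Suc.IH[OF _ _ prems(3-5) fL])
            show "s - 1 \<le> L" using prems(1) by simp
            show "s - 1 \<le> letter_sum G (y(j := y j - 1))" unfolding tot using prems(2) by (simp add: S_def)
          qed
          thus ?thesis unfolding k_def S by simp
        qed simp
      qed
      also have "\<dots> = (real S - real k) * N * (ffall (real s - 1) k / (real S * (ffall (real L) k * ffall (real S - 1) k)))"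
        unfolding sum_distrib_right[symmetric] sum_ffall_prod_upd[OF prems(3,5)] N_def k_def S_def ..
      finally have E: "real s * (\<Sum>j=1..G. real (y j) / real S * urn_avg G L (y(j := y j - 1)) (s - 1) (mono_ind \<mu>))
         = (real S - real k) * N * ((real s * ffall (real s - 1) k) / (ffall (real L) k * (real S * ffall (real S - 1) k)))"
        by (simp add: mult_ac)
      show ?thesis
      \<comment> \<open>Here the factor \<open>S - k\<close> cannot be cancelled, but
        \<open>s \<le> S = k\<close> makes both sides 0.\<close>
      proof (cases "real S = real k")
        case True
        have "(real s - real k) * ffall (real s) k = 0"
        proof (cases "s = k")
          case False
          hence "s < k" using True prems(2) by (auto simp: S_def)
          hence "ffall (real s) k = 0" unfolding ffall_def by (intro prod_zero) auto
          thus ?thesis by simp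
        qed simp
        thus ?thesis unfolding E u_def using True by auto
      next
        case False
        have "c * N * (t * f / (l * (c * g))) = t * (f * N / (l * g))" if "c \<noteq> 0" for c t f l g :: real
          using that by simp
        thus ?thesis unfolding E ffall_shift u_def using False by (metis right_minus_eq)
      qed
    qed
    have "urn_avg G (Suc L) y s (mono_ind \<mu>) = (1 - real s / real (Suc L)) * u + (real s - real k) * u / real (Suc L)"
      unfolding urn_avg.simps ind e1 e2[symmetric] S_def[symmetric] by simp
    also have "\<dots> = (real (Suc L) - real k) / real (Suc L) * u"
    proof -
      have gen: "(1 - s' / x) * u + (s' - k') * u / x = (x - k') / x * u" if "x \<noteq> 0" for x s' k' :: real
        using that by (simp add: field_simps)
      show ?thesis by (rule gen) (rule of_nat_neq_0)
    qed
    also have "\<dots> = ffall (real s) k * N / ((real (Suc L) * ffall (real L) k) / (real (Suc L) - real k) * ffall (real S) k)"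
    proof -
      have gen: "a / x * (f / (l * g)) = f / ((x * l) / a * g)" for a x f l g :: real by (simp add: mult_ac)
      show ?thesis unfolding u_def by (rule gen)
    qed
    also have "(real (Suc L) * ffall (real L) k) / (real (Suc L) - real k) = ffall (real (Suc L)) k"
      using ffall_shift[of "real (Suc L)" k] kL' by simp
    finally show ?thesis unfolding k_def N_def S_def .
  qed
qed

section \<open>Independent letter counts\<close>

text \<open>Expectation under the product law as an iterated finite sum; coordinates outside
  \<open>{1..G}\<close> are 0 throughout.\<close>

primrec iid_avg :: "(nat \<Rightarrow> real) \<Rightarrow> nat set \<Rightarrow> nat \<Rightarrow> ((nat \<Rightarrow> nat) \<Rightarrow> real) \<Rightarrow> real" where
  "iid_avg \<nu> X 0 f = f (\<lambda>_. 0)"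
| "iid_avg \<nu> X (Suc G) f = (\<Sum>x\<in>X. \<nu> x * iid_avg \<nu> X G (\<lambda>y. f (y(Suc G := x))))"

lemma iid_avg_sum: "iid_avg \<nu> X G (\<lambda>y. \<Sum>i\<in>F. c i * f i y) = (\<Sum>i\<in>F. c i * iid_avg \<nu> X G (f i))"
proof (induction G arbitrary: f)
  case (Suc G)
  show ?case unfolding iid_avg.simps Suc
    by (simp add: sum_distrib_left, subst sum.swap) (simp add: mult_ac)
qed simp

lemma iid_avg_cmult: "iid_avg \<nu> X G (\<lambda>y. c * f y) = c * iid_avg \<nu> X G f"
  using iid_avg_sum[of \<nu> X G "\<lambda>_. c" "\<lambda>_. f" "{()}"] by simp

lemma iid_avg_add: "iid_avg \<nu> X G (\<lambda>y. f y + g y) = iid_avg \<nu> X G f + iid_avg \<nu> X G g"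
  by (induction G arbitrary: f g) (simp_all add: distrib_left sum.distrib)

lemma iid_avg_diff: "iid_avg \<nu> X G (\<lambda>y. f y - g y) = iid_avg \<nu> X G f - iid_avg \<nu> X G g"
  by (induction G arbitrary: f g) (simp_all add: right_diff_distrib sum_subtractf)

lemma iid_avg_const: "(\<Sum>x\<in>X. \<nu> x) = 1 \<Longrightarrow> iid_avg \<nu> X G (\<lambda>_. c) = c"
  by (induction G) (simp_all flip: sum_distrib_right)

lemma iid_avg_mono:
  assumes "\<And>x. x \<in> X \<Longrightarrow> 0 \<le> \<nu> x"
    and "\<And>y. (\<And>j. j \<in> {1..G} \<Longrightarrow> y j \<in> X) \<Longrightarrow> f y \<le> g y"
  shows "iid_avg \<nu> X G f \<le> iid_avg \<nu> X G g"
  using assms(2)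
proof (induction G arbitrary: f g)
  case (Suc G)
  show ?case unfolding iid_avg.simps
  proof (intro sum_mono mult_left_mono Suc.IH)
    fix x y assume x: "x \<in> X" and y: "\<And>j. j \<in> {1..G} \<Longrightarrow> y j \<in> X"
    show "f (y(Suc G := x)) \<le> g (y(Suc G := x))"
    proof (rule Suc.prems)
      fix j assume "j \<in> {1..Suc G}"
      thus "(y(Suc G := x)) j \<in> X" using x y by (cases "j = Suc G") auto
    qed
  qed (use assms(1) in auto)
qed simp

lemma iid_avg_prod:
  "iid_avg \<nu> X G (\<lambda>y. \<Prod>j=1..G. f j (y j)) = (\<Prod>j=1..G. \<Sum>x\<in>X. \<nu> x * f j x)"
proof (induction G)
  case (Suc G)
  have "iid_avg \<nu> X (Suc G) (\<lambda>y. \<Prod>j=1..Suc G. f j (y j))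
      = (\<Sum>x\<in>X. \<nu> x * iid_avg \<nu> X G (\<lambda>y. f (Suc G) x * (\<Prod>j=1..G. f j (y j))))"
    unfolding iid_avg.simps
    by (intro sum.cong refl arg_cong2[of _ _ _ _ "(*)"] arg_cong[of _ _ "iid_avg \<nu> X G"] ext)
       (auto simp: mult.commute intro!: prod.cong)
  also have "\<dots> = (\<Sum>x\<in>X. \<nu> x * f (Suc G) x) * (\<Prod>j=1..G. \<Sum>x\<in>X. \<nu> x * f j x)"
    unfolding iid_avg_cmult Suc sum_distrib_right by (simp add: mult.assoc)
  finally show ?case by (simp add: mult.commute)
qed simp

lemma iid_avg_variance:
  assumes tot: "(\<Sum>x\<in>X. \<nu> x) = 1" and mean: "(\<Sum>x\<in>X. \<nu> x * f x) = 0"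
  shows "iid_avg \<nu> X G (\<lambda>y. (\<Sum>j=1..G. f (y j))\<^sup>2) = real G * (\<Sum>x\<in>X. \<nu> x * (f x)\<^sup>2)"
proof -
  have m: "iid_avg \<nu> X G (\<lambda>y. \<Sum>j=1..G. f (y j)) = 0" for G
  proof (induction G)
    case (Suc G)
    have "iid_avg \<nu> X (Suc G) (\<lambda>y. \<Sum>j=1..Suc G. f (y j))
      = (\<Sum>x\<in>X. \<nu> x * iid_avg \<nu> X G (\<lambda>y. f x + (\<Sum>j=1..G. f (y j))))"
      unfolding iid_avg.simps
      by (intro sum.cong refl arg_cong2[of _ _ _ _ "(*)"] arg_cong[of _ _ "iid_avg \<nu> X G"] ext)
         (auto simp: add.commute intro!: sum.cong)
    thus ?case unfolding iid_avg_add Suc iid_avg_const[OF tot] using mean by simp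
  qed simp
  show ?thesis
  proof (induction G)
    case (Suc G)
    have "iid_avg \<nu> X (Suc G) (\<lambda>y. (\<Sum>j=1..Suc G. f (y j))\<^sup>2)
      = (\<Sum>x\<in>X. \<nu> x * iid_avg \<nu> X G (\<lambda>y. (f x)\<^sup>2 + ((2 * f x) * (\<Sum>j=1..G. f (y j)) + (\<Sum>j=1..G. f (y j))\<^sup>2)))"
      unfolding iid_avg.simps
    proof (intro sum.cong refl arg_cong2[of _ _ _ _ "(*)"] arg_cong[of _ _ "iid_avg \<nu> X G"] ext)
      fix x y
      have "(\<Sum>j=1..Suc G. f ((y(Suc G := x)) j)) = f x + (\<Sum>j=1..G. f (y j))"
        by (auto simp: add.commute intro!: sum.cong)
      thus "(\<Sum>j=1..Suc G. f ((y(Suc G := x)) j))\<^sup>2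
        = (f x)\<^sup>2 + ((2 * f x) * (\<Sum>j=1..G. f (y j)) + (\<Sum>j=1..G. f (y j))\<^sup>2)"
        by (simp add: power2_eq_square algebra_simps)
    qed
    also have "\<dots> = (\<Sum>x\<in>X. \<nu> x * ((f x)\<^sup>2 + real G * (\<Sum>x\<in>X. \<nu> x * (f x)\<^sup>2)))"
      unfolding iid_avg_add iid_avg_cmult m Suc iid_avg_const[OF tot] by simp
    also have "\<dots> = real (Suc G) * (\<Sum>x\<in>X. \<nu> x * (f x)\<^sup>2)"
      by (simp add: distrib_left sum.distrib tot flip: sum_distrib_right) (simp add: algebra_simps)
    finally show ?case .
  qed simp
qed

lemma power_div_fact_le_exp: "0 \<le> (x::real) \<Longrightarrow> x ^ n / fact n \<le> exp x"
proof -
  assume x: "0 \<le> x"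
  have "x ^ n / fact n = (\<Sum>i\<in>{n}. inverse (fact i) * x ^ i)" by (simp add: field_simps)
  also have "\<dots> \<le> (\<Sum>i. inverse (fact i) * x ^ i)"
    using x summable_exp[of x] by (intro sum_le_suminf) auto
  also have "\<dots> = exp x" by (simp add: exp_def scaleR_conv_of_real divide_inverse)
  finally show ?thesis .
qed

text \<open>A partial product of sinh(pi sqrt z) / (pi sqrt z). It is split at \<open>r\<close>, the
  ceiling of \<open>sqrt z\<close>: up to \<open>r\<close> each factor is at most 2 (r / i)^2, and
  r^r / r! \<le> exp r yields exp(3 r); beyond \<open>r\<close> the bound 1 + t \<le> exp t and a
  telescoping sum below 1 / r yield exp r.\<close>

lemma prod_one_plus_inverse_squares:
  assumes z: "0 \<le> z"
  shows "(\<Prod>i=1..D. 1 + z / (real i)\<^sup>2) \<le> exp (4 * sqrt z + 4)"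
proof -
  define r where "r = nat \<lceil>sqrt z\<rceil>"
  have r: "sqrt z \<le> real r" "real r \<le> sqrt z + 1"
    unfolding r_def using z by (simp_all add: real_nat_ceiling_ge of_nat_nat)
  have zr: "z \<le> (real r)\<^sup>2" using r(1) z by (metis real_sqrt_pow2 real_sqrt_ge_zero power_mono)
  have "(\<Prod>i=1..D. 1 + z / (real i)\<^sup>2) \<le> (\<Prod>i=1..D. 1 + (real r)\<^sup>2 / (real i)\<^sup>2)"
    using z zr by (intro prod_mono conjI add_left_mono divide_right_mono) (auto intro!: add_nonneg_nonneg)
  also have "\<dots> \<le> (\<Prod>i=1..r+D. 1 + (real r)\<^sup>2 / (real i)\<^sup>2)"
    by (rule prod_mono2) auto
  also have "\<dots> = (\<Prod>i=1..r. 1 + (real r)\<^sup>2 / (real i)\<^sup>2) * (\<Prod>i=r+1..r+D. 1 + (real r)\<^sup>2 / (real i)\<^sup>2)"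
    by (rule prod.ub_add_nat) simp
  finally have split: "(\<Prod>i=1..D. 1 + z / (real i)\<^sup>2)
     \<le> (\<Prod>i=1..r. 1 + (real r)\<^sup>2 / (real i)\<^sup>2) * (\<Prod>i=r+1..r+D. 1 + (real r)\<^sup>2 / (real i)\<^sup>2)" .
  have low: "(\<Prod>i=1..r. 1 + (real r)\<^sup>2 / (real i)\<^sup>2) \<le> exp (3 * real r)"
  proof -
    have "(\<Prod>i=1..r. 1 + (real r)\<^sup>2 / (real i)\<^sup>2) \<le> (\<Prod>i=1..r. 2 * ((real r / real i) * (real r / real i)))"
    proof (intro prod_mono conjI)
      fix i assume i: "i \<in> {1..r}"
      have "1 \<le> real r / real i" using i by simp
      hence "1 * 1 \<le> (real r / real i) * (real r / real i)" by (intro mult_mono) auto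
      thus "1 + (real r)\<^sup>2 / (real i)\<^sup>2 \<le> 2 * ((real r / real i) * (real r / real i))"
        by (simp add: power2_eq_square)
    qed auto
    also have "\<dots> = 2 ^ r * ((\<Prod>i=1..r. real r / real i) * (\<Prod>i=1..r. real r / real i))"
      by (simp only: prod.distrib) simp
    also have "(\<Prod>i=1..r. real r / real i) = real r ^ r / fact r"
      by (simp add: prod_dividef fact_prod)
    also have "2 ^ r * (real r ^ r / fact r * (real r ^ r / fact r)) \<le> exp (real r) * (exp (real r) * exp (real r))"
    proof (intro mult_mono power_div_fact_le_exp)
      have "(2::real) ^ r \<le> exp 1 ^ r" using exp_ge_add_one_self[of 1] by (intro power_mono) auto
      thus "2 ^ r \<le> exp (real r)" by (simp flip: exp_of_nat_mult)
    qed auto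
    also have "\<dots> = exp (3 * real r)" by (simp flip: exp_add)
    finally show ?thesis .
  qed
  have high: "(\<Prod>i=r+1..r+D. 1 + (real r)\<^sup>2 / (real i)\<^sup>2) \<le> exp (real r)"
  proof (cases "r = 0")
    case False
    have s: "(\<Sum>i=r+1..r+D. 1 / (real i)\<^sup>2) \<le> 1 / real r - 1 / real (r + D)"
    proof (induction D)
      case (Suc D)
      have "1 / (real (Suc (r + D)))\<^sup>2 \<le> 1 / real (r + D) - 1 / real (Suc (r + D))"
        using False by (simp add: divide_simps power2_eq_square)
      thus ?case using Suc by simp
    qed simp
    have "(\<Prod>i=r+1..r+D. 1 + (real r)\<^sup>2 / (real i)\<^sup>2) \<le> (\<Prod>i=r+1..r+D. exp ((real r)\<^sup>2 * (1 / (real i)\<^sup>2)))"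
      using exp_ge_add_one_self by (intro prod_mono conjI) (auto intro!: add_nonneg_nonneg)
    also have "\<dots> = exp ((real r)\<^sup>2 * (\<Sum>i=r+1..r+D. 1 / (real i)\<^sup>2))"
      by (simp add: exp_sum sum_distrib_left)
    also have "\<dots> \<le> exp ((real r)\<^sup>2 * (1 / real r))"
    proof -
      have "(\<Sum>i=r+1..r+D. 1 / (real i)\<^sup>2) \<le> 1 / real r"
        using s by (rule order_trans) simp
      thus ?thesis by (intro iffD2[OF exp_le_cancel_iff] mult_left_mono) auto
    qed
    also have "\<dots> = exp (real r)" using False by (simp add: power2_eq_square)
    finally show ?thesis .
  qed simp
  note split
  also have "(\<Prod>i=1..r. 1 + (real r)\<^sup>2 / (real i)\<^sup>2) * (\<Prod>i=r+1..r+D. 1 + (real r)\<^sup>2 / (real i)\<^sup>2)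
      \<le> exp (3 * real r) * exp (real r)"
    by (intro mult_mono low high prod_nonneg) auto
  also have "\<dots> = exp (4 * real r)" by (simp flip: exp_add)
  also have "\<dots> \<le> exp (4 * sqrt z + 4)" using r by simp
  finally show ?thesis .
qed

section \<open>Growth of bounded polynomials\<close>

lemma cratio_le_1: "m \<le> D \<Longrightarrow> cratio D m \<le> 1"
  by (rule order_trans[OF cratio_le]) auto

text \<open>Lagrange interpolation at the points \<open>a * D\<^sup>2 - a * j\<^sup>2\<close>: a polynomial of degree at most \<open>D\<close>
  that is bounded on the integers of an interval of length at least \<open>D\<^sup>2\<close> grows at most like
  a Chebyshev polynomial outside of it.\<close>

lemma poly_growth:
  fixes h :: "real poly"
  assumes deg: "degree h \<le> D" and a: "a \<ge> 1" and D: "D \<ge> 1"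
    and bnd: "\<And>n. n \<le> a * D\<^sup>2 \<Longrightarrow> \<bar>poly h (real n)\<bar> \<le> 1"
    and S: "a * D\<^sup>2 \<le> S"
  shows "\<bar>poly h (real S)\<bar> \<le> (2 * real D + 1) * exp (4 * sqrt ((real S - real (a * D\<^sup>2)) / real a) + 4)"
proof -
  define z where "z = (real S - real (a * D\<^sup>2)) / real a"
  \<comment> \<open>Measured from the endpoint \<open>a * D\<^sup>2\<close> in units of
    \<open>a\<close>, these points are the squares, so that \<open>prod_square_ratio\<close>
    evaluates the interpolation coefficients. All of them are integers of the interval.\<close>
  define x where "x j = real (a * D\<^sup>2 - a * j\<^sup>2)" for j
  define R where "R = (\<Prod>i=1..D. 1 + z / (real i)\<^sup>2)"
  define T where "T j = (\<Prod>i\<in>{0..D}-{j}. (real S - x i) / (x j - x i))" for j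
  have "real (a * D\<^sup>2) \<le> real S" using S by (simp only: of_nat_le_iff)
  hence z: "z \<ge> 0" unfolding z_def by (intro divide_nonneg_nonneg) auto
  have ra: "real a > 0" using a by simp
  have xle: "a * j\<^sup>2 \<le> a * D\<^sup>2" if "j \<le> D" for j using that by (intro mult_left_mono power_mono) auto
  have x: "x j = real a * ((real D)\<^sup>2 - (real j)\<^sup>2)" if "j \<le> D" for j
    unfolding x_def using xle[OF that] by (simp add: of_nat_diff algebra_simps)
  have injx: "inj_on x {0..D}"
  proof (rule inj_onI)
    fix i j assume ij: "i \<in> {0..D}" "j \<in> {0..D}" "x i = x j"
    hence "(real i)\<^sup>2 = (real j)\<^sup>2" using x[of i] x[of j] ra by simp
    thus "i = j" by (simp add: power2_eq_iff_nonneg)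
  qed
  have "poly h (real S) = (\<Sum>u\<in>x ` {0..D}. poly h u * (\<Prod>v\<in>x ` {0..D} - {u}. (real S - v) / (u - v)))"
    by (rule lagrange_interpolation) (use deg in \<open>auto simp: card_image[OF injx]\<close>)
  also have "\<dots> = (\<Sum>j=0..D. poly h (x j) * T j)"
  proof (subst sum.reindex[OF injx], unfold o_def, rule sum.cong[OF refl])
    fix j assume j: "j \<in> {0..D}"
    have "x ` {0..D} - {x j} = x ` ({0..D} - {j})" using injx j by (auto simp: inj_on_def)
    moreover have "inj_on x ({0..D} - {j})" using injx by (rule inj_on_subset) auto
    ultimately show "poly h (x j) * (\<Prod>v\<in>x ` {0..D} - {x j}. (real S - v) / (x j - v)) = poly h (x j) * T j"
      unfolding T_def by (simp add: prod.reindex)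
  qed
  finally have lag: "poly h (real S) = (\<Sum>j=0..D. poly h (x j) * T j)" .
  have fac: "\<bar>(real S - x i) / (x j - x i)\<bar> = (z + (real i)\<^sup>2) / \<bar>(real i)\<^sup>2 - (real j)\<^sup>2\<bar>"
    if "i \<le> D" "j \<le> D" for i j
  proof -
    have 1: "real S - x i = real a * (z + (real i)\<^sup>2)" unfolding x[OF that(1)] z_def using ra
      by (simp add: field_simps)
    have 2: "x j - x i = real a * ((real i)\<^sup>2 - (real j)\<^sup>2)" unfolding x[OF that(1)] x[OF that(2)]
      by (simp add: algebra_simps)
    have "0 \<le> z + (real i)\<^sup>2" using z by simp
    thus ?thesis unfolding 1 2 using ra by (simp add: abs_mult)
  qed
  have Rpos: "R \<ge> 1" unfolding R_def using z by (intro prod_ge_1) auto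
  have T0: "\<bar>T 0\<bar> = R"
  proof -
    have "\<bar>T 0\<bar> = (\<Prod>i\<in>{0..D}-{0}. (z + (real i)\<^sup>2) / \<bar>(real i)\<^sup>2 - (real 0)\<^sup>2\<bar>)"
      unfolding T_def abs_prod using fac[of _ 0] by (intro prod.cong) auto
    also have "\<dots> = R" unfolding R_def by (intro prod.cong) (auto simp: field_simps)
    finally show ?thesis .
  qed
  have Tj: "\<bar>T j\<bar> \<le> 2 * R" if j: "j \<in> {1..D}" for j
  proof -
    have "\<bar>T j\<bar> = (\<Prod>i\<in>{0..D}-{j}. (z + (real i)\<^sup>2) / \<bar>(real i)\<^sup>2 - (real j)\<^sup>2\<bar>)"
      unfolding T_def abs_prod using fac[of _ j] j by (intro prod.cong) auto
    also have "{0..D}-{j} = insert 0 ({1..D}-{j})" using j by auto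
    also have "(\<Prod>i\<in>\<dots>. (z + (real i)\<^sup>2) / \<bar>(real i)\<^sup>2 - (real j)\<^sup>2\<bar>)
        = z / (real j)\<^sup>2 * (\<Prod>i\<in>{1..D}-{j}. (real i)\<^sup>2 / \<bar>(real i)\<^sup>2 - (real j)\<^sup>2\<bar> * (1 + z / (real i)\<^sup>2))"
    proof (subst prod.insert, simp, simp, intro arg_cong2[of _ _ _ _ "(*)"] prod.cong refl)
      fix i assume "i \<in> {1..D} - {j}"
      hence "(real i)\<^sup>2 * (1 + z / (real i)\<^sup>2) = z + (real i)\<^sup>2" by (simp add: distrib_left)
      thus "(z + (real i)\<^sup>2) / \<bar>(real i)\<^sup>2 - (real j)\<^sup>2\<bar> = (real i)\<^sup>2 / \<bar>(real i)\<^sup>2 - (real j)\<^sup>2\<bar> * (1 + z / (real i)\<^sup>2)"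
        by simp
    qed simp
    also have "\<dots> = z / (real j)\<^sup>2 * (2 * cratio D j * (\<Prod>i\<in>{1..D}-{j}. 1 + z / (real i)\<^sup>2))"
      unfolding prod.distrib using prod_square_ratio[of j D] j by simp
    \<comment> \<open>Enlarging \<open>z / j\<^sup>2\<close> to \<open>1 + z / j\<^sup>2\<close>
      restores the factor of \<open>R\<close> that the product over \<open>i \<noteq> j\<close>
      lacks.\<close>
    also have "\<dots> \<le> (1 + z / (real j)\<^sup>2) * (2 * 1 * (\<Prod>i\<in>{1..D}-{j}. 1 + z / (real i)\<^sup>2))"
      using cratio_le_1[of j D] cratio_nonneg[of D j] j z by (intro mult_mono) (auto intro!: prod_nonneg mult_nonneg_nonneg)
    also have "\<dots> = 2 * R" unfolding R_def using j by (subst (2) prod.remove[of _ j]) auto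
    finally show ?thesis .
  qed
  have hb: "\<bar>poly h (x j)\<bar> \<le> 1" for j unfolding x_def by (rule bnd) simp
  have "\<bar>poly h (real S)\<bar> \<le> (\<Sum>j=0..D. \<bar>poly h (x j)\<bar> * \<bar>T j\<bar>)"
    unfolding lag abs_mult[symmetric] by (rule sum_abs)
  also have "\<dots> \<le> (\<Sum>j=0..D. 1 * \<bar>T j\<bar>)" using hb by (intro sum_mono mult_right_mono) auto
  also have "\<dots> = \<bar>T 0\<bar> + (\<Sum>j=1..D. \<bar>T j\<bar>)" by (simp add: sum.atLeast_Suc_atMost)
  also have "\<dots> \<le> R + (\<Sum>j=1..D. 2 * R)" unfolding T0 using Tj by (intro add_left_mono sum_mono) auto
  also have "\<dots> = (2 * real D + 1) * R" by (simp add: algebra_simps)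
  also have "\<dots> \<le> (2 * real D + 1) * exp (4 * sqrt z + 4)"
    unfolding R_def using prod_one_plus_inverse_squares[OF z] by (intro mult_left_mono) auto
  finally show ?thesis unfolding z_def .
qed

text \<open>Origin of 12200 = 4 * 3050. By the inequality of the means the growth exponent is at
  most S / (4D) + 16 D / a, half of the available S / (2D) plus at most D. The other half is at
  least 3050 D: 3000 D of it pay for \<open>3000 * G / D\<close>, the normalisation of the tail, and
  50 D for the factor 50, the factor 2D + 1 and the constants.\<close>

lemma growth_vs_tail:
  assumes a: "a \<ge> 12200" and D: "D \<ge> 1" and G: "G \<le> D\<^sup>2" and S: "a * D\<^sup>2 \<le> S"
  shows "50 * ((2 * real D + 1) * exp (4 * sqrt ((real S - real (a * D\<^sup>2)) / real a) + 4))
    \<le> exp (real S / (2 * real D)) * exp (- (3000 * real G / real D))"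
proof -
  have D1: "real D \<ge> 1" and a1: "real a \<ge> 12200" using D a by auto
  have S1: "real a * (real D)\<^sup>2 \<le> real S" using S by (metis of_nat_le_iff of_nat_mult of_nat_power)
  have e: "(50::real) \<le> exp 8"
  proof -
    have "(2::real) ^ 8 \<le> exp 1 ^ 8" using exp_ge_add_one_self[of 1] by (intro power_mono) auto
    thus ?thesis by (simp flip: exp_of_nat_mult)
  qed
  have e2: "2 * real D + 1 \<le> exp (2 * real D)" using exp_ge_add_one_self[of "2 * real D"] by linarith
  have "4 * sqrt ((real S - real (a * D\<^sup>2)) / real a) \<le> 4 * sqrt (real S / real a)"
    using a1 by (intro mult_left_mono real_sqrt_le_mono divide_right_mono) auto
  also have "\<dots> \<le> real S / (4 * real D) + 16 * real D / real a"
  proof -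
    define u where "u = sqrt (real S / (4 * real D))"
    define v where "v = sqrt (16 * real D / real a)"
    have "u * v = sqrt ((real S / (4 * real D)) * (16 * real D / real a))"
      unfolding u_def v_def by (rule real_sqrt_mult[symmetric])
    also have "(real S / (4 * real D)) * (16 * real D / real a) = 4 * (real S / real a)"
      using D1 by (simp add: field_simps)
    finally have uv: "u * v = 2 * sqrt (real S / real a)" using real_sqrt_mult[of 4 "real S / real a"] by simp
    have "0 \<le> (u - v)\<^sup>2" by simp
    hence "2 * (u * v) \<le> u\<^sup>2 + v\<^sup>2" by (simp add: power2_eq_square algebra_simps)
    thus ?thesis unfolding uv unfolding u_def v_def using D1 a1 by simp
  qed
  also have "16 * real D / real a \<le> real D" using D1 a1 by (simp add: divide_le_eq)
  finally have 1: "4 * sqrt ((real S - real (a * D\<^sup>2)) / real a) \<le> real S / (4 * real D) + real D" by simp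
  have "3000 * real G / real D \<le> 3000 * real D"
  proof -
    have "real G \<le> real D * real D" using G by (metis of_nat_le_iff of_nat_mult power2_eq_square)
    thus ?thesis using D1 by (simp add: divide_le_eq)
  qed
  moreover have "3050 * real D \<le> real S / (4 * real D)"
  proof -
    have "12200 * (real D)\<^sup>2 \<le> real a * (real D)\<^sup>2" using a1 by (intro mult_right_mono) auto
    hence "12200 * (real D)\<^sup>2 \<le> real S" using S1 by linarith
    thus ?thesis using D1 by (simp add: le_divide_eq power2_eq_square)
  qed
  moreover have "real S / (2 * real D) = real S / (4 * real D) + real S / (4 * real D)" by simp
  ultimately have fin: "8 + (2 * real D + (4 * sqrt ((real S - real (a * D\<^sup>2)) / real a) + 4))
      \<le> real S / (2 * real D) + - (3000 * real G / real D)"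
    using 1 D1 by linarith
  have "50 * ((2 * real D + 1) * exp (4 * sqrt ((real S - real (a * D\<^sup>2)) / real a) + 4))
     \<le> exp 8 * (exp (2 * real D) * exp (4 * sqrt ((real S - real (a * D\<^sup>2)) / real a) + 4))"
    using e e2 by (intro mult_mono) auto
  also have "\<dots> \<le> exp (real S / (2 * real D)) * exp (- (3000 * real G / real D))"
    unfolding exp_add[symmetric] using fin by simp
  finally show ?thesis .
qed

section \<open>The averaged acceptance polynomial, on the words and beyond them\<close>

lemma ffall_prod_eq_0:
  assumes "finite \<mu>" "snd ` \<mu> \<subseteq> {1..G}" "letter_sum G y < card \<mu>"
  shows "ffall_prod G \<mu> y = 0"
proof -
  have "\<exists>j\<in>{1..G}. y j < mult_of \<mu> j"
  proof (rule ccontr)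
    assume "\<not> ?thesis"
    hence "(\<Sum>j=1..G. mult_of \<mu> j) \<le> letter_sum G y" unfolding letter_sum_def by (intro sum_mono) (auto simp: not_less)
    thus False using assms sum_mult_of[of \<mu> G] by simp
  qed
  then obtain j where j: "j \<in> {1..G}" "y j < mult_of \<mu> j" by blast
  hence "ffall (real (y j)) (mult_of \<mu> j) = 0" unfolding ffall_def by (intro prod_zero) auto
  thus ?thesis unfolding ffall_prod_def using j by (intro prod_zero) auto
qed

text \<open>Letter 0 is left out, being determined by the absence of the others. Injectivity of
  \<open>fst\<close> makes \<open>card \<mu>\<close> the number of positions involved.\<close>

definition is_monomial :: "nat \<Rightarrow> nat \<Rightarrow> nat \<Rightarrow> (nat \<times> nat) set \<Rightarrow> bool" where
  "is_monomial G L d \<mu> \<longleftrightarrow> finite \<mu> \<and> inj_on fst \<mu> \<and> snd ` \<mu> \<subseteq> {1..G} \<and> fst ` \<mu> \<subseteq> {..<L} \<and> card \<mu> \<le> d"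

text \<open>The urn average with all balls placed, after cancelling the falling factorials of
  \<open>s = letter_sum G y\<close>. In this form it is a polynomial in the counts and makes sense
  also when their sum exceeds \<open>L\<close>.\<close>

definition avg_poly :: "nat \<Rightarrow> nat \<Rightarrow> (nat \<times> nat) set set \<Rightarrow> ((nat \<times> nat) set \<Rightarrow> real) \<Rightarrow> (nat \<Rightarrow> nat) \<Rightarrow> real" where
  "avg_poly G L F c y = (\<Sum>\<mu>\<in>F. c \<mu> * (ffall_prod G \<mu> y / ffall (real L) (card \<mu>)))"

lemma urn_avg_poly:
  assumes "\<And>\<mu>. \<mu> \<in> F \<Longrightarrow> is_monomial G L d \<mu>" "s \<le> L" "s \<le> letter_sum G y"
  shows "urn_avg G L y s (\<lambda>w. \<Sum>\<mu>\<in>F. c \<mu> * mono_ind \<mu> w)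
    = (\<Sum>\<mu>\<in>F. c \<mu> * (ffall (real s) (card \<mu>) * ffall_prod G \<mu> y / (ffall (real L) (card \<mu>) * ffall (real (letter_sum G y)) (card \<mu>))))"
  unfolding urn_avg_sum
  by (intro sum.cong refl arg_cong2[of _ _ _ _ "(*)"] urn_avg_mono_ind) (use assms in \<open>auto simp: is_monomial_def\<close>)

lemma avg_poly_eq_urn_avg:
  assumes F: "\<And>\<mu>. \<mu> \<in> F \<Longrightarrow> is_monomial G L d \<mu>" and y: "letter_sum G y \<le> L"
  shows "avg_poly G L F c y = urn_avg G L y (letter_sum G y) (\<lambda>w. \<Sum>\<mu>\<in>F. c \<mu> * mono_ind \<mu> w)"
proof -
  have "urn_avg G L y (letter_sum G y) (\<lambda>w. \<Sum>\<mu>\<in>F. c \<mu> * mono_ind \<mu> w)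
    = (\<Sum>\<mu>\<in>F. c \<mu> * (ffall (real (letter_sum G y)) (card \<mu>) * ffall_prod G \<mu> y
        / (ffall (real L) (card \<mu>) * ffall (real (letter_sum G y)) (card \<mu>))))"
    by (rule urn_avg_poly[OF F y order_refl])
  also have "\<dots> = avg_poly G L F c y" unfolding avg_poly_def
proof (intro sum.cong refl arg_cong2[of _ _ _ _ "(*)"])
  fix \<mu> assume "\<mu> \<in> F"
  hence \<mu>: "finite \<mu>" "snd ` \<mu> \<subseteq> {1..G}" using F by (auto simp: is_monomial_def)
  show "ffall (real (letter_sum G y)) (card \<mu>) * ffall_prod G \<mu> y
      / (ffall (real L) (card \<mu>) * ffall (real (letter_sum G y)) (card \<mu>)) = ffall_prod G \<mu> y / ffall (real L) (card \<mu>)"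
  \<comment> \<open>Without this bound the cancelled falling factorial is 0, but then
    \<open>ffall_prod\<close> vanishes as well.\<close>
  proof (cases "card \<mu> \<le> letter_sum G y")
    case True
    thus ?thesis using ffall_pos[OF True] by simp
  qed (use ffall_prod_eq_0[OF \<mu>] in simp)
qed
  finally show ?thesis by simp
qed

text \<open>For fixed \<open>y\<close> with at least \<open>L\<close> balls, placing only
  \<open>s \<le> L\<close> of them is possible, and the average is a polynomial \<open>h\<close> in
  \<open>s\<close> of degree at most \<open>D\<close>, bounded by 1 at the integers up to
  \<open>L\<close>. Its value at \<open>s = letter_sum G y\<close> is \<open>avg_poly\<close>, so
  \<open>poly_growth\<close> applies.\<close>

lemma avg_poly_growth:
  assumes F: "\<And>\<mu>. \<mu> \<in> F \<Longrightarrow> is_monomial G L D \<mu>" and finF: "finite F"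
    and bnd: "\<And>w. (\<forall>l. w l \<le> G) \<Longrightarrow> \<bar>\<Sum>\<mu>\<in>F. c \<mu> * mono_ind \<mu> w\<bar> \<le> 1"
    and a: "a \<ge> 1" and D: "D \<ge> 1" and L: "L = a * D\<^sup>2" and S: "L \<le> letter_sum G y"
  shows "\<bar>avg_poly G L F c y\<bar> \<le> (2 * real D + 1) * exp (4 * sqrt ((real (letter_sum G y) - real (a * D\<^sup>2)) / real a) + 4)"
proof -
  define h where "h = (\<Sum>\<mu>\<in>F. Polynomial.smult (c \<mu> * (ffall_prod G \<mu> y / (ffall (real L) (card \<mu>) * ffall (real (letter_sum G y)) (card \<mu>)))) (ffall_poly (card \<mu>)))"
  have hs: "poly h (real s) = urn_avg G L y s (\<lambda>w. \<Sum>\<mu>\<in>F. c \<mu> * mono_ind \<mu> w)" if "s \<le> L" for s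
    using urn_avg_poly[OF F that, where y = y and c = c] that S unfolding h_def by (simp add: poly_sum mult_ac)
  have "degree h \<le> D" unfolding h_def
    by (intro degree_sum_le finF order_trans[OF degree_smult_le]) (use F in \<open>auto simp: is_monomial_def\<close>)
  moreover have "\<bar>poly h (real n)\<bar> \<le> 1" if "n \<le> a * D\<^sup>2" for n
  proof -
    have n: "n \<le> L" using that L by simp
    have "-1 \<le> poly h (real n) \<and> poly h (real n) \<le> 1" unfolding hs[OF n]
    proof (rule urn_avg_bounds)
      fix w :: "nat \<Rightarrow> nat" assume "\<forall>l. w l \<le> G"
      from bnd[OF this] show "-1 \<le> (\<Sum>\<mu>\<in>F. c \<mu> * mono_ind \<mu> w) \<and> (\<Sum>\<mu>\<in>F. c \<mu> * mono_ind \<mu> w) \<le> 1"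
        by (auto simp: abs_le_iff)
    qed (use n S in auto)
    thus ?thesis by (auto simp: abs_le_iff)
  qed
  ultimately have "\<bar>poly h (real (letter_sum G y))\<bar> \<le> (2 * real D + 1) * exp (4 * sqrt ((real (letter_sum G y) - real (a * D\<^sup>2)) / real a) + 4)"
    using S unfolding L by (intro poly_growth a D)
  moreover have "poly h (real (letter_sum G y)) = avg_poly G L F c y"
    unfolding h_def avg_poly_def poly_sum poly_smult poly_ffall_poly
  proof (intro sum.cong refl)
    fix \<mu> assume "\<mu> \<in> F"
    hence "inj_on fst \<mu>" "fst ` \<mu> \<subseteq> {..<L}" using F by (auto simp: is_monomial_def)
    hence "card \<mu> \<le> L" using card_inj_on_le[of fst \<mu> "{..<L}"] by simp
    hence "ffall (real (letter_sum G y)) (card \<mu>) > 0" using S by (intro ffall_pos) simp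
    thus "c \<mu> * (ffall_prod G \<mu> y / (ffall (real L) (card \<mu>) * ffall (real (letter_sum G y)) (card \<mu>))) * ffall (real (letter_sum G y)) (card \<mu>)
      = c \<mu> * (ffall_prod G \<mu> y / ffall (real L) (card \<mu>))" by simp
  qed
  ultimately show ?thesis by simp
qed

text \<open>By independence the expectation is a product over the letters, and each factor is the
  expectation of a polynomial of degree at most D + 1, which the two measures share.\<close>

lemma iid_avg_ffall_prod:
  assumes "card \<mu> \<le> D + 1" "finite \<mu>"
  shows "iid_avg (pos_measure D) (sq_nodes D) G (ffall_prod G \<mu>) = iid_avg (neg_measure D) (sq_nodes D) G (ffall_prod G \<mu>)"
proof -
  have eq: "ffall_prod G \<mu> = (\<lambda>y. \<Prod>j=1..G. ffall (real (y j)) (mult_of \<mu> j))" by (simp add: ffall_prod_def fun_eq_iff)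
  have m: "mult_of \<mu> j \<le> D + 1" for j
    unfolding mult_of_def using assms by (intro order_trans[OF card_mono assms(1)]) auto
  have "(\<Sum>x\<in>sq_nodes D. pos_measure D x * ffall (real x) (mult_of \<mu> j)) = (\<Sum>x\<in>sq_nodes D. neg_measure D x * ffall (real x) (mult_of \<mu> j))" for j
    using measure_moment[of "ffall_poly (mult_of \<mu> j)" D] m by simp
  thus ?thesis unfolding eq using iid_avg_prod[of _ _ G "\<lambda>j x. ffall (real x) (mult_of \<mu> j)"] by simp
qed

lemma iid_avg_avg_poly:
  "iid_avg \<nu> X G (avg_poly G L F c) = (\<Sum>\<mu>\<in>F. c \<mu> / ffall (real L) (card \<mu>) * iid_avg \<nu> X G (ffall_prod G \<mu>))"
proof -
  have "avg_poly G L F c = (\<lambda>y. \<Sum>\<mu>\<in>F. c \<mu> / ffall (real L) (card \<mu>) * ffall_prod G \<mu> y)"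
    by (simp add: avg_poly_def fun_eq_iff)
  thus ?thesis using iid_avg_sum[of \<nu> X G "\<lambda>\<mu>. c \<mu> / ffall (real L) (card \<mu>)" "ffall_prod G" F] by simp
qed

text \<open>The statistic \<open>\<Sum>j. sqrt (y j)\<close> of the letter counts \<open>y\<close> concentrates, under the two
  moment-matched measures, around two different values, whereas a polynomial of low degree has
  the same expectation under both.\<close>

theorem low_degree_cannot_distinguish:
  assumes F: "\<And>\<mu>. \<mu> \<in> F \<Longrightarrow> is_monomial G L D \<mu>" and finF: "finite F"
    and bnd: "\<And>w. (\<forall>l. w l \<le> G) \<Longrightarrow> 0 \<le> (\<Sum>\<mu>\<in>F. c \<mu> * mono_ind \<mu> w) \<and> (\<Sum>\<mu>\<in>F. c \<mu> * mono_ind \<mu> w) \<le> 1"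
    and a: "a \<ge> 12200" and D: "D \<ge> 1" and L: "L = a * D\<^sup>2" and GD: "G \<le> D\<^sup>2"
    and G: "real G \<ge> 960000 / sqrt_gap\<^sup>2"
    and \<tau>: "\<tau> = ((\<Sum>x\<in>sq_nodes D. pos_measure D x * sqrt (real x)) + (\<Sum>x\<in>sq_nodes D. neg_measure D x * sqrt (real x))) / 2"
    and high: "\<And>w y. (\<forall>l. w l \<le> G) \<Longrightarrow> (\<forall>l\<ge>L. w l = 0) \<Longrightarrow> (\<forall>j\<in>{1..G}. card {l. l < L \<and> w l = j} = y j \<and> y j \<ge> 1) \<Longrightarrow>
       letter_sum G y < L \<Longrightarrow> (\<Sum>j=1..G. sqrt (real (y j))) \<ge> real G * (\<tau> + sqrt_gap / 4) \<Longrightarrow>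
       2/3 \<le> (\<Sum>\<mu>\<in>F. c \<mu> * mono_ind \<mu> w)"
    and low: "\<And>w y. (\<forall>l. w l \<le> G) \<Longrightarrow> (\<forall>l\<ge>L. w l = 0) \<Longrightarrow> (\<forall>j\<in>{1..G}. card {l. l < L \<and> w l = j} = y j \<and> y j \<ge> 1) \<Longrightarrow>
       letter_sum G y < L \<Longrightarrow> (\<Sum>j=1..G. sqrt (real (y j))) \<le> real G * (\<tau> - sqrt_gap / 4) \<Longrightarrow>
       (\<Sum>\<mu>\<in>F. c \<mu> * mono_ind \<mu> w) \<le> 1/3"
  shows False
proof -
  define X where "X = sq_nodes D"
  define P where "P = avg_poly G L F c"
  define g where "g = sqrt_gap"
  have g: "g > 0" by (simp add: g_def sqrt_gap_pos)
  have Gpos: "real G > 0" using G g by (metis g_def divide_pos_pos less_le_trans zero_less_numeral zero_less_power)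
  \<comment> \<open>Chebyshev's inequality as a pointwise bound:
    \<open>K * (dev \<nu> y)\<^sup>2\<close> reaches 1 once the deviation reaches
    \<open>G * g / 4\<close>, half the distance from either mean to the nearer bound \<tau>
    \<plusminus> g/2 counted from \<tau>.\<close>
  define K where "K = 16 / ((real G)\<^sup>2 * g\<^sup>2)"
  have K: "K \<ge> 0" unfolding K_def by simp
  define m where "m \<nu> = (\<Sum>x\<in>X. \<nu> x * sqrt (real x))" for \<nu>
  define dev where "dev \<nu> y = (\<Sum>j=1..G. sqrt (real (y j)) - m \<nu>)" for \<nu> and y :: "nat \<Rightarrow> nat"
  \<comment> \<open>The prefactor offsets the \<open>G\<close> factors \<open>exp (3000 / D)\<close>
    of \<open>measure_exp\<close>, so that the expectation is at most 1.\<close>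
  define tail where "tail y = exp (- (3000 * real G / real D)) * (\<Prod>j=1..G. exp (real (y j) / (2 * real D)))"
    for y :: "nat \<Rightarrow> nat"
  have tail_eq: "tail y = exp (real (letter_sum G y) / (2 * real D)) * exp (- (3000 * real G / real D))" for y
    unfolding tail_def letter_sum_def by (simp add: exp_sum[symmetric] sum_divide_distrib)
  have dev_eq: "dev \<nu> y = (\<Sum>j=1..G. sqrt (real (y j))) - real G * m \<nu>" for \<nu> y
    unfolding dev_def by (simp add: sum_subtractf)
  have far: "1 \<le> K * (dev \<nu> y)\<^sup>2" if "\<bar>dev \<nu> y\<bar> \<ge> real G * g / 4" for \<nu> y
  proof -
    have "(real G * g / 4)\<^sup>2 \<le> \<bar>dev \<nu> y\<bar>\<^sup>2" using that Gpos g by (intro power_mono) auto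
    hence "K * (real G * g / 4)\<^sup>2 \<le> K * (dev \<nu> y)\<^sup>2" using K by (intro mult_left_mono) auto
    moreover have "K * (real G * g / 4)\<^sup>2 = 1" unfolding K_def using Gpos g by (simp add: power_mult_distrib power_divide)
    ultimately show ?thesis by simp
  qed
  have tail_nn: "tail y \<ge> 0" for y unfolding tail_eq by simp
  \<comment> \<open>Where the counts correspond to no word, the tail dominates the polynomial as
    well as the constant 1; the two fiftieths are the coefficient 1/25 below.\<close>
  have invalid: "\<bar>P y\<bar> \<le> tail y / 50" "1 \<le> tail y / 50" if "L \<le> letter_sum G y" for y
  proof -
    have "50 * ((2 * real D + 1) * exp (4 * sqrt ((real (letter_sum G y) - real (a * D\<^sup>2)) / real a) + 4)) \<le> tail y"
      unfolding tail_eq using that L by (intro growth_vs_tail a D GD) simp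
    moreover have "\<bar>P y\<bar> \<le> (2 * real D + 1) * exp (4 * sqrt ((real (letter_sum G y) - real (a * D\<^sup>2)) / real a) + 4)"
      unfolding P_def
    proof (rule avg_poly_growth[OF F finF])
      fix w :: "nat \<Rightarrow> nat" assume "\<forall>l. w l \<le> G"
      from bnd[OF this] show "\<bar>\<Sum>\<mu>\<in>F. c \<mu> * mono_ind \<mu> w\<bar> \<le> 1" by auto
    qed (use a D L that in auto)
    moreover have "1 * 1 \<le> (2 * real D + 1) * exp (4 * sqrt ((real (letter_sum G y) - real (a * D\<^sup>2)) / real a) + 4)"
    proof (intro mult_mono)
      have "real (a * D\<^sup>2) \<le> real (letter_sum G y)" using that L by (simp only: of_nat_le_iff)
      thus "1 \<le> exp (4 * sqrt ((real (letter_sum G y) - real (a * D\<^sup>2)) / real a) + 4)" by simp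
    qed auto
    ultimately show "\<bar>P y\<bar> \<le> tail y / 50" "1 \<le> tail y / 50" by auto
  qed
  have valid: "lo \<le> P y \<and> P y \<le> hi"
    if y: "letter_sum G y < L" "\<And>j. j \<in> {1..G} \<Longrightarrow> y j \<in> X"
      and w: "\<And>w. (\<forall>l. w l \<le> G) \<Longrightarrow> (\<forall>l\<ge>L. w l = 0) \<Longrightarrow> (\<forall>j\<in>{1..G}. card {l. l < L \<and> w l = j} = y j \<and> y j \<ge> 1) \<Longrightarrow>
         lo \<le> (\<Sum>\<mu>\<in>F. c \<mu> * mono_ind \<mu> w) \<and> (\<Sum>\<mu>\<in>F. c \<mu> * mono_ind \<mu> w) \<le> hi" for lo hi y
  proof -
    have "P y = urn_avg G L y (letter_sum G y) (\<lambda>w. \<Sum>\<mu>\<in>F. c \<mu> * mono_ind \<mu> w)"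
      unfolding P_def using y by (intro avg_poly_eq_urn_avg[OF F]) auto
    moreover have "lo \<le> urn_avg G L y (letter_sum G y) (\<lambda>w. \<Sum>\<mu>\<in>F. c \<mu> * mono_ind \<mu> w)
       \<and> urn_avg G L y (letter_sum G y) (\<lambda>w. \<Sum>\<mu>\<in>F. c \<mu> * mono_ind \<mu> w) \<le> hi"
    proof (rule urn_avg_bounds)
      fix v assume v: "\<forall>l. v l \<le> G" "\<forall>l\<ge>L. v l = 0"
        "letter_sum G y = letter_sum G y \<Longrightarrow> (\<forall>j\<in>{1..G}. card {l. l < L \<and> v l = j} = y j)"
      have "y j \<ge> 1" if "j \<in> {1..G}" for j using sq_nodes_pos y(2)[OF that] unfolding X_def by fastforce
      thus "lo \<le> (\<Sum>\<mu>\<in>F. c \<mu> * mono_ind \<mu> v) \<and> (\<Sum>\<mu>\<in>F. c \<mu> * mono_ind \<mu> v) \<le> hi"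
        using v by (intro w) auto
    qed (use y in auto)
    ultimately show ?thesis by simp
  qed
  have mean_gap: "m (neg_measure D) \<ge> \<tau> + g / 2" "m (pos_measure D) \<le> \<tau> - g / 2"
    using measure_sqrt_gap[of D] unfolding m_def X_def g_def \<tau> by (auto simp: field_simps)
  have stat: "iid_avg \<nu> X G (\<lambda>y. K * (dev \<nu> y)\<^sup>2) \<le> 1/25"
    "iid_avg \<nu> X G tail \<le> 1" "(\<Sum>x\<in>X. \<nu> x) = 1" "\<And>x. 0 \<le> \<nu> x"
    if \<nu>: "\<nu> = pos_measure D \<or> \<nu> = neg_measure D" for \<nu>
  proof -
    show tot: "(\<Sum>x\<in>X. \<nu> x) = 1" and nn: "\<And>x. 0 \<le> \<nu> x"
      using \<nu> measure_total measure_nonneg unfolding X_def by auto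
    have mean: "(\<Sum>x\<in>X. \<nu> x * (sqrt (real x) - m \<nu>)) = 0"
      by (simp add: right_diff_distrib sum_subtractf tot m_def flip: sum_distrib_right)
    have var: "(\<Sum>x\<in>X. \<nu> x * (sqrt (real x) - m \<nu>)\<^sup>2) \<le> 2400"
    proof -
      have "(\<Sum>x\<in>X. \<nu> x * (sqrt (real x) - m \<nu>)\<^sup>2)
        = (\<Sum>x\<in>X. \<nu> x * real x - 2 * m \<nu> * (\<nu> x * sqrt (real x)) + (m \<nu>)\<^sup>2 * \<nu> x)"
        by (intro sum.cong refl) (simp add: power2_diff algebra_simps)
      also have "\<dots> = (\<Sum>x\<in>X. \<nu> x * real x) - (m \<nu>)\<^sup>2"
        unfolding sum.distrib sum_subtractf sum_distrib_left[symmetric] tot m_def[symmetric]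
        by (simp add: power2_eq_square)
      also have "\<dots> \<le> 2400" using measure_mean[OF \<nu>] zero_le_power2[of "m \<nu>"] unfolding X_def by linarith
      finally show ?thesis .
    qed
    have "iid_avg \<nu> X G (\<lambda>y. K * (dev \<nu> y)\<^sup>2) = K * (real G * (\<Sum>x\<in>X. \<nu> x * (sqrt (real x) - m \<nu>)\<^sup>2))"
      unfolding iid_avg_cmult dev_def by (subst iid_avg_variance[OF tot mean]) simp
    also have "\<dots> \<le> K * (real G * 2400)" using var K by (intro mult_left_mono) auto
    also have "\<dots> = 38400 / (real G * g\<^sup>2)" unfolding K_def using Gpos by (simp add: power2_eq_square)
    also have "\<dots> \<le> 1/25"
    proof -
      \<comment> \<open>960000 = 25 * 16 * 2400, with 16 from \<open>K\<close> and 2400 from the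
        variance bound.\<close>
      have "960000 \<le> real G * g\<^sup>2" using G g unfolding g_def by (simp add: divide_le_eq)
      thus ?thesis using Gpos g by (simp add: divide_le_eq)
    qed
    finally show "iid_avg \<nu> X G (\<lambda>y. K * (dev \<nu> y)\<^sup>2) \<le> 1/25" .
    have "iid_avg \<nu> X G tail = exp (- (3000 * real G / real D)) * (\<Prod>j=1..G. \<Sum>x\<in>X. \<nu> x * exp (real x / (2 * real D)))"
      unfolding tail_def iid_avg_cmult iid_avg_prod[of \<nu> X G "\<lambda>j x. exp (real x / (2 * real D))"] ..
    also have "\<dots> \<le> exp (- (3000 * real G / real D)) * (\<Prod>j=1..G. exp (3000 / real D))"
      using measure_exp[OF \<nu> D] nn unfolding X_def by (intro mult_left_mono prod_mono) (auto intro!: sum_nonneg)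
    also have "\<dots> = 1" by (simp flip: exp_of_nat_mult exp_add)
    finally show "iid_avg \<nu> X G tail \<le> 1" .
  qed
  \<comment> \<open>Pointwise, \<open>P\<close> is at least 2/3 minus two error terms: the Chebyshev
    term covers atypical counts, the tail term the counts without words. Each costs 1/25 in
    expectation, and 2/3 - 2/25 exceeds the value 1/3 + 2/25 obtained for the other measure.\<close>
  have lower: "2/3 - 2/25 \<le> iid_avg (neg_measure D) X G P"
  proof -
    define \<nu> where "\<nu> = neg_measure D"
    note st = stat[of \<nu>, OF disjI2[OF \<nu>_def]]
    have "2/3 - 1/25 - 1/25 \<le> 2/3 - iid_avg \<nu> X G (\<lambda>y. K * (dev \<nu> y)\<^sup>2) - (1/25) * iid_avg \<nu> X G tail"
      using st(1,2) by (intro diff_mono) auto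
    also have "\<dots> = iid_avg \<nu> X G (\<lambda>y. 2/3 - K * (dev \<nu> y)\<^sup>2 - (1/25) * tail y)"
      unfolding iid_avg_diff iid_avg_cmult iid_avg_const[OF st(3)] ..
    also have "\<dots> \<le> iid_avg \<nu> X G P"
    proof (rule iid_avg_mono)
      fix y :: "nat \<Rightarrow> nat" assume y: "\<And>j. j \<in> {1..G} \<Longrightarrow> y j \<in> X"
      have Kd: "0 \<le> K * (dev \<nu> y)\<^sup>2" using K by simp
      show "2/3 - K * (dev \<nu> y)\<^sup>2 - (1/25) * tail y \<le> P y"
      proof (cases "letter_sum G y < L")
        case True
        show ?thesis
        proof (cases "\<bar>dev \<nu> y\<bar> \<ge> real G * g / 4")
          case True
          have "0 \<le> P y \<and> P y \<le> 1" using bnd by (intro valid \<open>letter_sum G y < L\<close> y) auto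
          thus ?thesis using far[OF True] tail_nn[of y] by linarith
        next
          case False
          have "real G * (\<tau> + g / 2) \<le> real G * m \<nu>" using mean_gap \<nu>_def by (intro mult_left_mono) auto
          hence s: "real G * (\<tau> + sqrt_gap / 4) \<le> (\<Sum>j=1..G. sqrt (real (y j)))"
            using False unfolding dev_eq g_def[symmetric] distrib_left right_diff_distrib by linarith
          have "2/3 \<le> P y \<and> P y \<le> 1"
            using bnd high[OF _ _ _ \<open>letter_sum G y < L\<close> s] by (intro valid \<open>letter_sum G y < L\<close> y) auto
          thus ?thesis using tail_nn[of y] Kd by linarith
        qed
      next
        case False
        thus ?thesis using invalid[of y] Kd by linarith
      qed
    qed (use st(4) in auto)
    finally show ?thesis unfolding \<nu>_def by simp
  qed
  have upper: "iid_avg (pos_measure D) X G P \<le> 1/3 + 2/25"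
  proof -
    define \<nu> where "\<nu> = pos_measure D"
    note st = stat[of \<nu>, OF disjI1[OF \<nu>_def]]
    have "iid_avg \<nu> X G P \<le> iid_avg \<nu> X G (\<lambda>y. 1/3 + (K * (dev \<nu> y)\<^sup>2 + (1/25) * tail y))"
    proof (rule iid_avg_mono)
      fix y :: "nat \<Rightarrow> nat" assume y: "\<And>j. j \<in> {1..G} \<Longrightarrow> y j \<in> X"
      have Kd: "0 \<le> K * (dev \<nu> y)\<^sup>2" using K by simp
      show "P y \<le> 1/3 + (K * (dev \<nu> y)\<^sup>2 + (1/25) * tail y)"
      proof (cases "letter_sum G y < L")
        case True
        show ?thesis
        proof (cases "\<bar>dev \<nu> y\<bar> \<ge> real G * g / 4")
          case True
          have "0 \<le> P y \<and> P y \<le> 1" using bnd by (intro valid \<open>letter_sum G y < L\<close> y) auto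
          thus ?thesis using far[OF True] tail_nn[of y] by linarith
        next
          case False
          have "real G * m \<nu> \<le> real G * (\<tau> - g / 2)" using mean_gap \<nu>_def by (intro mult_left_mono) auto
          hence s: "(\<Sum>j=1..G. sqrt (real (y j))) \<le> real G * (\<tau> - sqrt_gap / 4)"
            using False unfolding dev_eq g_def[symmetric] distrib_left right_diff_distrib by linarith
          have "0 \<le> P y \<and> P y \<le> 1/3"
            using bnd low[OF _ _ _ \<open>letter_sum G y < L\<close> s] by (intro valid \<open>letter_sum G y < L\<close> y) auto
          thus ?thesis using tail_nn[of y] Kd by linarith
        qed
      next
        case False
        thus ?thesis using invalid[of y] Kd by linarith
      qed
    qed (use st(4) in auto)
    also have "\<dots> = 1/3 + (iid_avg \<nu> X G (\<lambda>y. K * (dev \<nu> y)\<^sup>2) + (1/25) * iid_avg \<nu> X G tail)"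
      unfolding iid_avg_add iid_avg_cmult iid_avg_const[OF st(3)] ..
    also have "\<dots> \<le> 1/3 + (1/25 + (1/25) * 1)"
      using st(1,2) by (intro add_left_mono add_mono mult_left_mono) auto
    finally show ?thesis unfolding \<nu>_def by simp
  qed
  have "iid_avg (pos_measure D) X G P = iid_avg (neg_measure D) X G P"
    unfolding P_def iid_avg_avg_poly X_def
  proof (intro sum.cong refl arg_cong2[of _ _ _ _ "(*)"])
    fix \<mu> assume "\<mu> \<in> F"
    hence "card \<mu> \<le> D + 1" "finite \<mu>" using F[of \<mu>] by (auto simp: is_monomial_def)
    thus "iid_avg (pos_measure D) (sq_nodes D) G (ffall_prod G \<mu>) = iid_avg (neg_measure D) (sq_nodes D) G (ffall_prod G \<mu>)"
      by (rule iid_avg_ffall_prod)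
  qed
  thus False using lower upper by simp
qed

section \<open>Matrices and norms\<close>

lemma adj_carrier [simp]: "A \<in> carrier_mat a b \<Longrightarrow> adj A \<in> carrier_mat b a"
  by (simp add: adj_def)

lemma adj_dim [simp]: "dim_row (adj A) = dim_col A" "dim_col (adj A) = dim_row A"
  by (simp_all add: adj_def)

lemma adj_index [simp]: "i < dim_col A \<Longrightarrow> j < dim_row A \<Longrightarrow> adj A $$ (i, j) = cnj (A $$ (j, i))"
  by (simp add: adj_def)

lemma mult_index:
  assumes "A \<in> carrier_mat a b" "B \<in> carrier_mat b c" "i < a" "j < c"
  shows "(A * B) $$ (i, j) = (\<Sum>k<b. A $$ (i, k) * B $$ (k, j))"
  using assms by (auto simp: scalar_prod_def atLeast0LessThan intro!: sum.cong)

lemma mult_vec_index: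
  assumes "A \<in> carrier_mat a b" "v \<in> carrier_vec b" "i < a"
  shows "(A *\<^sub>v v) $ i = (\<Sum>k<b. A $$ (i, k) * v $ k)"
  using assms by (auto simp: scalar_prod_def atLeast0LessThan intro!: sum.cong)

lemma adj_adj [simp]: "adj (adj A) = A"
  by (rule eq_matI) auto

lemma adj_mult:
  assumes "A \<in> carrier_mat a b" "B \<in> carrier_mat b c"
  shows "adj (A * B) = adj B * adj A"
proof (rule eq_matI)
  fix i j assume "i < dim_row (adj B * adj A)" "j < dim_col (adj B * adj A)"
  hence ij: "i < c" "j < a" using assms by auto
  have "adj (A * B) $$ (i, j) = cnj ((A * B) $$ (j, i))" using assms ij by simp
  also have "\<dots> = (\<Sum>k<b. adj B $$ (i, k) * adj A $$ (k, j))"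
    unfolding mult_index[OF assms ij(2,1)] using assms ij by (auto simp: mult.commute intro!: sum.cong)
  also have "\<dots> = (adj B * adj A) $$ (i, j)"
    using assms ij by (intro mult_index[symmetric]) auto
  finally show "adj (A * B) $$ (i, j) = (adj B * adj A) $$ (i, j)" .
qed (use assms in auto)

lemma adj_add:
  assumes "A \<in> carrier_mat a b" "B \<in> carrier_mat a b"
  shows "adj (A + B) = adj A + adj B"
  by (rule eq_matI) (use assms in auto)

lemma adj_minus:
  assumes "A \<in> carrier_mat a b" "B \<in> carrier_mat a b"
  shows "adj (A - B) = adj A - adj B"
  by (rule eq_matI) (use assms in auto)

lemma adj_one [simp]: "adj (1\<^sub>m n) = 1\<^sub>m n"
  by (rule eq_matI) auto

lemma unitary_carrier [simp]: "unitary_mat d U \<Longrightarrow> U \<in> carrier_mat d d"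
  by (simp add: unitary_mat_def)

lemma unitary_adj: "unitary_mat d U \<Longrightarrow> unitary_mat d (adj U)"
  by (auto simp: unitary_mat_def)

lemma unitary_mult:
  assumes "unitary_mat d U" "unitary_mat d V"
  shows "unitary_mat d (U * V)"
proof -
  have c: "U \<in> carrier_mat d d" "V \<in> carrier_mat d d" "adj U \<in> carrier_mat d d" "adj V \<in> carrier_mat d d"
    using assms by (auto simp: unitary_mat_def)
  have "(U * V) * (adj V * adj U) = U * (V * adj V) * adj U" using c by (simp add: assoc_mult_mat[of _ d d _ d _ d] mult_carrier_mat[of _ d d _ d])
  also have "\<dots> = 1\<^sub>m d" using assms c by (simp add: unitary_mat_def)
  finally have 1: "(U * V) * (adj V * adj U) = 1\<^sub>m d" .
  have "(adj V * adj U) * (U * V) = adj V * (adj U * U) * V" using c by (simp add: assoc_mult_mat[of _ d d _ d _ d] mult_carrier_mat[of _ d d _ d])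
  also have "\<dots> = 1\<^sub>m d" using assms c by (simp add: unitary_mat_def)
  finally show ?thesis using 1 c by (simp add: unitary_mat_def adj_mult[OF c(1,2)])
qed

section \<open>Euclidean norm, unitaries and projections\<close>

definition vnorm :: "complex vec \<Rightarrow> real" where
  "vnorm v = L2_set (\<lambda>i. cmod (v $ i)) {..<dim_vec v}"

lemma vnorm_sq: "(vnorm v)\<^sup>2 = (\<Sum>i<dim_vec v. (cmod (v $ i))\<^sup>2)"
  by (simp add: vnorm_def L2_set_def sum_nonneg)

lemma vnorm_nonneg [simp]: "0 \<le> vnorm v"
  by (simp add: vnorm_def)

lemma vnorm_triangle:
  assumes "u \<in> carrier_vec n" "v \<in> carrier_vec n"
  shows "vnorm (u + v) \<le> vnorm u + vnorm v"
proof -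
  have "vnorm (u + v) \<le> L2_set (\<lambda>i. cmod (u $ i) + cmod (v $ i)) {..<n}"
    unfolding vnorm_def using assms by (auto intro!: L2_set_mono norm_triangle_ineq)
  also have "\<dots> \<le> vnorm u + vnorm v"
    using L2_set_triangle_ineq[of "\<lambda>i. cmod (u $ i)" "\<lambda>i. cmod (v $ i)" "{..<n}"] assms by (simp add: vnorm_def)
  finally show ?thesis .
qed

lemma inner_adj:
  assumes A: "A \<in> carrier_mat a b" and v: "v \<in> carrier_vec b" and u: "u \<in> carrier_vec a"
  shows "(\<Sum>i<a. (A *\<^sub>v v) $ i * cnj (u $ i)) = (\<Sum>j<b. v $ j * cnj ((adj A *\<^sub>v u) $ j))"
proof -
  have "(\<Sum>i<a. (A *\<^sub>v v) $ i * cnj (u $ i)) = (\<Sum>i<a. \<Sum>j<b. A $$ (i, j) * v $ j * cnj (u $ i))"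
    by (intro sum.cong refl) (simp add: mult_vec_index[OF A v] sum_distrib_right)
  also have "\<dots> = (\<Sum>j<b. \<Sum>i<a. A $$ (i, j) * v $ j * cnj (u $ i))" by (rule sum.swap)
  also have "\<dots> = (\<Sum>j<b. v $ j * cnj ((adj A *\<^sub>v u) $ j))"
  proof (intro sum.cong refl)
    fix j assume j: "j \<in> {..<b}"
    have "(adj A *\<^sub>v u) $ j = (\<Sum>i<a. adj A $$ (j, i) * u $ i)"
      using A u j by (intro mult_vec_index) auto
    thus "(\<Sum>i<a. A $$ (i, j) * v $ j * cnj (u $ i)) = v $ j * cnj ((adj A *\<^sub>v u) $ j)"
      using A j by (auto simp: sum_distrib_left mult_ac intro!: sum.cong)
  qed
  finally show ?thesis .
qed

lemma vnorm_sq_inner: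
  assumes "v \<in> carrier_vec n"
  shows "complex_of_real ((vnorm v)\<^sup>2) = (\<Sum>i<n. v $ i * cnj (v $ i))"
  using assms unfolding vnorm_sq of_real_sum by (auto simp: complex_norm_square simp del: of_real_power intro!: sum.cong)

lemma vnorm_mult_adj:
  assumes A: "A \<in> carrier_mat a b" and v: "v \<in> carrier_vec b"
  shows "complex_of_real ((vnorm (A *\<^sub>v v))\<^sup>2) = (\<Sum>j<b. v $ j * cnj ((adj A * A *\<^sub>v v) $ j))"
proof -
  have "complex_of_real ((vnorm (A *\<^sub>v v))\<^sup>2) = (\<Sum>i<a. (A *\<^sub>v v) $ i * cnj ((A *\<^sub>v v) $ i))"
    using A v by (intro vnorm_sq_inner mult_mat_vec_carrier)
  also have "\<dots> = (\<Sum>j<b. v $ j * cnj ((adj A *\<^sub>v (A *\<^sub>v v)) $ j))"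
    using A v by (intro inner_adj) auto
  also have "adj A *\<^sub>v (A *\<^sub>v v) = adj A * A *\<^sub>v v"
    using A v by (intro assoc_mult_mat_vec[symmetric]) auto
  finally show ?thesis .
qed

lemma vnorm_unitary:
  assumes "unitary_mat d U" "v \<in> carrier_vec d"
  shows "vnorm (U *\<^sub>v v) = vnorm v"
proof -
  have "complex_of_real ((vnorm (U *\<^sub>v v))\<^sup>2) = complex_of_real ((vnorm v)\<^sup>2)"
    unfolding vnorm_sq_inner[OF assms(2)]
    using vnorm_mult_adj[of U d d v] assms by (auto simp: unitary_mat_def)
  hence "(vnorm (U *\<^sub>v v))\<^sup>2 = (vnorm v)\<^sup>2" by (simp only: of_real_eq_iff)
  thus ?thesis by (simp add: power2_eq_iff_nonneg)
qed

text \<open>Pythagoras: the squared norm of \<open>v - P v\<close> is the difference of the other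
  two.\<close>

lemma vnorm_orth_proj:
  assumes P: "orth_proj d P" and v: "v \<in> carrier_vec d"
  shows "vnorm (P *\<^sub>v v) \<le> vnorm v"
proof -
  have c: "P \<in> carrier_mat d d" "P * P = P" "adj P = P" using P by (auto simp: orth_proj_def)
  have Pv: "P *\<^sub>v v \<in> carrier_vec d" using c v by auto
  define S where "S = (\<Sum>j<d. v $ j * cnj ((P *\<^sub>v v) $ j))"
  have 1: "complex_of_real ((vnorm (P *\<^sub>v v))\<^sup>2) = S"
    using vnorm_mult_adj[OF c(1) v] c by (simp add: S_def)
  have 2: "complex_of_real ((vnorm (P *\<^sub>v v))\<^sup>2) = (\<Sum>j<d. (P *\<^sub>v v) $ j * cnj ((P *\<^sub>v v) $ j))"
    by (rule vnorm_sq_inner[OF Pv])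
  have "complex_of_real ((vnorm (v - P *\<^sub>v v))\<^sup>2)
     = (\<Sum>j<d. v $ j * cnj (v $ j)) - S - cnj S + (\<Sum>j<d. (P *\<^sub>v v) $ j * cnj ((P *\<^sub>v v) $ j))"
  proof -
    have "v - P *\<^sub>v v \<in> carrier_vec d" using Pv v by auto
    thus ?thesis unfolding S_def using Pv v c
      by (subst vnorm_sq_inner[of _ d]) (auto simp: algebra_simps sum.distrib sum_subtractf)
  qed
  also have "\<dots> = complex_of_real ((vnorm v)\<^sup>2 - (vnorm (P *\<^sub>v v))\<^sup>2)"
    unfolding 2[symmetric] vnorm_sq_inner[OF v, symmetric] 1[symmetric] by simp
  finally have "(vnorm (v - P *\<^sub>v v))\<^sup>2 = (vnorm v)\<^sup>2 - (vnorm (P *\<^sub>v v))\<^sup>2" by (simp only: of_real_eq_iff)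
  hence "(vnorm (P *\<^sub>v v))\<^sup>2 \<le> (vnorm v)\<^sup>2" by (metis diff_ge_0_iff_ge zero_le_power2)
  thus ?thesis by (rule power2_le_imp_le) simp
qed

section \<open>Pair indices and Kronecker products\<close>

lemma pair_less: "a < n \<Longrightarrow> b < m \<Longrightarrow> a * m + b < n * (m::nat)"
proof -
  assume "a < n" "b < m"
  hence "a * m + b < Suc a * m" by simp
  also have "\<dots> \<le> n * m" using \<open>a < n\<close> by (intro mult_le_mono1) simp
  finally show ?thesis .
qed

lemma sum_div_mod:
  fixes f :: "nat \<Rightarrow> nat \<Rightarrow> 'a::comm_monoid_add"
  shows "(\<Sum>x<n*m. f (x div m) (x mod m)) = (\<Sum>i<n. \<Sum>j<m. f i j)"
proof (cases "m = 0")
  case False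
  have "(\<Sum>i<n. \<Sum>j<m. f i j) = (\<Sum>(i,j)\<in>{..<n} \<times> {..<m}. f i j)" by (simp add: sum.cartesian_product)
  also have "\<dots> = (\<Sum>x<n*m. f (x div m) (x mod m))"
  proof (rule sum.reindex_bij_witness[where i = "\<lambda>x. (x div m, x mod m)" and j = "\<lambda>(i,j). i * m + j"])
    fix a assume "a \<in> {..<n} \<times> {..<m}"
    then obtain i j where a: "a = (i, j)" "i < n" "j < m" by auto
    have "i * m + j < i * m + m" using a by simp
    also have "\<dots> \<le> n * m" using a by (metis Suc_leI mult_Suc add.commute mult_le_mono1)
    finally show "(case a of (i, j) \<Rightarrow> i * m + j) \<in> {..<n * m}" using a by simp
    show "((case a of (i, j) \<Rightarrow> i * m + j) div m, (case a of (i, j) \<Rightarrow> i * m + j) mod m) = a"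
      using a False by simp
    show "f ((case a of (i, j) \<Rightarrow> i * m + j) div m) ((case a of (i, j) \<Rightarrow> i * m + j) mod m) = (case a of (i, j) \<Rightarrow> f i j)"
      using a False by simp
  next
    fix b assume b: "b \<in> {..<n * m}"
    show "(case (b div m, b mod m) of (i, j) \<Rightarrow> i * m + j) = b" by simp
    show "(b div m, b mod m) \<in> {..<n} \<times> {..<m}" using b False by (auto simp: less_mult_imp_div_less)
  qed
  finally show ?thesis by simp
qed simp

lemma div_mod_less: "x < n * m \<Longrightarrow> x div m < n \<and> x mod m < (m::nat)"
  by (metis less_mult_imp_div_less mod_less_divisor mult_0_right not_gr_zero not_less_zero)

lemma kron_carrier [simp]:
  "A \<in> carrier_mat a b \<Longrightarrow> B \<in> carrier_mat c d \<Longrightarrow> kron A B \<in> carrier_mat (a * c) (b * d)"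
  by (simp add: kron_def)

lemma kron_index:
  assumes "A \<in> carrier_mat a b" "B \<in> carrier_mat c d" "x < a * c" "y < b * d"
  shows "kron A B $$ (x, y) = A $$ (x div c, y div d) * B $$ (x mod c, y mod d)"
  using assms by (auto simp: kron_def)

lemma kron_mult:
  assumes A: "A \<in> carrier_mat a b" and B: "B \<in> carrier_mat c d"
    and A': "A' \<in> carrier_mat b a'" and B': "B' \<in> carrier_mat d c'"
  shows "kron A B * kron A' B' = kron (A * A') (B * B')"
proof (rule eq_matI)
  have kA: "kron A B \<in> carrier_mat (a * c) (b * d)" and kA': "kron A' B' \<in> carrier_mat (b * d) (a' * c')"
    using assms by auto
  have kk: "kron (A * A') (B * B') \<in> carrier_mat (a * c) (a' * c')" using assms by (intro kron_carrier) auto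
  fix x y assume "x < dim_row (kron (A * A') (B * B'))" "y < dim_col (kron (A * A') (B * B'))"
  hence xy: "x < a * c" "y < a' * c'" using kk by auto
  note x = div_mod_less[OF xy(1)] and y = div_mod_less[OF xy(2)]
  have "(kron A B * kron A' B') $$ (x, y) = (\<Sum>k<b*d. kron A B $$ (x, k) * kron A' B' $$ (k, y))"
    by (rule mult_index[OF kA kA' xy])
  also have "\<dots> = (\<Sum>k<b*d. (A $$ (x div c, k div d) * A' $$ (k div d, y div c'))
      * (B $$ (x mod c, k mod d) * B' $$ (k mod d, y mod c')))"
    by (intro sum.cong refl) (simp add: kron_index[OF A B xy(1)] kron_index[OF A' B' _ xy(2)])
  also have "\<dots> = (\<Sum>i<b. \<Sum>j<d. (A $$ (x div c, i) * A' $$ (i, y div c')) * (B $$ (x mod c, j) * B' $$ (j, y mod c')))"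
    by (rule sum_div_mod)
  also have "\<dots> = (A * A') $$ (x div c, y div c') * (B * B') $$ (x mod c, y mod c')"
    using x y by (simp add: mult_index[OF A A'] mult_index[OF B B'] sum_product)
  also have "\<dots> = kron (A * A') (B * B') $$ (x, y)"
    using xy assms by (intro kron_index[symmetric]) auto
  finally show "(kron A B * kron A' B') $$ (x, y) = kron (A * A') (B * B') $$ (x, y)" .
qed (use assms in \<open>auto simp: kron_def\<close>)

lemma adj_kron: "adj (kron A B) = kron (adj A) (adj B)"
proof (rule eq_matI)
  fix i j assume "i < dim_row (kron (adj A) (adj B))" "j < dim_col (kron (adj A) (adj B))"
  hence ij: "i < dim_col A * dim_col B" "j < dim_row A * dim_row B" by (auto simp: kron_def)
  show "adj (kron A B) $$ (i, j) = kron (adj A) (adj B) $$ (i, j)"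
    using ij div_mod_less[OF ij(1)] div_mod_less[OF ij(2)] by (simp add: kron_def)
qed (auto simp: kron_def)

lemma kron_one: "kron (1\<^sub>m a) (1\<^sub>m b) = 1\<^sub>m (a * b)"
proof (rule eq_matI)
  fix i j assume "i < dim_row (1\<^sub>m (a * b))" "j < dim_col (1\<^sub>m (a * b))"
  hence ij: "i < a * b" "j < a * b" by auto
  have "i div b = j div b \<Longrightarrow> i mod b = j mod b \<Longrightarrow> i = j" by (metis div_mult_mod_eq)
  thus "kron (1\<^sub>m a) (1\<^sub>m b) $$ (i, j) = 1\<^sub>m (a * b) $$ (i, j)"
    using ij div_mod_less[OF ij(1)] div_mod_less[OF ij(2)] by (auto simp: kron_def)
qed (auto simp: kron_def)

lemma kron_add_right:
  assumes "A \<in> carrier_mat a b" "B \<in> carrier_mat c d" "C \<in> carrier_mat c d"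
  shows "kron A B + kron A C = kron A (B + C)"
proof (rule eq_matI)
  fix i j assume "i < dim_row (kron A (B + C))" "j < dim_col (kron A (B + C))"
  hence ij: "i < a * c" "j < b * d" using assms by (auto simp: kron_def)
  show "(kron A B + kron A C) $$ (i, j) = kron A (B + C) $$ (i, j)"
    using ij div_mod_less[OF ij(1)] div_mod_less[OF ij(2)] assms by (auto simp: kron_def algebra_simps)
qed (use assms in \<open>auto simp: kron_def\<close>)

lemma kron_minus_left:
  assumes "A \<in> carrier_mat a b" "A' \<in> carrier_mat a b" "B \<in> carrier_mat c d"
  shows "kron A B - kron A' B = kron (A - A') B"
proof (rule eq_matI)
  fix i j assume "i < dim_row (kron (A - A') B)" "j < dim_col (kron (A - A') B)"
  hence ij: "i < a * c" "j < b * d" using assms by (auto simp: kron_def)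
  show "(kron A B - kron A' B) $$ (i, j) = kron (A - A') B $$ (i, j)"
    using ij div_mod_less[OF ij(1)] div_mod_less[OF ij(2)] assms by (auto simp: kron_def algebra_simps)
qed (use assms in \<open>auto simp: kron_def\<close>)

lemma kron_zero_right: "A \<in> carrier_mat a b \<Longrightarrow> kron A (0\<^sub>m c d) = 0\<^sub>m (a * c) (b * d)"
  by (rule eq_matI) (auto simp: kron_def dest!: div_mod_less)

section \<open>Controlled queries\<close>

lemma orth_proj_complement:
  assumes "orth_proj W P"
  shows "orth_proj W (1\<^sub>m W - P)"
    and "P * (1\<^sub>m W - P) = 0\<^sub>m W W" "(1\<^sub>m W - P) * P = 0\<^sub>m W W"
proof -
  have P: "P \<in> carrier_mat W W" "P * P = P" "adj P = P" using assms by (auto simp: orth_proj_def)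
  show 1: "P * (1\<^sub>m W - P) = 0\<^sub>m W W"
    using P by (simp add: mult_minus_distrib_mat[of _ W W _ W] minus_r_inv_mat)
  show 2: "(1\<^sub>m W - P) * P = 0\<^sub>m W W"
    using P by (simp add: minus_mult_distrib_mat[of _ W W _ _ W] minus_r_inv_mat)
  have "(1\<^sub>m W - P) * (1\<^sub>m W - P) = 1\<^sub>m W * (1\<^sub>m W - P) - P * (1\<^sub>m W - P)"
    using P by (intro minus_mult_distrib_mat[of _ W W _ _ W]) auto
  also have "\<dots> = 1\<^sub>m W - P" unfolding 1 using P by (intro eq_matI) auto
  finally show "orth_proj W (1\<^sub>m W - P)"
    using P by (auto simp: orth_proj_def adj_minus[of _ W W])
qed

definition ctrl :: "nat \<Rightarrow> complex mat \<Rightarrow> complex mat \<Rightarrow> complex mat" where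
  "ctrl N P G = kron G P + kron (1\<^sub>m N) (1\<^sub>m (dim_row P) - P)"

lemma query_gate_ctrl:
  "query_gate N U V (s, d, P) = ctrl N P (if d then adj (if s then V else U) else (if s then V else U))"
  by (simp add: query_gate_def ctrl_def Let_def)

lemma ctrl_carrier [simp]:
  "G \<in> carrier_mat N N \<Longrightarrow> P \<in> carrier_mat W W \<Longrightarrow> ctrl N P G \<in> carrier_mat (N * W) (N * W)"
  unfolding ctrl_def by (intro add_carrier_mat kron_carrier) auto

text \<open>The mixed terms vanish because \<open>P\<close> and its complement are orthogonal. This
  lets a controlled product be split into controlled factors, one of which is the same for all
  instances compared.\<close>

lemma ctrl_mult:
  assumes P: "orth_proj W P" and A: "A \<in> carrier_mat N N" and B: "B \<in> carrier_mat N N"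
  shows "ctrl N P A * ctrl N P B = ctrl N P (A * B)"
proof -
  define P' where "P' = 1\<^sub>m W - P"
  have c: "P \<in> carrier_mat W W" "P * P = P" using P by (auto simp: orth_proj_def)
  have c': "P' \<in> carrier_mat W W" "P' * P' = P'" "P * P' = 0\<^sub>m W W" "P' * P = 0\<^sub>m W W"
    using orth_proj_complement[OF P] unfolding P'_def orth_proj_def by auto
  have k: "kron A P \<in> carrier_mat (N*W) (N*W)" "kron B P \<in> carrier_mat (N*W) (N*W)"
     "kron (1\<^sub>m N) P' \<in> carrier_mat (N*W) (N*W)" using A B c c' by auto
  have "ctrl N P A * ctrl N P B = (kron A P + kron (1\<^sub>m N) P') * (kron B P + kron (1\<^sub>m N) P')"
    using c by (simp add: ctrl_def P'_def)
  also have "\<dots> = kron A P * kron B P + kron (1\<^sub>m N) P' * kron B P + (kron A P * kron (1\<^sub>m N) P' + kron (1\<^sub>m N) P' * kron (1\<^sub>m N) P')"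
    using k by (simp add: add_mult_distrib_mat[of _ "N*W" "N*W" _ _ "N*W"] mult_add_distrib_mat[of _ "N*W" "N*W" _ "N*W"])
  also have "\<dots> = kron (A * B) P + 0\<^sub>m (N*W) (N*W) + (0\<^sub>m (N*W) (N*W) + kron (1\<^sub>m N) P')"
    using A B c c' by (simp add: kron_mult[of _ N N _ W W _ N _ W] kron_zero_right)
  also have "\<dots> = ctrl N P (A * B)" using k A B c unfolding ctrl_def P'_def[symmetric]
    by (intro eq_matI) (auto simp: P'_def)
  finally show ?thesis .
qed

lemma ctrl_one: "orth_proj W P \<Longrightarrow> ctrl N P (1\<^sub>m N) = 1\<^sub>m (N * W)"
proof -
  assume P: "orth_proj W P"
  hence c: "P \<in> carrier_mat W W" by (simp add: orth_proj_def)
  have "ctrl N P (1\<^sub>m N) = kron (1\<^sub>m N) (P + (1\<^sub>m W - P))"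
    unfolding ctrl_def using c by (subst kron_add_right[of _ N N _ W W]) auto
  also have "P + (1\<^sub>m W - P) = 1\<^sub>m W" using c by (intro eq_matI) auto
  finally show ?thesis by (simp add: kron_one)
qed

lemma adj_ctrl:
  assumes P: "orth_proj W P" and A: "A \<in> carrier_mat N N"
  shows "adj (ctrl N P A) = ctrl N P (adj A)"
proof -
  have c: "P \<in> carrier_mat W W" "adj P = P" using P by (auto simp: orth_proj_def)
  show ?thesis unfolding ctrl_def using c A
    by (subst adj_add[of _ "N*W" "N*W"]) (auto simp: adj_kron adj_minus[of _ W W] intro!: kron_carrier)
qed

lemma ctrl_unitary:
  assumes P: "orth_proj W P" and U: "unitary_mat N U"
  shows "unitary_mat (N * W) (ctrl N P U)"
proof -
  have c: "P \<in> carrier_mat W W" using P by (auto simp: orth_proj_def)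
  have u: "U \<in> carrier_mat N N" "adj U \<in> carrier_mat N N" "U * adj U = 1\<^sub>m N" "adj U * U = 1\<^sub>m N"
    using U by (auto simp: unitary_mat_def)
  show ?thesis unfolding unitary_mat_def adj_ctrl[OF P u(1)] ctrl_mult[OF P u(1,2)] ctrl_mult[OF P u(2,1)] u
    using c u by (simp add: ctrl_one[OF P])
qed

lemma query_gate_unitary:
  assumes "orth_proj W (snd (snd q))" "unitary_mat N U" "unitary_mat N V"
  shows "unitary_mat (N * W) (query_gate N U V q)"
  using assms by (cases q) (auto simp: query_gate_ctrl intro!: ctrl_unitary unitary_adj)

section \<open>Runs of an algorithm and the hybrid argument\<close>

definition alg_step :: "nat \<Rightarrow> complex mat \<Rightarrow> complex mat \<Rightarrow> complex vec \<Rightarrow> query \<times> complex mat \<Rightarrow> complex vec" where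
  "alg_step N U V \<psi> = (\<lambda>(q, X). X *\<^sub>v (query_gate N U V q *\<^sub>v \<psi>))"

lemma final_state_foldl:
  "final_state N W V0 steps U V = foldl (alg_step N U V) (V0 *\<^sub>v unit_vec (N*W) 0) steps"
  unfolding final_state_def alg_step_def ..

definition valid_steps :: "nat \<Rightarrow> nat \<Rightarrow> (query \<times> complex mat) list \<Rightarrow> bool" where
  "valid_steps N W steps \<longleftrightarrow> (\<forall>(q,V) \<in> set steps. unitary_mat (N*W) V \<and> orth_proj W (snd (snd q)))"

lemma alg_step_norm:
  assumes "unitary_mat (N*W) X" "orth_proj W (snd (snd q))" "unitary_mat N U" "unitary_mat N V" "\<psi> \<in> carrier_vec (N*W)"
  shows "alg_step N U V \<psi> (q, X) \<in> carrier_vec (N*W)" "vnorm (alg_step N U V \<psi> (q, X)) = vnorm \<psi>"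
proof -
  have Q: "unitary_mat (N*W) (query_gate N U V q)" by (intro query_gate_unitary assms)
  have w: "query_gate N U V q *\<^sub>v \<psi> \<in> carrier_vec (N*W)"
    by (rule mult_mat_vec_carrier[OF unitary_carrier[OF Q] assms(5)])
  show "alg_step N U V \<psi> (q, X) \<in> carrier_vec (N*W)"
    unfolding alg_step_def using mult_mat_vec_carrier[OF unitary_carrier[OF assms(1)] w] by simp
  show "vnorm (alg_step N U V \<psi> (q, X)) = vnorm \<psi>"
    unfolding alg_step_def using vnorm_unitary[OF assms(1) w] vnorm_unitary[OF Q assms(5)] by simp
qed

lemma foldl_norm:
  assumes "valid_steps N W steps" "unitary_mat N U" "unitary_mat N V" "\<psi> \<in> carrier_vec (N*W)"
  shows "foldl (alg_step N U V) \<psi> steps \<in> carrier_vec (N*W) \<and> vnorm (foldl (alg_step N U V) \<psi> steps) = vnorm \<psi>"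
  using assms
proof (induction steps arbitrary: \<psi>)
  case (Cons st steps)
  obtain q X where st: "st = (q, X)" by (cases st)
  have "alg_step N U V \<psi> st \<in> carrier_vec (N*W)" "vnorm (alg_step N U V \<psi> st) = vnorm \<psi>"
    using alg_step_norm[of N W X q U V \<psi>] Cons.prems unfolding st valid_steps_def by auto
  thus ?case using Cons unfolding valid_steps_def by auto
qed simp

lemma initial_norm:
  assumes "unitary_mat d V0" "0 < d"
  shows "V0 *\<^sub>v unit_vec d 0 \<in> carrier_vec d" "vnorm (V0 *\<^sub>v unit_vec d 0) = 1"
proof -
  have "(vnorm (unit_vec d 0))\<^sup>2 = (\<Sum>i<d. if i = 0 then 1 else 0)"
    unfolding vnorm_sq by (intro sum.cong) auto
  also have "\<dots> = 1" using assms by simp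
  finally have "vnorm (unit_vec d 0) = 1" by (simp add: power2_eq_1_iff) (metis vnorm_nonneg neg_0_le_iff_le not_one_le_zero)
  thus "vnorm (V0 *\<^sub>v unit_vec d 0) = 1" using vnorm_unitary[OF assms(1), of "unit_vec d 0"] by simp
  show "V0 *\<^sub>v unit_vec d 0 \<in> carrier_vec d" using assms by (intro mult_mat_vec_carrier[of _ d d]) auto
qed

lemma final_state_norm:
  assumes "valid_alg N W V0 steps" "unitary_mat N U" "unitary_mat N V" "0 < N * W"
  shows "final_state N W V0 steps U V \<in> carrier_vec (N*W)" "vnorm (final_state N W V0 steps U V) = 1"
proof -
  have v: "unitary_mat (N*W) V0" "valid_steps N W steps"
    using assms(1) by (auto simp: valid_alg_def valid_steps_def)
  show "final_state N W V0 steps U V \<in> carrier_vec (N*W)" "vnorm (final_state N W V0 steps U V) = 1"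
    unfolding final_state_foldl
    using foldl_norm[OF v(2) assms(2,3) initial_norm(1)[OF v(1) assms(4)]] initial_norm(2)[OF v(1) assms(4)] by auto
qed

text \<open>A common unitary step preserves the distance reached so far, and replacing the gate on
  the second run, whose state has norm 1, adds at most \<eta>. Queries to the second oracle are
  identical in both runs and add nothing.\<close>

lemma hybrid:
  assumes steps: "valid_steps N W steps" and U: "unitary_mat N U" "unitary_mat N U'" "unitary_mat N V"
    and close: "\<And>P d v. orth_proj W P \<Longrightarrow> v \<in> carrier_vec (N*W) \<Longrightarrow>
      vnorm (query_gate N U V (False, d, P) *\<^sub>v v - query_gate N U' V (False, d, P) *\<^sub>v v) \<le> \<eta> * vnorm v"
    and \<eta>: "0 \<le> \<eta>"
    and \<psi>: "\<psi> \<in> carrier_vec (N*W)" "\<psi>' \<in> carrier_vec (N*W)" "vnorm \<psi>' = 1"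
  shows "vnorm (foldl (alg_step N U V) \<psi> steps - foldl (alg_step N U' V) \<psi>' steps)
    \<le> vnorm (\<psi> - \<psi>') + real (length steps) * \<eta>"
  using steps \<psi>
proof (induction steps arbitrary: \<psi> \<psi>')
  case (Cons st steps)
  obtain q X where st: "st = (q, X)" by (cases st)
  obtain s d P where q: "q = (s, d, P)" by (cases q)
  have vs: "unitary_mat (N*W) X" "orth_proj W P" "valid_steps N W steps"
    using Cons.prems(1) unfolding st q valid_steps_def by auto
  define Q where "Q = query_gate N U V q"
  define Q' where "Q' = query_gate N U' V q"
  have QU: "unitary_mat (N*W) Q" "unitary_mat (N*W) Q'" unfolding Q_def Q'_def
    by (intro query_gate_unitary U; simp add: q vs)+
  have c: "Q \<in> carrier_mat (N*W) (N*W)" "Q' \<in> carrier_mat (N*W) (N*W)" "X \<in> carrier_mat (N*W) (N*W)"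
    using QU vs by auto
  have qc: "vnorm (Q *\<^sub>v v - Q' *\<^sub>v v) \<le> \<eta> * vnorm v" if v: "v \<in> carrier_vec (N*W)" for v
  proof (cases s)
    case True
    have "Q = Q'" unfolding Q_def Q'_def q using True by (simp add: query_gate_ctrl)
    moreover have "vnorm (w - w) = 0" for w by (simp add: vnorm_def L2_set_def)
    ultimately show ?thesis using \<eta> by simp
  next
    case False
    thus ?thesis unfolding Q_def Q'_def q using close[OF vs(2) v] by simp
  qed
  define \<phi> where "\<phi> = alg_step N U V \<psi> st"
  define \<phi>' where "\<phi>' = alg_step N U' V \<psi>' st"
  have \<phi>: "\<phi> = X *\<^sub>v (Q *\<^sub>v \<psi>)" "\<phi>' = X *\<^sub>v (Q' *\<^sub>v \<psi>')"
    unfolding \<phi>_def \<phi>'_def alg_step_def st Q_def Q'_def by auto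
  have cv: "\<phi> \<in> carrier_vec (N*W)" "\<phi>' \<in> carrier_vec (N*W)" "vnorm \<phi>' = 1"
    unfolding \<phi>_def \<phi>'_def st using alg_step_norm[of N W X q] vs U Cons.prems by (auto simp: q)
  have qv: "Q *\<^sub>v \<psi> \<in> carrier_vec (N*W)" "Q *\<^sub>v \<psi>' \<in> carrier_vec (N*W)" "Q' *\<^sub>v \<psi>' \<in> carrier_vec (N*W)"
    using c Cons.prems by (auto intro!: mult_mat_vec_carrier[of _ "N*W" "N*W"])
  have "vnorm (\<phi> - \<phi>') = vnorm (X *\<^sub>v (Q *\<^sub>v \<psi> - Q' *\<^sub>v \<psi>'))"
    unfolding \<phi> using c qv by (simp add: mult_minus_distrib_mat_vec)
  also have "\<dots> = vnorm (Q *\<^sub>v \<psi> - Q' *\<^sub>v \<psi>')" using qv by (intro vnorm_unitary[OF vs(1)]) auto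
  also have "Q *\<^sub>v \<psi> - Q' *\<^sub>v \<psi>' = Q *\<^sub>v (\<psi> - \<psi>') + (Q *\<^sub>v \<psi>' - Q' *\<^sub>v \<psi>')"
    using c qv Cons.prems by (simp add: mult_minus_distrib_mat_vec) (intro eq_vecI; auto)
  also have "vnorm \<dots> \<le> vnorm (Q *\<^sub>v (\<psi> - \<psi>')) + vnorm (Q *\<^sub>v \<psi>' - Q' *\<^sub>v \<psi>')"
    using c qv Cons.prems by (intro vnorm_triangle[of _ "N*W"]) (auto intro!: mult_mat_vec_carrier[of _ "N*W" "N*W"])
  also have "vnorm (Q *\<^sub>v (\<psi> - \<psi>')) = vnorm (\<psi> - \<psi>')" using Cons.prems by (intro vnorm_unitary[OF QU(1)]) auto
  also have "vnorm (Q *\<^sub>v \<psi>' - Q' *\<^sub>v \<psi>') \<le> \<eta>" using qc[of \<psi>'] Cons.prems by simp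
  finally have "vnorm (\<phi> - \<phi>') \<le> vnorm (\<psi> - \<psi>') + \<eta>" by simp
  moreover have "vnorm (foldl (alg_step N U V) \<phi> steps - foldl (alg_step N U' V) \<phi>' steps)
    \<le> vnorm (\<phi> - \<phi>') + real (length steps) * \<eta>" by (rule Cons.IH[OF vs(3) cv])
  ultimately show ?case unfolding \<phi>_def \<phi>'_def by (simp add: algebra_simps)
qed simp

section \<open>Diagonal states\<close>

text \<open>\<open>\<kappa> j\<close> is a row in which, among the columns of \<open>J\<close>, only
  column \<open>j\<close> has a non-zero entry; this gives independence. Every other column is 0 or
  proportional to a single one of them, so \<open>J\<close> yields a maximal independent
  set.\<close>

lemma mrank_eq_card:
  assumes A: "A \<in> carrier_mat n n" and J: "J \<subseteq> {..<n}"
    and \<kappa>: "\<And>j. j \<in> J \<Longrightarrow> \<kappa> j < n" "\<And>j. j \<in> J \<Longrightarrow> A $$ (\<kappa> j, j) \<noteq> 0"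
      "\<And>j j'. j \<in> J \<Longrightarrow> j' \<in> J \<Longrightarrow> j \<noteq> j' \<Longrightarrow> A $$ (\<kappa> j, j') = 0"
    and rest: "\<And>i. i < n \<Longrightarrow> i \<notin> J \<Longrightarrow> (\<exists>j\<in>J. \<exists>c. \<forall>k<n. A $$ (k, i) = c * A $$ (k, j)) \<or> (\<forall>k<n. A $$ (k, i) = 0)"
  shows "mrank n A = card J"
proof -
  interpret vec_space "TYPE(complex)" n .
  define S where "S = col A ` J"
  have finJ: "finite J" using J by (rule finite_subset) simp
  have colc: "col A j \<in> carrier_vec n" for j using A by auto
  have colx: "col A j $ k = A $$ (k, j)" if "k < n" "j < n" for j k using A that by simp
  have Jn: "j < n" if "j \<in> J" for j using that J by auto
  have inj: "inj_on (col A) J"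
  proof (rule inj_onI, rule ccontr)
    fix j j' assume h: "j \<in> J" "j' \<in> J" "col A j = col A j'" "j \<noteq> j'"
    have "A $$ (\<kappa> j, j) = A $$ (\<kappa> j, j')"
      using h(3) colx[OF \<kappa>(1)[OF h(1)] Jn[OF h(1)]] colx[OF \<kappa>(1)[OF h(1)] Jn[OF h(2)]] by simp
    thus False using \<kappa>(2)[OF h(1)] \<kappa>(3)[OF h(1,2,4)] by simp
  qed
  have setc: "set (cols A) = col A ` {..<n}" using A by (auto simp: cols_def)
  have Sc: "S \<subseteq> set (cols A)" "S \<subseteq> carrier_vec n" unfolding S_def setc using J colc by auto
  have indpt: "lin_indpt S"
  proof
    assume "lin_dep S"
    then obtain B a v where B: "finite B" "B \<subseteq> S" "lincomb a B = 0\<^sub>v n" "v \<in> B" "a v \<noteq> 0"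
      unfolding lin_dep_def by (auto simp: class_ring_simps)
    then obtain j where j: "j \<in> J" "v = col A j" unfolding S_def by auto
    have "0 = lincomb a B $ \<kappa> j" using B(3) \<kappa>(1)[OF j(1)] by simp
    also have "\<dots> = (\<Sum>x\<in>B. a x * x $ \<kappa> j)" using B(2) Sc by (intro lincomb_index \<kappa> j) auto
    also have "\<dots> = (\<Sum>x\<in>B. if x = v then a v * A $$ (\<kappa> j, j) else 0)"
    proof (intro sum.cong refl)
      fix x assume "x \<in> B"
      then obtain j' where j': "j' \<in> J" "x = col A j'" using B(2) unfolding S_def by auto
      show "a x * x $ \<kappa> j = (if x = v then a v * A $$ (\<kappa> j, j) else 0)"
        using j j' \<kappa>(3)[OF j(1) j'(1)] colx[OF \<kappa>(1)[OF j(1)] Jn[OF j'(1)]] inj_onD[OF inj _ j(1) j'(1)]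
        by (cases "j = j'") auto
    qed
    also have "\<dots> = a v * A $$ (\<kappa> j, j)" using B by simp
    finally show False using B(5) \<kappa>(2)[OF j(1)] by simp
  qed
  have "maximal S (\<lambda>T. T \<subseteq> set (cols A) \<and> lin_indpt T)"
    unfolding maximal_def
  proof (intro conjI Sc(1) indpt allI impI)
    fix T assume T: "S \<subseteq> T \<and> T \<subseteq> set (cols A) \<and> lin_indpt T"
    show "T = S"
    proof (rule ccontr)
      assume "T \<noteq> S"
      then obtain t where t: "t \<in> T" "t \<notin> S" using T by auto
      then obtain i where i: "i < n" "t = col A i" using T setc by auto
      have iJ: "i \<notin> J" using t i unfolding S_def by auto
      have "lin_dep T"
      proof (rule disjE[OF rest[OF i(1) iJ]])
        assume "\<exists>j\<in>J. \<exists>c. \<forall>k<n. A $$ (k, i) = c * A $$ (k, j)"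
        then obtain j c where j: "j \<in> J" "\<forall>k<n. A $$ (k, i) = c * A $$ (k, j)" by auto
        define s where "s = col A j"
        have s: "s \<in> T" "s \<noteq> t" using T j t unfolding s_def S_def by auto
        define a where "a x = (if x = t then 1 else - c)" for x :: "complex vec"
        have "lincomb a {s, t} = 0\<^sub>v n"
        proof (rule eq_vecI)
          fix k assume k: "k < dim_vec (0\<^sub>v n :: complex vec)"
          have "lincomb a {s, t} $ k = (\<Sum>x\<in>{s, t}. a x * x $ k)"
            using k i(2) colc unfolding s_def by (intro lincomb_index) auto
          also have "\<dots> = 0" using s k i j Jn[OF j(1)] by (simp add: a_def s_def colx del: index_col)
          finally show "lincomb a {s, t} $ k = 0\<^sub>v n $ k" using k by simp
        qed (use i(2) colc in \<open>auto simp: s_def intro!: lincomb_dim\<close>)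
        thus ?thesis unfolding lin_dep_def
          using s t by (intro exI[of _ "{s, t}"] exI[of _ a] exI[of _ t]) (auto simp: a_def class_ring_simps)
      next
        assume z: "\<forall>k<n. A $$ (k, i) = 0"
        have "t = 0\<^sub>v n" using z i A by (intro eq_vecI) auto
        hence "lincomb (\<lambda>_. 1) {t} = 0\<^sub>v n"
        proof -
          assume t0: "t = 0\<^sub>v n"
          show ?thesis
          proof (rule eq_vecI)
            fix k assume k: "k < dim_vec (0\<^sub>v n :: complex vec)"
            have "lincomb (\<lambda>_. 1) {t} $ k = (\<Sum>x\<in>{t}. 1 * x $ k)"
              using k t0 by (intro lincomb_index) auto
            thus "lincomb (\<lambda>_. 1) {t} $ k = 0\<^sub>v n $ k" using t0 by simp
          qed (use t0 in \<open>auto intro!: lincomb_dim\<close>)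
        qed
        thus ?thesis unfolding lin_dep_def
          using t by (intro exI[of _ "{t}"] exI[of _ "\<lambda>_. 1"] exI[of _ t]) (auto simp: class_ring_simps)
      qed
      thus False using T by simp
    qed
  qed
  from rank_card_indpt[OF A this] show ?thesis unfolding mrank_def S_def by (simp add: card_image[OF inj])
qed

definition real_diag :: "nat \<Rightarrow> (nat \<Rightarrow> real) \<Rightarrow> complex mat" where
  "real_diag n p = mat n n (\<lambda>(i, j). if i = j then complex_of_real (p i) else 0)"

lemma real_diag_carrier [simp]: "real_diag n p \<in> carrier_mat n n" by (simp add: real_diag_def)

lemma real_diag_index: "i < n \<Longrightarrow> j < n \<Longrightarrow> real_diag n p $$ (i, j) = (if i = j then complex_of_real (p i) else 0)"
  by (simp add: real_diag_def)

lemma mrank_real_diag: "mrank n (real_diag n p) = card {i. i < n \<and> p i \<noteq> 0}"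
  by (rule mrank_eq_card[where \<kappa> = id]) (auto simp: real_diag_index)

lemma real_diag_mult_left: "A \<in> carrier_mat n n \<Longrightarrow> i < n \<Longrightarrow> j < n \<Longrightarrow> (real_diag n p * A) $$ (i, j) = complex_of_real (p i) * A $$ (i, j)"
  by (simp add: mult_index[of _ n n _ n] real_diag_index if_distrib[of "\<lambda>x. x * _"] cong: if_cong)

lemma real_diag_mult_right: "A \<in> carrier_mat n n \<Longrightarrow> i < n \<Longrightarrow> j < n \<Longrightarrow> (A * real_diag n p) $$ (i, j) = A $$ (i, j) * complex_of_real (p j)"
  by (simp add: mult_index[of _ n n _ n] real_diag_index if_distrib[of "\<lambda>x. _ * x"] cong: if_cong)

lemma real_diag_mult: "real_diag n p * real_diag n q = real_diag n (\<lambda>i. p i * q i)"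
proof (rule eq_matI)
  fix i j assume "i < dim_row (real_diag n (\<lambda>i. p i * q i))" "j < dim_col (real_diag n (\<lambda>i. p i * q i))"
  hence "i < n" "j < n" by (auto simp: real_diag_def)
  thus "(real_diag n p * real_diag n q) $$ (i, j) = real_diag n (\<lambda>i. p i * q i) $$ (i, j)"
    by (simp add: real_diag_mult_left[OF real_diag_carrier] real_diag_index del: index_mult_mat(1))
qed (auto simp: real_diag_def)

lemma inner_sum: "u \<in> carrier_vec n \<Longrightarrow> v \<in> carrier_vec n \<Longrightarrow> u \<bullet>c v = (\<Sum>i<n. u $ i * cnj (v $ i))"
  by (auto simp: scalar_prod_def atLeast0LessThan intro!: sum.cong)

lemma psd_real_diag:
  assumes "\<And>i. 0 \<le> p i"
  shows "psd n (real_diag n p)"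
proof -
  have "adj (real_diag n p) = real_diag n p" by (rule eq_matI) (auto simp: real_diag_def)
  moreover have "Im ((real_diag n p *\<^sub>v v) \<bullet>c v) = 0 \<and> 0 \<le> Re ((real_diag n p *\<^sub>v v) \<bullet>c v)" if v: "v \<in> carrier_vec n" for v
  proof -
    have "(real_diag n p *\<^sub>v v) $ i = complex_of_real (p i) * v $ i" if "i < n" for i
      using that v by (simp add: mult_vec_index[of _ n n] real_diag_index if_distrib[of "\<lambda>x. x * _"] cong: if_cong)
    hence "(real_diag n p *\<^sub>v v) \<bullet>c v = (\<Sum>i<n. complex_of_real (p i) * v $ i * cnj (v $ i))"
      using v by (subst inner_sum[of _ n]) (auto intro!: mult_mat_vec_carrier[of _ n n])
    also have "\<dots> = complex_of_real (\<Sum>i<n. p i * (cmod (v $ i))\<^sup>2)"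
      unfolding of_real_sum by (intro sum.cong refl) (simp only: of_real_mult mult.assoc complex_norm_square)
    finally show ?thesis using assms by (auto intro!: sum_nonneg)
  qed
  ultimately show ?thesis unfolding psd_def by simp
qed

text \<open>Uniqueness of the square root of a diagonal matrix: \<open>x = B e\<^sub>i - c\<^sub>i e\<^sub>i\<close> satisfies
  \<open>B x = - c\<^sub>i x\<close>, which positivity of \<open>B\<close> allows only for \<open>x = 0\<close>.\<close>

lemma msqrt_real_diag:
  assumes c: "\<And>i. 0 \<le> c i"
  shows "msqrt n (real_diag n (\<lambda>i. c i * c i)) = real_diag n c"
  unfolding msqrt_def
proof (rule the_equality)
  show "psd n (real_diag n c) \<and> real_diag n c * real_diag n c = real_diag n (\<lambda>i. c i * c i)"
    using psd_real_diag[OF c] real_diag_mult by simp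
  fix B assume B: "psd n B \<and> B * B = real_diag n (\<lambda>i. c i * c i)"
  hence Bc: "B \<in> carrier_mat n n" and Ba: "adj B = B" by (auto simp: psd_def)
  show "B = real_diag n c"
  proof (rule eq_matI)
    fix k i assume "k < dim_row (real_diag n c)" "i < dim_col (real_diag n c)"
    hence ki: "k < n" "i < n" by (auto simp: real_diag_def)
    define x where "x = vec n (\<lambda>k. B $$ (k, i) - (if k = i then complex_of_real (c i) else 0))"
    have x: "x \<in> carrier_vec n" by (simp add: x_def)
    have Bx: "(B *\<^sub>v x) $ k = - complex_of_real (c i) * x $ k" if k: "k < n" for k
    proof -
      have "(B *\<^sub>v x) $ k = (\<Sum>l<n. B $$ (k, l) * B $$ (l, i)) - (\<Sum>l<n. if l = i then B $$ (k, l) * complex_of_real (c i) else 0)"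
        unfolding mult_vec_index[OF Bc x k] sum_subtractf[symmetric]
        by (intro sum.cong refl) (auto simp: x_def algebra_simps)
      also have "(\<Sum>l<n. B $$ (k, l) * B $$ (l, i)) = (B * B) $$ (k, i)"
        by (rule mult_index[OF Bc Bc k ki(2), symmetric])
      also have "\<dots> = (if k = i then complex_of_real (c i * c i) else 0)" using B k ki by (simp add: real_diag_index)
      also have "(\<Sum>l<n. if l = i then B $$ (k, l) * complex_of_real (c i) else 0) = B $$ (k, i) * complex_of_real (c i)"
        using ki by simp
      finally show ?thesis using k by (simp add: x_def algebra_simps)
    qed
    have nx: "(\<Sum>k<n. x $ k * cnj (x $ k)) = complex_of_real ((vnorm x)\<^sup>2)" by (rule vnorm_sq_inner[OF x, symmetric])
    have "vnorm x = 0"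
    proof (cases "c i = 0")
      \<comment> \<open>The relation for \<open>B x\<close> carries no sign information now.
        Instead, since \<open>B\<close> is self-adjoint, the squared norm of its column
        \<open>i\<close> is a diagonal entry of \<open>B * B\<close>, which is 0.\<close>
      case True
      have "x = col B i" unfolding x_def using True Bc ki by (intro eq_vecI) auto
      have "(\<Sum>k<n. x $ k * cnj (x $ k)) = (\<Sum>k<n. B $$ (i, k) * B $$ (k, i))"
      proof (intro sum.cong refl)
        fix k assume k: "k \<in> {..<n}"
        have "cnj (B $$ (k, i)) = adj B $$ (i, k)" using Bc k ki by simp
        thus "x $ k * cnj (x $ k) = B $$ (i, k) * B $$ (k, i)" using k True Ba by (simp add: x_def)
      qed
      also have "\<dots> = (B * B) $$ (i, i)" by (rule mult_index[OF Bc Bc ki(2) ki(2), symmetric])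
      also have "\<dots> = 0" using B ki True by (simp add: real_diag_index)
      finally show ?thesis unfolding nx by simp
    next
      case False
      have "(B *\<^sub>v x) \<bullet>c x = (\<Sum>k<n. (B *\<^sub>v x) $ k * cnj (x $ k))"
        using Bc x by (intro inner_sum mult_mat_vec_carrier)
      also have "\<dots> = - complex_of_real (c i) * (\<Sum>k<n. x $ k * cnj (x $ k))"
        unfolding sum_distrib_left by (intro sum.cong refl) (simp add: Bx)
      also have "\<dots> = complex_of_real (- (c i * (vnorm x)\<^sup>2))" unfolding nx by simp
      finally have "Re ((B *\<^sub>v x) \<bullet>c x) = - (c i * (vnorm x)\<^sup>2)" by simp
      moreover have "0 \<le> Re ((B *\<^sub>v x) \<bullet>c x)" using B x by (auto simp: psd_def)
      ultimately have "c i * (vnorm x)\<^sup>2 \<le> 0" by simp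
      moreover have "c i > 0" using False c[of i] by simp
      ultimately show ?thesis by (metis linorder_not_le mult_pos_pos zero_less_power vnorm_nonneg less_le)
    qed
    hence "(\<Sum>k<n. (cmod (x $ k))\<^sup>2) = 0" using vnorm_sq[of x] x by simp
    hence "(cmod (x $ k))\<^sup>2 = 0" using ki by (subst (asm) sum_nonneg_eq_0_iff) auto
    thus "B $$ (k, i) = real_diag n c $$ (k, i)" using ki by (simp add: x_def real_diag_index split: if_splits)
  qed (use Bc in \<open>auto simp: real_diag_def\<close>)
qed

lemma mtrace_real_diag: "mtrace (real_diag n p) = complex_of_real (\<Sum>i<n. p i)"
  by (simp add: mtrace_def real_diag_def)

text \<open>Diagonality is asked only after multiplying with the root of \<sigma> on both sides: the
  rotated state has off-diagonal entries between the indices 0 and \<open>r\<close>, and \<sigma>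
  vanishes at \<open>r\<close>.\<close>

lemma fidelity_real_diag_right:
  assumes q: "\<And>i. 0 \<le> q i" and c: "\<And>i. 0 \<le> c i" and \<rho>: "\<rho> \<in> carrier_mat n n"
    and eq: "\<And>i j. i < n \<Longrightarrow> j < n \<Longrightarrow> complex_of_real (sqrt (q i)) * \<rho> $$ (i, j) * complex_of_real (sqrt (q j))
      = (if i = j then complex_of_real (c i * c i) else 0)"
  shows "fidelity n \<rho> (real_diag n q) = (\<Sum>i<n. c i)"
proof -
  have s: "msqrt n (real_diag n q) = real_diag n (\<lambda>i. sqrt (q i))"
    using msqrt_real_diag[of "\<lambda>i. sqrt (q i)" n] q by simp
  have "real_diag n (\<lambda>i. sqrt (q i)) * \<rho> * real_diag n (\<lambda>i. sqrt (q i)) = real_diag n (\<lambda>i. c i * c i)"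
  proof (rule eq_matI)
    fix i j assume "i < dim_row (real_diag n (\<lambda>i. c i * c i))" "j < dim_col (real_diag n (\<lambda>i. c i * c i))"
    hence ij: "i < n" "j < n" by (auto simp: real_diag_def)
    have "real_diag n (\<lambda>i. sqrt (q i)) * \<rho> \<in> carrier_mat n n" using \<rho> by (intro mult_carrier_mat[of _ n n _ n]) auto
    thus "(real_diag n (\<lambda>i. sqrt (q i)) * \<rho> * real_diag n (\<lambda>i. sqrt (q i))) $$ (i, j) = real_diag n (\<lambda>i. c i * c i) $$ (i, j)"
      using eq[OF ij] ij \<rho> by (simp add: real_diag_mult_left real_diag_mult_right real_diag_index)
  qed (use \<rho> in \<open>auto simp: real_diag_def\<close>)
  thus ?thesis unfolding fidelity_def s by (simp add: msqrt_real_diag[OF c] mtrace_real_diag)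
qed

section \<open>Purifications\<close>

lemma ptrace_pure:
  assumes U: "U \<in> carrier_mat (n*m) (n*m)" and a: "a < n" "a' < n"
  shows "ptrace_B n m (U * proj0 (n*m) * adj U) $$ (a, a')
    = (\<Sum>b<m. U $$ (a*m+b, 0) * cnj (U $$ (a'*m+b, 0)))"
proof -
  define d where "d = n * m"
  have U': "U \<in> carrier_mat d d" and p: "proj0 d \<in> carrier_mat d d" using U by (auto simp: d_def proj0_def)
  have Up: "U * proj0 d \<in> carrier_mat d d" using U' p by (intro mult_carrier_mat[of _ d d _ d])
  have lt: "a * m + b < d" if "a < n" "b < m" for a b unfolding d_def by (rule pair_less[OF that])
  have e: "(U * proj0 d * adj U) $$ (x, y) = U $$ (x, 0) * cnj (U $$ (y, 0))" if "x < d" "y < d" for x y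
  proof -
    have z: "(U * proj0 d) $$ (x, k) = (if k = 0 then U $$ (x, 0) else 0)" if k: "k < d" for k
    proof -
      have "(U * proj0 d) $$ (x, k) = (\<Sum>l<d. U $$ (x, l) * proj0 d $$ (l, k))"
        by (rule mult_index[OF U' p \<open>x < d\<close> k])
      also have "\<dots> = (\<Sum>l<d. if l = 0 then (if k = 0 then U $$ (x, 0) else 0) else 0)"
        using k by (intro sum.cong refl) (auto simp: proj0_def)
      finally show ?thesis using k by simp
    qed
    have "(U * proj0 d * adj U) $$ (x, y) = (\<Sum>k<d. (U * proj0 d) $$ (x, k) * adj U $$ (k, y))"
      by (rule mult_index[OF Up _ that]) (use U' in simp)
    also have "\<dots> = (\<Sum>k<d. if k = 0 then U $$ (x, 0) * cnj (U $$ (y, 0)) else 0)"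
      using that U' by (intro sum.cong refl) (auto simp: z)
    finally show ?thesis using that by simp
  qed
  show ?thesis unfolding ptrace_B_def d_def[symmetric] using a lt e by auto
qed

lemma ptrace_carrier [simp]: "ptrace_B n m M \<in> carrier_mat n n"
  by (simp add: ptrace_B_def)

text \<open>Settles the density of all instances at once: the quadratic form is a sum of squares
  \<open>|s b|\<^sup>2\<close>, one for each basis state of the traced-out system, and the trace is
  the squared norm of the first column of \<open>U\<close>.\<close>

lemma density_ptrace:
  assumes U: "unitary_mat (n*m) U" and nm: "0 < n * m"
  shows "density n (ptrace_B n m (U * proj0 (n*m) * adj U))"
proof -
  define \<rho> where "\<rho> = ptrace_B n m (U * proj0 (n*m) * adj U)"
  define u where "u a b = U $$ (a*m+b, 0)" for a b
  have Uc: "U \<in> carrier_mat (n*m) (n*m)" using U by simp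
  have \<rho>c: "\<rho> \<in> carrier_mat n n" by (simp add: \<rho>_def)
  have \<rho>: "\<rho> $$ (a, a') = (\<Sum>b<m. u a b * cnj (u a' b))" if "a < n" "a' < n" for a a'
    unfolding \<rho>_def u_def by (rule ptrace_pure[OF Uc that])
  have herm: "adj \<rho> = \<rho>"
    by (rule eq_matI) (use \<rho>c in \<open>auto simp: \<rho> mult.commute intro!: sum.cong\<close>)
  have pos: "Im ((\<rho> *\<^sub>v v) \<bullet>c v) = 0 \<and> 0 \<le> Re ((\<rho> *\<^sub>v v) \<bullet>c v)" if v: "v \<in> carrier_vec n" for v
  proof -
    define s where "s b = (\<Sum>a<n. cnj (u a b) * v $ a)" for b
    have "(\<rho> *\<^sub>v v) \<bullet>c v = (\<Sum>a<n. (\<rho> *\<^sub>v v) $ a * cnj (v $ a))"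
      using \<rho>c v by (intro inner_sum mult_mat_vec_carrier)
    also have "\<dots> = (\<Sum>a<n. (\<Sum>a'<n. \<rho> $$ (a, a') * v $ a') * cnj (v $ a))"
      by (intro sum.cong refl) (simp only: mult_vec_index[OF \<rho>c v] lessThan_iff)
    also have "\<dots> = (\<Sum>a<n. \<Sum>a'<n. \<Sum>b<m. (cnj (u a' b) * v $ a') * (u a b * cnj (v $ a)))"
      unfolding sum_distrib_right by (intro sum.cong refl) (simp add: \<rho> sum_distrib_right sum_distrib_left mult_ac)
    also have "\<dots> = (\<Sum>a<n. \<Sum>b<m. \<Sum>a'<n. (cnj (u a' b) * v $ a') * (u a b * cnj (v $ a)))"
      by (intro sum.cong refl sum.swap)
    also have "\<dots> = (\<Sum>b<m. \<Sum>a<n. \<Sum>a'<n. (cnj (u a' b) * v $ a') * (u a b * cnj (v $ a)))" by (rule sum.swap)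
    also have "\<dots> = (\<Sum>b<m. s b * cnj (s b))"
      unfolding s_def by (intro sum.cong refl) (simp add: sum_product mult.commute cnj_sum, subst sum.swap, simp add: mult_ac)
    also have "\<dots> = complex_of_real (\<Sum>b<m. (cmod (s b))\<^sup>2)" unfolding of_real_sum by (simp only: complex_norm_square)
    finally show ?thesis by (auto intro!: sum_nonneg)
  qed
  have "mtrace \<rho> = (\<Sum>a<n. \<Sum>b<m. u a b * cnj (u a b))"
    unfolding mtrace_def using \<rho>c by (auto simp: \<rho>)
  also have "\<dots> = (\<Sum>x<n*m. u (x div m) (x mod m) * cnj (u (x div m) (x mod m)))" by (rule sum_div_mod[symmetric])
  also have "\<dots> = (\<Sum>x<n*m. adj U $$ (0, x) * U $$ (x, 0))"
    using Uc nm by (intro sum.cong refl) (auto simp: u_def mult.commute)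
  also have "\<dots> = (adj U * U) $$ (0, 0)" using Uc nm by (intro mult_index[symmetric]) auto
  also have "\<dots> = 1" using U nm by (simp add: unitary_mat_def)
  finally show ?thesis using herm pos \<rho>c unfolding density_def psd_def \<rho>_def[symmetric] by auto
qed

text \<open>A Householder reflection maps \<open>e\<^sub>0\<close> to a given real unit vector.\<close>

lemma unitary_with_column:
  fixes u :: "nat \<Rightarrow> real"
  assumes d: "0 < d" and u: "(\<Sum>i<d. (u i)\<^sup>2) = 1"
  shows "\<exists>U. unitary_mat d U \<and> (\<forall>i<d. U $$ (i, 0) = complex_of_real (u i))"
proof (cases "u 0 = 1")
  case True
  have "(\<Sum>i<d. (u i)\<^sup>2) = (u 0)\<^sup>2 + (\<Sum>i\<in>{..<d}-{0}. (u i)\<^sup>2)" using d by (intro sum.remove) auto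
  hence "(\<Sum>i\<in>{..<d}-{0}. (u i)\<^sup>2) = 0" using u True by simp
  hence "\<forall>i\<in>{..<d}-{0}. u i = 0" by (subst (asm) sum_nonneg_eq_0_iff) auto
  hence "\<forall>i<d. (1\<^sub>m d :: complex mat) $$ (i, 0) = complex_of_real (u i)" using True d by auto
  moreover have "unitary_mat d (1\<^sub>m d)" by (simp add: unitary_mat_def)
  ultimately show ?thesis by blast
next
  case False
  define v where "v i = u i - (if i = 0 then 1 else 0)" for i
  \<comment> \<open>This is \<open>2 / |v|\<^sup>2\<close> for the normal vector \<open>v\<close>,
    which is zero only in the excluded case \<open>u 0 = 1\<close>.\<close>
  define k where "k = 1 / (1 - u 0)"
  have vv: "(\<Sum>i<d. v i * v i) = 2 * (1 - u 0)"
  proof -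
    have "(\<Sum>i<d. v i * v i) = (\<Sum>i<d. (u i)\<^sup>2 + (if i = 0 then 1 - 2 * u 0 else 0))"
      by (intro sum.cong refl) (auto simp: v_def power2_eq_square algebra_simps)
    thus ?thesis using u d by (simp add: sum.distrib)
  qed
  define H where "H = mat d d (\<lambda>(i, j). complex_of_real ((if i = j then 1 else 0) - k * v i * v j))"
  have Hc: "H \<in> carrier_mat d d" by (simp add: H_def)
  have adjH: "adj H = H" by (rule eq_matI) (auto simp: H_def)
  have HH: "H * H = 1\<^sub>m d"
  proof (rule eq_matI)
    fix i j assume "i < dim_row (1\<^sub>m d :: complex mat)" "j < dim_col (1\<^sub>m d :: complex mat)"
    hence ij: "i < d" "j < d" by auto
    have "(H * H) $$ (i, j) = (\<Sum>l<d. H $$ (i, l) * H $$ (l, j))" by (rule mult_index[OF Hc Hc ij])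
    also have "\<dots> = (\<Sum>l<d. complex_of_real ((if l = i then (if i = j then 1 else 0) - k * v i * v j else 0)
        - (if l = j then k * v i * v j else 0) + k * k * v i * v j * (v l * v l)))"
      using ij by (intro sum.cong refl) (auto simp: H_def algebra_simps)
    also have "\<dots> = complex_of_real ((\<Sum>l<d. (if l = i then (if i = j then 1 else 0) - k * v i * v j else 0))
        - (\<Sum>l<d. (if l = j then k * v i * v j else 0)) + k * k * v i * v j * (\<Sum>l<d. v l * v l))"
      by (simp only: of_real_sum[symmetric] sum.distrib sum_subtractf sum_distrib_left)
    also have "\<dots> = complex_of_real ((if i = j then 1 else 0) + (k * (k * (2 * (1 - u 0))) - 2 * k) * v i * v j)"
      unfolding vv using ij by (simp add: algebra_simps)
    also have "k * (k * (2 * (1 - u 0))) - 2 * k = 0"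
    proof -
      have "k * (1 - u 0) = 1" unfolding k_def using False by simp
      moreover have "k * (k * (2 * (1 - u 0))) = 2 * k * (k * (1 - u 0))" by (simp only: mult_ac)
      ultimately show ?thesis by simp
    qed
    finally show "(H * H) $$ (i, j) = 1\<^sub>m d $$ (i, j)" using ij by simp
  qed (use Hc in auto)
  have "H $$ (i, 0) = complex_of_real (u i)" if "i < d" for i
  proof -
    have "k * v i * v 0 = - v i" unfolding k_def v_def using False by (simp add: field_simps)
    hence r: "(if i = 0 then 1 else 0) - k * v i * v 0 = u i" by (simp only: v_def)
    show ?thesis unfolding H_def index_mat(1)[OF that d] prod.case r ..
  qed
  moreover have "unitary_mat d H" unfolding unitary_mat_def adjH using Hc HH by simp
  ultimately show ?thesis by blast
qed

text \<open>The vector of the \<open>sqrt (p a)\<close> at |a>|a>; it fits only if \<open>p\<close>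
  is supported below \<open>m\<close>. The first column is part of the conclusion because a rotation
  will be applied to it.\<close>

lemma purification_exists:
  assumes p: "\<And>i. 0 \<le> p i" and sum: "(\<Sum>i<n. p i) = 1" and nm: "0 < n" "0 < m"
    and supp: "\<And>i. i < n \<Longrightarrow> m \<le> i \<Longrightarrow> p i = 0"
  shows "\<exists>U. unitary_mat (n*m) U \<and> (\<forall>a<n. \<forall>b<m. U $$ (a*m+b, 0) = (if a = b then complex_of_real (sqrt (p a)) else 0))
    \<and> purifies n m U (real_diag n p)"
proof -
  define u where "u x = (if x div m = x mod m then sqrt (p (x div m)) else 0)" for x
  have row: "(\<Sum>b<m. if a = b then f a else 0) = f a" if "a < n" "m \<le> a \<Longrightarrow> f a = 0" for a and f :: "nat \<Rightarrow> 'b::comm_monoid_add"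
    using that by (cases "a < m") auto
  have "(\<Sum>x<n*m. (u x)\<^sup>2) = (\<Sum>a<n. \<Sum>b<m. (if a = b then p a else 0))"
    unfolding sum_div_mod[symmetric] using p by (intro sum.cong refl) (simp add: u_def)
  also have "\<dots> = (\<Sum>a<n. p a)" by (intro sum.cong refl row) (use supp in auto)
  finally have "(\<Sum>x<n*m. (u x)\<^sup>2) = 1" using sum by simp
  then obtain U where U: "unitary_mat (n*m) U" "\<forall>x<n*m. U $$ (x, 0) = complex_of_real (u x)"
    using unitary_with_column[of "n*m" u] nm by auto
  have lt: "a * m + b < n * m" if "a < n" "b < m" for a b by (rule pair_less[OF that])
  have col: "U $$ (a*m+b, 0) = (if a = b then complex_of_real (sqrt (p a)) else 0)" if "a < n" "b < m" for a b
    using U(2) lt[OF that] that by (simp add: u_def)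
  have "ptrace_B n m (U * proj0 (n*m) * adj U) = real_diag n p"
  proof (rule eq_matI)
    fix a a' assume "a < dim_row (real_diag n p)" "a' < dim_col (real_diag n p)"
    hence a: "a < n" "a' < n" by (auto simp: real_diag_def)
    have "ptrace_B n m (U * proj0 (n*m) * adj U) $$ (a, a') = (\<Sum>b<m. U $$ (a*m+b, 0) * cnj (U $$ (a'*m+b, 0)))"
      using U(1) by (intro ptrace_pure a) simp
    also have "\<dots> = (\<Sum>b<m. if a = b then (if a = a' then complex_of_real (p a) else 0) else 0)"
      using a p by (intro sum.cong refl) (auto simp: col simp flip: of_real_mult)
    also have "\<dots> = (if a = a' then complex_of_real (p a) else 0)" by (rule row) (use a supp in auto)
    finally show "ptrace_B n m (U * proj0 (n*m) * adj U) $$ (a, a') = real_diag n p $$ (a, a')" using a by (simp add: real_diag_index)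
  qed (auto simp: ptrace_B_def real_diag_def)
  thus ?thesis using U(1) col unfolding purifies_def by blast
qed

lemma purifies_density: "purifies n m U \<rho> \<Longrightarrow> 0 < n * m \<Longrightarrow> density n \<rho>"
  using density_ptrace[of n m U] by (auto simp: purifies_def)

section \<open>Polynomial dependence on the word\<close>

inductive word_poly :: "nat \<Rightarrow> nat \<Rightarrow> nat \<Rightarrow> ((nat \<Rightarrow> nat) \<Rightarrow> complex) \<Rightarrow> bool" for G L where
  mono: "finite \<mu> \<Longrightarrow> snd ` \<mu> \<subseteq> {1..G} \<Longrightarrow> fst ` \<mu> \<subseteq> {..<L} \<Longrightarrow> card \<mu> \<le> d \<Longrightarrow>
    word_poly G L d (\<lambda>w. c * complex_of_real (mono_ind \<mu> w))"
| add: "word_poly G L d a \<Longrightarrow> word_poly G L d b \<Longrightarrow> word_poly G L d (\<lambda>w. a w + b w)"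

lemma word_poly_const: "word_poly G L d (\<lambda>_. c)"
  using word_poly.mono[of "{}" G L d c] by (simp add: mono_ind_def)

lemma word_poly_sum: "(\<And>i. i \<in> I \<Longrightarrow> word_poly G L d (a i)) \<Longrightarrow> word_poly G L d (\<lambda>w. \<Sum>i\<in>I. a i w)"
  by (induction I rule: infinite_finite_induct) (auto intro: word_poly_const word_poly.add)

lemma word_poly_cnj: "word_poly G L d a \<Longrightarrow> word_poly G L d (\<lambda>w. cnj (a w))"
proof (induction rule: word_poly.induct)
  case (mono \<mu> d c)
  hence "word_poly G L d (\<lambda>w. cnj c * complex_of_real (mono_ind \<mu> w))" by (rule word_poly.mono)
  thus ?case by simp
next
  case (add d a b)
  thus ?case by (simp add: word_poly.add)
qed

lemma mono_ind_Un: "mono_ind (\<mu> \<union> \<nu>) w = mono_ind \<mu> w * mono_ind \<nu> w"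
  by (auto simp: mono_ind_def)

lemma word_poly_mult:
  assumes "word_poly G L d a" "word_poly G L e b"
  shows "word_poly G L (d + e) (\<lambda>w. a w * b w)"
  using assms
proof (induction rule: word_poly.induct)
  case (mono \<mu> d c)
  show ?case using mono.prems
  proof (induction rule: word_poly.induct)
    case (mono \<nu> e c')
    have "word_poly G L (d + e) (\<lambda>w. (c * c') * complex_of_real (mono_ind (\<mu> \<union> \<nu>) w))"
      using mono \<open>finite \<mu>\<close> \<open>snd ` \<mu> \<subseteq> {1..G}\<close> \<open>fst ` \<mu> \<subseteq> {..<L}\<close> \<open>card \<mu> \<le> d\<close>
      by (intro word_poly.mono) (auto simp: image_Un intro: order_trans[OF card_Un_le])
    thus ?case by (simp add: mono_ind_Un mult_ac)
  next
    case (add e a b)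
    thus ?case by (auto simp: distrib_left intro: word_poly.add)
  qed
next
  case (add d a a')
  thus ?case by (auto simp: distrib_right intro: word_poly.add)
qed

lemma word_poly_cmult: "word_poly G L d a \<Longrightarrow> word_poly G L d (\<lambda>w. c * a w)"
  using word_poly_mult[OF word_poly_const[of G L 0 c], of d a] by simp

lemma word_poly_ind:
  assumes "l < L" "j \<in> {1..G}"
  shows "word_poly G L 1 (\<lambda>w. if w l = j then c else 0)"
proof -
  have "(\<lambda>w. if w l = j then c else 0) = (\<lambda>w. c * complex_of_real (mono_ind {(l, j)} w))"
    by (auto simp: mono_ind_def)
  moreover have "word_poly G L 1 (\<lambda>w. c * complex_of_real (mono_ind {(l, j)} w))"
    using assms by (intro word_poly.mono) auto
  ultimately show ?thesis by simp
qed

lemma word_poly_repr: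
  assumes "word_poly G L d a"
  shows "\<exists>F c. finite F \<and> (\<forall>\<mu>\<in>F. is_monomial G L d \<mu>) \<and> (\<forall>w. Re (a w) = (\<Sum>\<mu>\<in>F. c \<mu> * mono_ind \<mu> w))"
  using assms
proof (induction rule: word_poly.induct)
  case (mono \<mu> d c)
  show ?case
  proof (cases "inj_on fst \<mu>")
    case True
    thus ?thesis using mono by (intro exI[of _ "{\<mu>}"] exI[of _ "\<lambda>_. Re c"]) (auto simp: is_monomial_def)
  next
    case False
    then obtain p q where pq: "p \<in> \<mu>" "q \<in> \<mu>" "fst p = fst q" "p \<noteq> q" unfolding inj_on_def by blast
    have "\<not> (\<forall>(l, j)\<in>\<mu>. w l = j)" for w
    proof
      assume h: "\<forall>(l, j)\<in>\<mu>. w l = j"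
      have "w (fst p) = snd p" using bspec[OF h pq(1)] by (simp add: split_beta)
      moreover have "w (fst q) = snd q" using bspec[OF h pq(2)] by (simp add: split_beta)
      ultimately show False using pq(3,4) by (simp add: prod_eq_iff)
    qed
    hence "mono_ind \<mu> w = 0" for w by (simp only: mono_ind_def if_False)
    thus ?thesis by (intro exI[of _ "{}"]) simp
  qed
next
  case (add d a b)
  then obtain F1 c1 F2 c2 where F1: "finite F1" "\<forall>\<mu>\<in>F1. is_monomial G L d \<mu>" "\<forall>w. Re (a w) = (\<Sum>\<mu>\<in>F1. c1 \<mu> * mono_ind \<mu> w)"
    and F2: "finite F2" "\<forall>\<mu>\<in>F2. is_monomial G L d \<mu>" "\<forall>w. Re (b w) = (\<Sum>\<mu>\<in>F2. c2 \<mu> * mono_ind \<mu> w)"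
    by blast
  define c where "c \<mu> = (if \<mu> \<in> F1 then c1 \<mu> else 0) + (if \<mu> \<in> F2 then c2 \<mu> else 0)" for \<mu>
  have "Re (a w + b w) = (\<Sum>\<mu>\<in>F1 \<union> F2. c \<mu> * mono_ind \<mu> w)" for w
  proof -
    have "(\<Sum>\<mu>\<in>F1. c1 \<mu> * mono_ind \<mu> w) = (\<Sum>\<mu>\<in>F1 \<union> F2. (if \<mu> \<in> F1 then c1 \<mu> else 0) * mono_ind \<mu> w)"
      using F1(1) F2(1) by (intro sum.mono_neutral_cong_left) auto
    moreover have "(\<Sum>\<mu>\<in>F2. c2 \<mu> * mono_ind \<mu> w) = (\<Sum>\<mu>\<in>F1 \<union> F2. (if \<mu> \<in> F2 then c2 \<mu> else 0) * mono_ind \<mu> w)"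
      using F1(1) F2(1) by (intro sum.mono_neutral_cong_left) auto
    ultimately show ?thesis using F1(3) F2(3) by (simp add: c_def distrib_right sum.distrib)
  qed
  thus ?case using F1 F2 by (intro exI[of _ "F1 \<union> F2"] exI[of _ c]) auto
qed

text \<open>The oracle exchanges the basis states 0 and \<open>w l\<close> of the first register, controlled on the state \<open>l\<close>
  of the second one. Letters above \<open>G\<close> act as 0, which makes the oracle a unitary for every \<open>w\<close>.\<close>

definition flip0 :: "nat \<Rightarrow> nat \<Rightarrow> nat" where
  "flip0 t a = (if a = 0 then t else if a = t then 0 else a)"

lemma flip0_flip0 [simp]: "flip0 t (flip0 t a) = a"
  by (simp add: flip0_def)

definition letter :: "nat \<Rightarrow> nat \<Rightarrow> (nat \<Rightarrow> nat) \<Rightarrow> nat \<Rightarrow> nat" where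
  "letter L G w l = (if l < L \<and> w l \<le> G then w l else 0)"

definition word_perm :: "nat \<Rightarrow> nat \<Rightarrow> nat \<Rightarrow> (nat \<Rightarrow> nat) \<Rightarrow> nat \<Rightarrow> nat" where
  "word_perm m L G w y = flip0 (letter L G w (y mod m)) (y div m) * m + y mod m"

definition word_oracle :: "nat \<Rightarrow> nat \<Rightarrow> nat \<Rightarrow> nat \<Rightarrow> (nat \<Rightarrow> nat) \<Rightarrow> complex mat" where
  "word_oracle n m L G w = mat (n*m) (n*m) (\<lambda>(x, y). if x = word_perm m L G w y then 1 else 0)"

lemma word_perm_less:
  assumes "G < n" "y < n * m"
  shows "word_perm m L G w y < n * m"
proof -
  have "letter L G w (y mod m) < n" using assms by (simp add: letter_def)
  hence "flip0 (letter L G w (y mod m)) (y div m) < n"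
    using div_mod_less[OF assms(2)] assms(1) by (auto simp: flip0_def)
  thus ?thesis unfolding word_perm_def using div_mod_less[OF assms(2)] by (intro pair_less) auto
qed

lemma word_perm_involution: "y < n * m \<Longrightarrow> word_perm m L G w (word_perm m L G w y) = y"
  using div_mod_less[of y n m] by (simp add: word_perm_def)

lemma word_oracle_unitary:
  assumes G: "G < n"
  shows "unitary_mat (n*m) (word_oracle n m L G w)"
proof -
  define O' where "O' = word_oracle n m L G w"
  define d where "d = n * m"
  define f where "f = word_perm m L G w"
  have f: "f y < d" "f (f y) = y" if "y < d" for y
    using word_perm_less[OF G] word_perm_involution that unfolding f_def d_def by auto
  have c: "O' \<in> carrier_mat d d" by (simp add: O'_def word_oracle_def d_def)
  have e: "O' $$ (x, y) = (if x = f y then 1 else 0)" if "x < d" "y < d" for x y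
    using that by (simp add: O'_def word_oracle_def d_def f_def)
  have sym: "adj O' = O'"
  proof (rule eq_matI)
    fix i j assume "i < dim_row O'" "j < dim_col O'"
    hence ij: "i < d" "j < d" using c by auto
    have "j = f i \<longleftrightarrow> i = f j" using f ij by metis
    thus "adj O' $$ (i, j) = O' $$ (i, j)" using ij c by (simp add: e)
  qed (use c in auto)
  have "O' * O' = 1\<^sub>m d"
  proof (rule eq_matI)
    fix i j assume "i < dim_row (1\<^sub>m d :: complex mat)" "j < dim_col (1\<^sub>m d :: complex mat)"
    hence ij: "i < d" "j < d" by auto
    have "(O' * O') $$ (i, j) = (\<Sum>k<d. O' $$ (i, k) * O' $$ (k, j))" by (rule mult_index[OF c c ij])
    also have "\<dots> = (\<Sum>k<d. if k = f j then (if i = f (f j) then 1 else 0) else 0)"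
      using ij by (intro sum.cong refl) (auto simp: e)
    also have "\<dots> = (if i = j then 1 else 0)" using f[OF ij(2)] by simp
    finally show "(O' * O') $$ (i, j) = 1\<^sub>m d $$ (i, j)" using ij by simp
  qed (use c in auto)
  thus ?thesis unfolding unitary_mat_def O'_def[symmetric] d_def[symmetric] sym using c by simp
qed

text \<open>An entry depends on the word only through the letter at \<open>y mod m\<close>, so it is
  its value for letter 0 plus a correction for each letter \<open>j\<close> from 1 to
  \<open>G\<close>. Letters above \<open>G\<close> give the value for 0, in accordance with
  \<open>letter\<close>.\<close>

lemma word_poly_word_oracle:
  assumes "x < n * m" "y < n * m"
  shows "word_poly G L 1 (\<lambda>w. word_oracle n m L G w $$ (x, y))"
proof -
  define l where "l = y mod m"
  define e :: "nat \<Rightarrow> complex" where "e t = (if x = flip0 t (y div m) * m + l then 1 else 0)" for t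
  have eq: "word_oracle n m L G w $$ (x, y) = e (letter L G w l)" for w
    using assms by (simp add: word_oracle_def word_perm_def e_def l_def)
  show ?thesis
  proof (cases "l < L")
    case True
    have "e (letter L G w l) = e 0 + (\<Sum>j=1..G. if w l = j then e j - e 0 else 0)" for w
      using True by (cases "w l = 0") (auto simp: letter_def sum.delta)
    moreover have "word_poly G L 1 (\<lambda>w. e 0 + (\<Sum>j=1..G. if w l = j then e j - e 0 else 0))"
      using True by (intro word_poly.add word_poly_const word_poly_sum word_poly_ind) auto
    ultimately show ?thesis unfolding eq by simp
  next
    case False
    thus ?thesis unfolding eq letter_def by (simp add: word_poly_const)
  qed
qed

text \<open>Each query multiplies the amplitudes by gate entries of degree at most 1; inverse
  queries contribute conjugates, while queries to \<open>V\<close> and the fixed unitaries have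
  constant entries.\<close>

lemma word_poly_final_state:
  assumes Uc: "\<And>w. U w \<in> carrier_mat N N" and Vc: "V \<in> carrier_mat N N"
    and U: "\<And>x y. x < N \<Longrightarrow> y < N \<Longrightarrow> word_poly G L 1 (\<lambda>w. U w $$ (x, y))"
    and alg: "valid_alg N W V0 steps" and k: "k < N * W"
  shows "word_poly G L (length steps) (\<lambda>w. final_state N W V0 steps (U w) V $ k)"
proof -
  define M where "M = N * W"
  have step: "(\<forall>w. foldl (alg_step N (U w) V) (\<psi> w) st \<in> carrier_vec M) \<and>
    (\<forall>k<M. word_poly G L (d + length st) (\<lambda>w. foldl (alg_step N (U w) V) (\<psi> w) st $ k))"
    if "valid_steps N W st" "\<And>w. \<psi> w \<in> carrier_vec M" "\<And>k. k < M \<Longrightarrow> word_poly G L d (\<lambda>w. \<psi> w $ k)" for st \<psi> d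
    using that
  proof (induction st arbitrary: \<psi> d)
    case (Cons a st)
    obtain s ad P X where a: "a = ((s, ad, P), X)" by (metis prod.exhaust)
    have X: "X \<in> carrier_mat M M" and P: "P \<in> carrier_mat W W" and st: "valid_steps N W st"
      using Cons.prems(1) unfolding a valid_steps_def M_def by (auto simp: unitary_mat_def orth_proj_def)
    define H where "H w = (if ad then adj (if s then V else U w) else (if s then V else U w))" for w
    have Hc: "H w \<in> carrier_mat N N" for w using Uc Vc by (auto simp: H_def)
    have Hp: "word_poly G L 1 (\<lambda>w. H w $$ (x, y))" if "x < N" "y < N" for x y
    proof -
      have "adj (U w) $$ (x, y) = cnj (U w $$ (y, x))" for w using Uc[of w] that by simp
      thus ?thesis using U[OF that] U[OF that(2,1)] unfolding H_def
        by (cases s; cases ad) (auto intro: word_poly_const word_poly_cnj)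
    qed
    define Q where "Q w = query_gate N (U w) V (s, ad, P)" for w
    have Qeq: "Q w = ctrl N P (H w)" for w unfolding Q_def query_gate_ctrl H_def ..
    have Qc: "Q w \<in> carrier_mat M M" for w unfolding Qeq M_def using Hc P by simp
    have Qp: "word_poly G L 1 (\<lambda>w. Q w $$ (x, y))" if "x < M" "y < M" for x y
    proof -
      have xy: "x div W < N" "x mod W < W" "y div W < N" "y mod W < W"
        using div_mod_less[of x N W] div_mod_less[of y N W] that unfolding M_def by auto
      have "Q w $$ (x, y) = P $$ (x mod W, y mod W) * H w $$ (x div W, y div W)
         + kron (1\<^sub>m N) (1\<^sub>m (dim_row P) - P) $$ (x, y)" for w
        unfolding Qeq ctrl_def using that P Hc[of w] unfolding M_def
        by (subst index_add_mat) (auto simp: kron_def)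
      thus ?thesis using Hp[OF xy(1,3)] by (auto intro!: word_poly.add word_poly_const word_poly_cmult)
    qed
    define \<phi> where "\<phi> w = Q w *\<^sub>v \<psi> w" for w
    have \<phi>c: "\<phi> w \<in> carrier_vec M" for w unfolding \<phi>_def by (rule mult_mat_vec_carrier[OF Qc Cons.prems(2)])
    have \<phi>p: "word_poly G L (d + 1) (\<lambda>w. \<phi> w $ k)" if "k < M" for k
    proof -
      have "\<phi> w $ k = (\<Sum>j<M. Q w $$ (k, j) * \<psi> w $ j)" for w
        unfolding \<phi>_def by (rule mult_vec_index[OF Qc Cons.prems(2) that])
      moreover have "word_poly G L (1 + d) (\<lambda>w. \<Sum>j<M. Q w $$ (k, j) * \<psi> w $ j)"
        using that by (intro word_poly_sum word_poly_mult Qp Cons.prems(3)) auto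
      ultimately show ?thesis by simp
    qed
    define \<psi>' where "\<psi>' w = alg_step N (U w) V (\<psi> w) a" for w
    have \<psi>': "\<psi>' w = X *\<^sub>v \<phi> w" for w unfolding \<psi>'_def \<phi>_def Q_def a alg_step_def by simp
    have \<psi>'c: "\<psi>' w \<in> carrier_vec M" for w unfolding \<psi>' by (rule mult_mat_vec_carrier[OF X \<phi>c])
    have \<psi>'p: "word_poly G L (d + 1) (\<lambda>w. \<psi>' w $ k)" if "k < M" for k
    proof -
      have "\<psi>' w $ k = (\<Sum>j<M. X $$ (k, j) * \<phi> w $ j)" for w
        unfolding \<psi>' by (rule mult_vec_index[OF X \<phi>c that])
      moreover have "word_poly G L (d + 1) (\<lambda>w. \<Sum>j<M. X $$ (k, j) * \<phi> w $ j)"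
        using that by (intro word_poly_sum word_poly_cmult \<phi>p) auto
      ultimately show ?thesis by simp
    qed
    show ?case using Cons.IH[OF st \<psi>'c \<psi>'p] by (simp add: \<psi>'_def)
  qed simp
  have v: "valid_steps N W steps" "V0 \<in> carrier_mat M M" using alg unfolding valid_alg_def valid_steps_def M_def
    by (auto simp: unitary_mat_def)
  have "word_poly G L (0 + length steps) (\<lambda>w. foldl (alg_step N (U w) V) (V0 *\<^sub>v unit_vec M 0) steps $ k)"
    using step[OF v(1), of "\<lambda>_. V0 *\<^sub>v unit_vec M 0" 0] k v(2)
    by (auto simp: M_def[symmetric] intro!: word_poly_const mult_mat_vec_carrier[of _ M M])
  thus ?thesis unfolding final_state_foldl M_def by simp
qed

section \<open>The bound of order 1/epsilon\<close>

text \<open>Applied with \<open>s = 0\<close> and with \<open>s\<close> of order \<open>\<epsilon>\<close> to the eigenvector of \<open>\<rho>\<close> of largest eigenvalue: for \<open>s = 0\<close> it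
  is moved out of the support of \<open>\<sigma>\<close>.\<close>

definition plane_refl :: "nat \<Rightarrow> nat \<Rightarrow> real \<Rightarrow> complex mat" where
  "plane_refl n r s = mat n n (\<lambda>(i, j). complex_of_real (
     if i = 0 \<and> j = 0 then s else if (i = 0 \<and> j = r) \<or> (i = r \<and> j = 0) then sqrt (1 - s\<^sup>2)
     else if i = r \<and> j = r then - s else if i = j then 1 else 0))"

lemma sum_two:
  fixes f :: "nat \<Rightarrow> 'a::comm_monoid_add"
  assumes "0 < r" "r < n" "\<And>k. k < n \<Longrightarrow> k \<noteq> 0 \<Longrightarrow> k \<noteq> r \<Longrightarrow> f k = 0"
  shows "(\<Sum>k<n. f k) = f 0 + f r"
proof -
  have "(\<Sum>k<n. f k) = (\<Sum>k\<in>{0, r}. f k)" using assms by (intro sum.mono_neutral_right) auto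
  thus ?thesis using assms by simp
qed

lemma plane_refl_carrier [simp]: "plane_refl n r s \<in> carrier_mat n n" by (simp add: plane_refl_def)

lemma adj_plane_refl: "adj (plane_refl n r s) = plane_refl n r s"
  by (rule eq_matI) (auto simp: plane_refl_def)

lemma plane_refl_unitary:
  assumes "0 < r" "r < n" "0 \<le> s" "s \<le> 1"
  shows "unitary_mat n (plane_refl n r s)"
proof -
  define c where "c = sqrt (1 - s\<^sup>2)"
  have "s\<^sup>2 \<le> 1" using assms by (simp add: power_le_one)
  hence cc: "c * c = 1 - s * s" by (simp add: c_def power2_eq_square)
  have "plane_refl n r s * plane_refl n r s = 1\<^sub>m n"
  proof (rule eq_matI)
    fix i j assume "i < dim_row (1\<^sub>m n :: complex mat)" "j < dim_col (1\<^sub>m n :: complex mat)"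
    hence ij: "i < n" "j < n" by auto
    have "(plane_refl n r s * plane_refl n r s) $$ (i, j) = (\<Sum>k<n. plane_refl n r s $$ (i, k) * plane_refl n r s $$ (k, j))"
      using ij by (intro mult_index) auto
    also have "\<dots> = 1\<^sub>m n $$ (i, j)"
    proof (cases "i = 0 \<or> i = r")
      case True
      have "(\<Sum>k<n. plane_refl n r s $$ (i, k) * plane_refl n r s $$ (k, j))
        = plane_refl n r s $$ (i, 0) * plane_refl n r s $$ (0, j) + plane_refl n r s $$ (i, r) * plane_refl n r s $$ (r, j)"
        using assms True ij by (intro sum_two) (auto simp: plane_refl_def)
      thus ?thesis using True ij assms cc unfolding plane_refl_def c_def[symmetric]
        by (auto simp flip: of_real_mult of_real_add)
    next
      case False
      have e: "plane_refl n r s $$ (i, k) = (if k = i then 1 else 0)" if "k < n" for k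
        using False ij that by (simp add: plane_refl_def)
      have "(\<Sum>k<n. plane_refl n r s $$ (i, k) * plane_refl n r s $$ (k, j))
        = (\<Sum>k<n. if k = i then plane_refl n r s $$ (i, j) else 0)"
        by (intro sum.cong refl) (simp add: e)
      also have "\<dots> = 1\<^sub>m n $$ (i, j)" using ij by (simp add: e)
      finally show ?thesis .
    qed
    finally show "(plane_refl n r s * plane_refl n r s) $$ (i, j) = 1\<^sub>m n $$ (i, j)" .
  qed (auto simp: plane_refl_def)
  thus ?thesis by (simp add: unitary_mat_def adj_plane_refl)
qed

text \<open>With c = sqrt(1 - s^2), the difference acts on the plane of the indices 0 and
  \<open>r\<close> by the rows (s, c - 1) and (c - 1, -s), whose square is a multiple of the
  identity of that plane; elsewhere it is 0.\<close>

lemma plane_refl_diff: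
  assumes r: "0 < r" "r < n" and s: "0 \<le> s" "s \<le> 1"
  defines "K \<equiv> plane_refl n r s - plane_refl n r 0"
  shows "adj K * K = complex_of_real (s\<^sup>2 + (1 - sqrt (1 - s\<^sup>2))\<^sup>2) \<cdot>\<^sub>m real_diag n (\<lambda>i. if i = 0 \<or> i = r then 1 else 0)"
proof -
  define c where "c = sqrt (1 - s\<^sup>2)"
  define E where "E = s\<^sup>2 + (1 - c)\<^sup>2"
  have Kc: "K \<in> carrier_mat n n" unfolding K_def by (intro minus_carrier_mat) simp
  have Ki: "K $$ (i, j) = complex_of_real (if i = 0 \<and> j = 0 then s else if (i = 0 \<and> j = r) \<or> (i = r \<and> j = 0) then c - 1
      else if i = r \<and> j = r then - s else 0)" if "i < n" "j < n" for i j
    using that r unfolding K_def plane_refl_def c_def by auto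
  have adjK: "adj K = K" unfolding K_def by (subst adj_minus[of _ n n]) (auto simp: adj_plane_refl)
  have "K * K = complex_of_real E \<cdot>\<^sub>m real_diag n (\<lambda>i. if i = 0 \<or> i = r then 1 else 0)"
  proof (rule eq_matI)
    fix i j assume "i < dim_row (complex_of_real E \<cdot>\<^sub>m real_diag n (\<lambda>i. if i = 0 \<or> i = r then 1 else 0))"
      "j < dim_col (complex_of_real E \<cdot>\<^sub>m real_diag n (\<lambda>i. if i = 0 \<or> i = r then 1 else 0))"
    hence ij: "i < n" "j < n" by (auto simp: real_diag_def)
    have "(K * K) $$ (i, j) = (\<Sum>k<n. K $$ (i, k) * K $$ (k, j))" by (rule mult_index[OF Kc Kc ij])
    also have "\<dots> = K $$ (i, 0) * K $$ (0, j) + K $$ (i, r) * K $$ (r, j)"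
      using r ij by (intro sum_two) (auto simp: Ki)
    also have "\<dots> = (complex_of_real E \<cdot>\<^sub>m real_diag n (\<lambda>i. if i = 0 \<or> i = r then 1 else 0)) $$ (i, j)"
      using ij r by (auto simp: Ki real_diag_def E_def power2_eq_square algebra_simps simp flip: of_real_mult of_real_add)
    finally show "(K * K) $$ (i, j) = (complex_of_real E \<cdot>\<^sub>m real_diag n (\<lambda>i. if i = 0 \<or> i = r then 1 else 0)) $$ (i, j)" .
  qed (use Kc in \<open>auto simp: real_diag_def\<close>)
  thus ?thesis unfolding adjK E_def c_def .
qed

lemma orth_proj_real_diag: "orth_proj n (real_diag n (\<lambda>i. if S i then 1 else 0))"
proof -
  have "adj (real_diag n p) = real_diag n p" for p by (rule eq_matI) (auto simp: real_diag_def)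
  thus ?thesis unfolding orth_proj_def real_diag_mult by (auto intro!: arg_cong[of _ _ "real_diag n"])
qed

lemma orth_proj_one: "orth_proj m (1\<^sub>m m)"
  by (simp add: orth_proj_def)

lemma orth_proj_kron:
  assumes "orth_proj n P" "orth_proj m Q"
  shows "orth_proj (n * m) (kron P Q)"
  using assms unfolding orth_proj_def by (auto simp: adj_kron kron_mult[of _ n n _ m m _ n _ m])

lemma kron_smult_left: "A \<in> carrier_mat a b \<Longrightarrow> kron (c \<cdot>\<^sub>m A) B = c \<cdot>\<^sub>m kron A B"
  by (rule eq_matI) (auto simp: kron_def dest!: div_mod_less)

lemma vnorm_le_of_adj_mult:
  assumes E: "E \<in> carrier_mat d d" and P: "orth_proj d P" and EE: "adj E * E = complex_of_real e \<cdot>\<^sub>m P"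
    and e: "0 \<le> e" and v: "v \<in> carrier_vec d"
  shows "vnorm (E *\<^sub>v v) \<le> sqrt e * vnorm v"
proof -
  have Pc: "P \<in> carrier_mat d d" "adj P = P" "P * P = P" using P by (auto simp: orth_proj_def)
  have "complex_of_real ((vnorm (E *\<^sub>v v))\<^sup>2) = (\<Sum>j<d. v $ j * cnj (((complex_of_real e \<cdot>\<^sub>m P) *\<^sub>v v) $ j))"
    unfolding vnorm_mult_adj[OF E v] EE ..
  also have "\<dots> = complex_of_real e * (\<Sum>j<d. v $ j * cnj ((P *\<^sub>v v) $ j))"
    unfolding sum_distrib_left using Pc v by (intro sum.cong refl) (simp add: mult_ac)
  also have "(\<Sum>j<d. v $ j * cnj ((P *\<^sub>v v) $ j)) = complex_of_real ((vnorm (P *\<^sub>v v))\<^sup>2)"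
    using vnorm_mult_adj[OF Pc(1) v] Pc by simp
  finally have "(vnorm (E *\<^sub>v v))\<^sup>2 = e * (vnorm (P *\<^sub>v v))\<^sup>2"
    by (simp only: of_real_mult[symmetric] of_real_eq_iff)
  also have "\<dots> \<le> e * (vnorm v)\<^sup>2" using vnorm_orth_proj[OF P v] e by (intro mult_left_mono power_mono) auto
  also have "\<dots> = (sqrt e * vnorm v)\<^sup>2" using e by (simp add: power_mult_distrib)
  finally show ?thesis by (rule power2_le_imp_le) (use e in simp)
qed

text \<open>The parts outside the control subspace cancel, leaving
  \<open>K \<otimes> 1 \<otimes> P\<close>. Times its adjoint this is \<open>e\<close> times a
  projector, so it stretches vectors by at most \<open>sqrt e\<close>.\<close>

lemma ctrl_plane_refl_diff:
  assumes r: "0 < r" "r < n" and s: "0 \<le> s" "s \<le> 1" and P: "orth_proj W P" and v: "v \<in> carrier_vec (n*m*W)"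
  defines "R \<equiv> \<lambda>s. kron (plane_refl n r s) (1\<^sub>m m)"
  shows "vnorm (ctrl (n*m) P (R s) *\<^sub>v v - ctrl (n*m) P (R 0) *\<^sub>v v) \<le> 2 * s * vnorm v"
proof -
  define N where "N = n * m"
  define K where "K = plane_refl n r s - plane_refl n r 0"
  define E where "E = kron (kron K (1\<^sub>m m)) P"
  define e where "e = s\<^sup>2 + (1 - sqrt (1 - s\<^sup>2))\<^sup>2"
  define Pr where "Pr = real_diag n (\<lambda>i. if i = 0 \<or> i = r then 1 else 0)"
  have Pc: "P \<in> carrier_mat W W" "adj P = P" "P * P = P" using P by (auto simp: orth_proj_def)
  have Kc: "K \<in> carrier_mat n n" unfolding K_def by (intro minus_carrier_mat) simp
  have Rc: "R t \<in> carrier_mat N N" for t unfolding R_def N_def by simp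
  have Ec: "E \<in> carrier_mat (N*W) (N*W)" unfolding E_def N_def using Kc Pc by simp
  have cc: "ctrl N P (R t) \<in> carrier_mat (N*W) (N*W)" for t using Rc Pc by simp
  have "ctrl N P (R s) - ctrl N P (R 0) = kron (R s) P - kron (R 0) P"
    unfolding ctrl_def using Rc[of s] Rc[of 0] Pc
    by (intro eq_matI) (auto simp: kron_def)
  also have "\<dots> = kron (R s - R 0) P" by (rule kron_minus_left[OF Rc Rc Pc(1)])
  also have "R s - R 0 = kron K (1\<^sub>m m)" unfolding R_def K_def by (rule kron_minus_left[of _ n n _ _ m m]) auto
  finally have diff: "ctrl N P (R s) - ctrl N P (R 0) = E" unfolding E_def .
  have "adj E * E = kron (kron (adj K * K) (1\<^sub>m m)) P"
    unfolding E_def adj_kron using Kc Pc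
    by (simp add: kron_mult[of _ "n*m" "n*m" _ W W _ "n*m" _ W] kron_mult[of _ n n _ m m _ n _ m])
  also have "adj K * K = complex_of_real e \<cdot>\<^sub>m Pr"
    unfolding K_def e_def Pr_def by (rule plane_refl_diff[OF r s])
  finally have EE: "adj E * E = complex_of_real e \<cdot>\<^sub>m kron (kron Pr (1\<^sub>m m)) P"
    by (simp add: kron_smult_left[of _ n n] kron_smult_left[of _ "n*m" "n*m"] Pr_def)
  have Q: "orth_proj (N*W) (kron (kron Pr (1\<^sub>m m)) P)"
    unfolding N_def Pr_def by (intro orth_proj_kron orth_proj_real_diag orth_proj_one P)
  have s2: "s\<^sup>2 \<le> 1" using s by (simp add: power_le_one)
  \<comment> \<open>From 1 - s^2 \<le> sqrt(1 - s^2) and s^2 \<le> 1 the second summand of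
    \<open>e\<close> is at most s^4 \<le> s^2.\<close>
  have "e \<le> (2 * s)\<^sup>2"
  proof -
    have "1 - s\<^sup>2 \<le> sqrt (1 - s\<^sup>2)"
      using s2 real_le_rsqrt[of "1 - s\<^sup>2" "1 - s\<^sup>2"] by (simp add: power2_eq_square mult_left_le)
    hence "1 - sqrt (1 - s\<^sup>2) \<le> s\<^sup>2" by simp
    moreover have "0 \<le> 1 - sqrt (1 - s\<^sup>2)" by simp
    ultimately have "(1 - sqrt (1 - s\<^sup>2))\<^sup>2 \<le> (s\<^sup>2)\<^sup>2" by (intro power_mono)
    also have "\<dots> \<le> s\<^sup>2" using mult_left_mono[OF s2 zero_le_power2[of s]]
      unfolding power2_eq_square[of "s\<^sup>2"] by (simp only: mult_1_right)
    finally have "(1 - sqrt (1 - s\<^sup>2))\<^sup>2 \<le> s\<^sup>2" .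
    moreover have "0 \<le> s\<^sup>2" by simp
    moreover have "(2 * s)\<^sup>2 = 4 * s\<^sup>2" by (simp add: power_mult_distrib)
    ultimately show ?thesis unfolding e_def by linarith
  qed
  hence se: "sqrt e \<le> 2 * s" using s by (simp add: real_le_lsqrt e_def)
  have "ctrl N P (R s) *\<^sub>v v - ctrl N P (R 0) *\<^sub>v v = E *\<^sub>v v"
    unfolding diff[symmetric] by (rule minus_mult_distrib_mat_vec[OF cc cc, symmetric]) (use v in \<open>simp add: N_def\<close>)
  moreover have "vnorm (E *\<^sub>v v) \<le> sqrt e * vnorm v"
    using v by (intro vnorm_le_of_adj_mult[OF Ec Q EE]) (auto simp: e_def N_def)
  ultimately show ?thesis using mult_right_mono[OF se vnorm_nonneg[of v]] by (simp add: N_def)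
qed

lemma kron_one_unitary:
  assumes "unitary_mat n A"
  shows "unitary_mat (n * m) (kron A (1\<^sub>m m))"
  using assms unfolding unitary_mat_def
  by (auto simp: adj_kron kron_mult[of _ n n _ m m _ n _ m] kron_one)

text \<open>On \<open>S\<close> the state \<psi>' has mass at most 1/3. The triangle inequality on
  \<open>S\<close> then gives sqrt(2/3) - sqrt(1/3), with 4/5 and 3/5 as rational bounds of the
  roots.\<close>

lemma distinguishing_norm:
  assumes \<psi>: "\<psi> \<in> carrier_vec K" "\<psi>' \<in> carrier_vec K" "vnorm \<psi>' = 1"
    and S: "S \<subseteq> {..<K}" "S' \<subseteq> {..<K}" "S \<inter> S' = {}"
    and p: "(\<Sum>k\<in>S. (cmod (\<psi> $ k))\<^sup>2) \<ge> 2/3" "(\<Sum>k\<in>S'. (cmod (\<psi>' $ k))\<^sup>2) \<ge> 2/3"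
  shows "1/5 \<le> vnorm (\<psi> - \<psi>')"
proof -
  have fin: "finite S" "finite S'" using S by (auto intro: finite_subset)
  have "(\<Sum>k\<in>S. (cmod (\<psi>' $ k))\<^sup>2) + (\<Sum>k\<in>S'. (cmod (\<psi>' $ k))\<^sup>2) = (\<Sum>k\<in>S \<union> S'. (cmod (\<psi>' $ k))\<^sup>2)"
    using fin S by (intro sum.union_disjoint[symmetric])
  also have "\<dots> \<le> (\<Sum>k<K. (cmod (\<psi>' $ k))\<^sup>2)" using S by (intro sum_mono2) auto
  also have "\<dots> = 1" using vnorm_sq[of \<psi>'] \<psi> by simp
  finally have q: "(\<Sum>k\<in>S. (cmod (\<psi>' $ k))\<^sup>2) \<le> 1/3" using p by simp
  have "L2_set (\<lambda>k. cmod (\<psi> $ k)) S \<le> L2_set (\<lambda>k. cmod ((\<psi> - \<psi>') $ k) + cmod (\<psi>' $ k)) S"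
  proof (rule L2_set_mono)
    fix k assume "k \<in> S"
    hence "\<psi> $ k = (\<psi> - \<psi>') $ k + \<psi>' $ k" using S \<psi> by auto
    thus "cmod (\<psi> $ k) \<le> cmod ((\<psi> - \<psi>') $ k) + cmod (\<psi>' $ k)" by (metis norm_triangle_ineq)
  qed simp
  also have "\<dots> \<le> L2_set (\<lambda>k. cmod ((\<psi> - \<psi>') $ k)) S + L2_set (\<lambda>k. cmod (\<psi>' $ k)) S" by (rule L2_set_triangle_ineq)
  also have "L2_set (\<lambda>k. cmod ((\<psi> - \<psi>') $ k)) S \<le> vnorm (\<psi> - \<psi>')"
    unfolding vnorm_def L2_set_def using S \<psi> by (intro real_sqrt_le_mono sum_mono2) auto
  also have "L2_set (\<lambda>k. cmod (\<psi>' $ k)) S \<le> sqrt ((3/5)\<^sup>2)"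
    unfolding L2_set_def using q by (intro real_sqrt_le_mono) (simp add: power2_eq_square)
  finally have "L2_set (\<lambda>k. cmod (\<psi> $ k)) S \<le> vnorm (\<psi> - \<psi>') + 3/5" by simp
  moreover have "sqrt ((4/5)\<^sup>2) \<le> L2_set (\<lambda>k. cmod (\<psi> $ k)) S"
    unfolding L2_set_def using p by (intro real_sqrt_le_mono) (simp add: power2_eq_square)
  ultimately show ?thesis by simp
qed

definition block_dist :: "real \<Rightarrow> real \<Rightarrow> nat set \<Rightarrow> nat \<Rightarrow> real" where
  "block_dist x y S i = (if i = 0 then x else if i \<in> S then y else 0)"

lemma sum_block_dist:
  assumes "S \<subseteq> {1..<n}" "0 < n"
  shows "(\<Sum>i<n. block_dist x y S i) = x + real (card S) * y"
proof -
  have fin: "finite S" using assms by (auto intro: finite_subset)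
  have "(\<Sum>i<n. block_dist x y S i) = (\<Sum>i\<in>insert 0 S. block_dist x y S i)"
    using assms by (intro sum.mono_neutral_right) (auto simp: block_dist_def)
  also have "\<dots> = x + (\<Sum>i\<in>S. block_dist x y S i)" using assms fin
    by (subst sum.insert) (auto simp: block_dist_def)
  also have "(\<Sum>i\<in>S. block_dist x y S i) = (\<Sum>i\<in>S. y)"
    using assms by (intro sum.cong refl) (auto simp: block_dist_def)
  finally show ?thesis by simp
qed

text \<open>The supports of \<rho> before rotation and of \<sigma> share only the index 0, where
  both have weight \<open>x\<close>. The rotation sends this vector to s e_0 + c e_r, and \<sigma>
  sees only the first component, so the fidelity is \<open>x * s\<close>. For \<open>s < 1\<close>
  the component at \<open>r\<close> stays non-zero.\<close>

lemma rotated_state_instance: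
  assumes r: "1 \<le> r" "2 * r < n" "2 * r < m"
  obtains U V x where "1/2 \<le> x" "x \<le> 1"
    "unitary_mat (n*m) U" "unitary_mat (n*m) V"
    "\<And>s. 0 \<le> s \<Longrightarrow> s < 1 \<Longrightarrow> \<exists>\<rho> \<sigma>. density n \<rho> \<and> density n \<sigma> \<and> mrank n \<rho> = r \<and> mrank n \<sigma> = r \<and>
      purifies n m (kron (plane_refl n r s) (1\<^sub>m m) * U) \<rho> \<and> purifies n m V \<sigma> \<and> fidelity n \<rho> \<sigma> = x * s"
proof -
  define x :: real where "x = (if r = 1 then 1 else 1/2)"
  define t where "t = real (r - 1)"
  \<comment> \<open>For \<open>r = 1\<close> this is \<open>1 / 0 = 0\<close>, in keeping with
    \<open>x = 1\<close> and the empty blocks.\<close>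
  define y where "y = 1 / (2 * t)"
  define p where "p = block_dist x y {1..<r}"
  define q where "q = block_dist x y {r+1..<2*r}"
  have t: "t \<ge> 0" "r \<noteq> 1 \<Longrightarrow> t > 0" "r = 1 \<Longrightarrow> t = 0" using r by (auto simp: t_def)
  have xy: "x + t * y = 1" "x > 0" "y \<ge> 0" "r \<noteq> 1 \<Longrightarrow> y > 0"
    using t by (auto simp: x_def y_def)
  have pn: "0 \<le> p i" "0 \<le> q i" for i using xy by (auto simp: p_def q_def block_dist_def)
  have ps: "(\<Sum>i<n. p i) = 1" "(\<Sum>i<n. q i) = 1"
    unfolding p_def q_def using r xy(1) by (subst sum_block_dist; auto simp: t_def mult_2)+
  have nm: "0 < n" "0 < m" "0 < n * m" using r by auto
  have "\<exists>U. unitary_mat (n*m) U \<and> (\<forall>a<n. \<forall>b<m. U $$ (a*m+b, 0) = (if a = b then complex_of_real (sqrt (p a)) else 0))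
    \<and> purifies n m U (real_diag n p)"
    by (rule purification_exists[OF pn(1) ps(1) nm(1,2)]) (use r in \<open>auto simp: p_def block_dist_def\<close>)
  then obtain U where U: "unitary_mat (n*m) U"
    "\<And>a b. a < n \<Longrightarrow> b < m \<Longrightarrow> U $$ (a*m+b, 0) = (if a = b then complex_of_real (sqrt (p a)) else 0)" by blast
  have "\<exists>U. unitary_mat (n*m) U \<and> (\<forall>a<n. \<forall>b<m. U $$ (a*m+b, 0) = (if a = b then complex_of_real (sqrt (q a)) else 0))
    \<and> purifies n m U (real_diag n q)"
    by (rule purification_exists[OF pn(2) ps(2) nm(1,2)]) (use r in \<open>auto simp: q_def block_dist_def\<close>)
  then obtain V where V: "unitary_mat (n*m) V" "purifies n m V (real_diag n q)" by blast
  show ?thesis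
  proof (rule that)
    show "1/2 \<le> x" "x \<le> 1" by (auto simp: x_def)
    show "unitary_mat (n*m) U" "unitary_mat (n*m) V" by fact+
    fix s :: real assume s: "0 \<le> s" "s < 1"
    define c where "c = sqrt (1 - s\<^sup>2)"
    have "s\<^sup>2 < 1" using s by (simp add: power_less_one_iff)
    hence c: "c > 0" by (simp add: c_def)
    define R where "R = kron (plane_refl n r s) (1\<^sub>m m)"
    define T where "T = R * U"
    have Ru: "unitary_mat (n*m) R" unfolding R_def using r s by (intro kron_one_unitary plane_refl_unitary) auto
    have Tu: "unitary_mat (n*m) T" unfolding T_def by (rule unitary_mult[OF Ru U(1)])
    define \<rho> where "\<rho> = ptrace_B n m (T * proj0 (n*m) * adj T)"
    have pur: "purifies n m T \<rho>" using Tu by (simp add: purifies_def \<rho>_def)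
    have \<rho>c: "\<rho> \<in> carrier_mat n n" by (simp add: \<rho>_def)
    define g where "g a = (if a = 0 then s else if a = r then c else 0)" for a
    have col: "T $$ (a*m+b, 0) = (if b < r then plane_refl n r s $$ (a, b) * complex_of_real (sqrt (p b)) else 0)"
      if ab: "a < n" "b < m" for a b
    proof -
      have "T $$ (a*m+b, 0) = (\<Sum>z<n*m. R $$ (a*m+b, z) * U $$ (z, 0))"
        unfolding T_def using Ru U(1) pair_less[OF ab] nm by (intro mult_index[of _ "n*m" "n*m" _ "n*m"]) auto
      also have "\<dots> = (\<Sum>z<n*m. plane_refl n r s $$ (a, z div m) * (if b = z mod m then 1 else 0) * U $$ ((z div m) * m + z mod m, 0))"
      proof (intro sum.cong refl)
        fix z assume z: "z \<in> {..<n*m}"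
        have "R $$ (a*m+b, z) = plane_refl n r s $$ ((a*m+b) div m, z div m) * 1\<^sub>m m $$ ((a*m+b) mod m, z mod m)"
          unfolding R_def using z pair_less[OF ab] by (intro kron_index[of _ n n _ m m]) auto
        thus "R $$ (a*m+b, z) * U $$ (z, 0) = plane_refl n r s $$ (a, z div m) * (if b = z mod m then 1 else 0) * U $$ ((z div m) * m + z mod m, 0)"
          using ab z div_mod_less[of z n m] by simp
      qed
      also have "\<dots> = (\<Sum>a'<n. \<Sum>b'<m. plane_refl n r s $$ (a, a') * (if b = b' then 1 else 0) * U $$ (a'*m+b', 0))"
        by (rule sum_div_mod)
      also have "\<dots> = (\<Sum>a'<n. \<Sum>b'<m. if b' = b then (if a' = b then plane_refl n r s $$ (a, a') * complex_of_real (sqrt (p a')) else 0) else 0)"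
        using ab by (intro sum.cong refl) (auto simp: U(2))
      also have "\<dots> = (\<Sum>a'<n. if a' = b then plane_refl n r s $$ (a, a') * complex_of_real (sqrt (p a')) else 0)"
        using ab by simp
      also have "\<dots> = (if b < r then plane_refl n r s $$ (a, b) * complex_of_real (sqrt (p b)) else 0)"
        using r by (auto simp: sum.delta p_def block_dist_def)
      finally show ?thesis .
    qed
    have \<rho>: "\<rho> $$ (a, a') = complex_of_real (x * g a * g a' + (if a = a' \<and> 1 \<le> a \<and> a < r then y else 0))"
      if a: "a < n" "a' < n" for a a'
    proof -
      have "\<rho> $$ (a, a') = (\<Sum>b<m. T $$ (a*m+b, 0) * cnj (T $$ (a'*m+b, 0)))"
        unfolding \<rho>_def using Tu by (intro ptrace_pure a) simp
      also have "\<dots> = (\<Sum>b<m. complex_of_real ((if b = 0 then x * g a * g a' else 0) + (if b = a then (if a = a' \<and> 1 \<le> a \<and> a < r then y else 0) else 0)))"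
      proof (intro sum.cong refl)
        fix b assume b: "b \<in> {..<m}"
        have e: "plane_refl n r s $$ (a, b) = complex_of_real (if b = 0 then g a else if a = b then 1 else 0)"
          if "b < r" "a < n" for a
          using that r by (auto simp: plane_refl_def g_def c_def)
        define h where "h = sqrt (p b)"
        have sq: "h * h = p b" using pn by (simp add: h_def)
        show "T $$ (a*m+b, 0) * cnj (T $$ (a'*m+b, 0)) = complex_of_real ((if b = 0 then x * g a * g a' else 0) + (if b = a then (if a = a' \<and> 1 \<le> a \<and> a < r then y else 0) else 0))"
        proof (cases "b < r")
          case True
          have "T $$ (a*m+b, 0) * cnj (T $$ (a'*m+b, 0)) = complex_of_real
            ((if b = 0 then g a else if a = b then 1 else 0) * (if b = 0 then g a' else if a' = b then 1 else 0) * (h * h))"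
            using a b True by (simp add: col[folded h_def] e h_def[symmetric] mult_ac)
          also have "\<dots> = complex_of_real ((if b = 0 then x * g a * g a' else 0) + (if b = a then (if a = a' \<and> 1 \<le> a \<and> a < r then y else 0) else 0))"
            unfolding sq using True by (auto simp: p_def block_dist_def)
          finally show ?thesis .
        next
          case False
          thus ?thesis using a b r by (simp add: col)
        qed
      qed
      also have "\<dots> = complex_of_real ((\<Sum>b<m. if b = 0 then x * g a * g a' else 0) + (\<Sum>b<m. if b = a then (if a = a' \<and> 1 \<le> a \<and> a < r then y else 0) else 0))"
        by (simp only: of_real_sum[symmetric] sum.distrib)
      also have "(\<Sum>b<m. if b = 0 then x * g a * g a' else 0) = x * g a * g a'" using nm by simp
      also have "(\<Sum>b<m. if b = a then (if a = a' \<and> 1 \<le> a \<and> a < r then y else 0) else 0) = (if a = a' \<and> 1 \<le> a \<and> a < r then y else 0)"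
        using r by (auto simp: sum.delta)
      finally show ?thesis .
    qed
    \<comment> \<open>Column 0 is \<open>s / c\<close> times column \<open>r\<close>, so the columns
      1 to \<open>r\<close> form a basis even when \<open>s = 0\<close> makes column 0
      vanish.\<close>
    have "mrank n \<rho> = card {1..r}"
    proof (rule mrank_eq_card[where \<kappa> = id])
      fix i assume i: "i < n" "i \<notin> {1..r}"
      show "(\<exists>j\<in>{1..r}. \<exists>c. \<forall>k<n. \<rho> $$ (k, i) = c * \<rho> $$ (k, j)) \<or> (\<forall>k<n. \<rho> $$ (k, i) = 0)"
      proof (cases "i = 0")
        case True
        have "\<forall>k<n. \<rho> $$ (k, i) = complex_of_real (s / c) * \<rho> $$ (k, r)"
        proof (intro allI impI)
          fix k assume k: "k < n"
          have "(if k = i \<and> 1 \<le> k \<and> k < r then y else 0) = 0" "(if k = r \<and> 1 \<le> k \<and> k < r then y else 0) = 0"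
            "g i = s" "g r = c" using True r by (auto simp: g_def)
          hence "\<rho> $$ (k, i) = complex_of_real (x * g k * s)" "\<rho> $$ (k, r) = complex_of_real (x * g k * c)"
            using \<rho>[OF k i(1)] \<rho>[OF k, of r] r by simp_all
          thus "\<rho> $$ (k, i) = complex_of_real (s / c) * \<rho> $$ (k, r)" using c by simp
        qed
        moreover have "r \<in> {1..r}" using r by simp
        ultimately show ?thesis by blast
      next
        case False
        hence "g i = 0" "r < i" using i by (auto simp: g_def)
        thus ?thesis using i by (simp add: \<rho>)
      qed
    next
      fix j assume j: "j \<in> {1..r}"
      hence jn: "j < n" using r by auto
      have "x * g j * g j + (if 1 \<le> j \<and> j < r then y else 0) \<noteq> 0"
      proof (cases "j = r")
        case True
        thus ?thesis using j c xy(2) by (auto simp: g_def)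
      next
        case False
        hence "y > 0" using j xy(4) by auto
        thus ?thesis using j False by (auto simp: g_def)
      qed
      thus "\<rho> $$ (id j, j) \<noteq> 0" using jn by (simp add: \<rho> del: of_real_add of_real_mult)
    next
      fix j j' assume "j \<in> {1..r}" "j' \<in> {1..r}" "j \<noteq> j'"
      thus "\<rho> $$ (id j, j') = 0" using r by (auto simp: \<rho> g_def)
    qed (use r \<rho>c in auto)
    hence rank\<rho>: "mrank n \<rho> = r" by simp
    have "{i. i < n \<and> q i \<noteq> 0} = insert 0 {r+1..<2*r}"
    proof -
      have "y \<noteq> 0" if "i \<in> {r+1..<2*r}" for i using that xy(4) by fastforce
      thus ?thesis using xy(2) r by (auto simp: q_def block_dist_def)
    qed
    hence rank\<sigma>: "mrank n (real_diag n q) = r" unfolding mrank_real_diag using r by simp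
    have "fidelity n \<rho> (real_diag n q) = (\<Sum>i<n. if i = 0 then x * s else 0)"
    proof (rule fidelity_real_diag_right[OF pn(2) _ \<rho>c])
      fix i j assume ij: "i < n" "j < n"
      have qz: "q k = 0 \<or> k = 0 \<or> r < k" for k by (auto simp: q_def block_dist_def)
      show "complex_of_real (sqrt (q i)) * \<rho> $$ (i, j) * complex_of_real (sqrt (q j))
        = (if i = j then complex_of_real ((if i = 0 then x * s else 0) * (if i = 0 then x * s else 0)) else 0)"
      proof (cases "i = 0 \<and> j = 0")
        case True
        have "q 0 = x" by (simp add: q_def block_dist_def)
        moreover have "complex_of_real (sqrt x) * complex_of_real (x * s * s) * complex_of_real (sqrt x) = complex_of_real ((sqrt x * sqrt x) * (x * s * s))"
          by (simp only: of_real_mult mult_ac)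
        ultimately show ?thesis using True ij xy(2) r by (simp add: \<rho> g_def mult_ac del: of_real_mult)
      next
        case False
        have "complex_of_real (sqrt (q i)) * \<rho> $$ (i, j) * complex_of_real (sqrt (q j)) = 0"
          using qz[of i] qz[of j] ij False r by (auto simp: \<rho> g_def)
        thus ?thesis using False by auto
      qed
    qed (use xy s in auto)
    also have "\<dots> = x * s" using nm by simp
    finally have fid: "fidelity n \<rho> (real_diag n q) = x * s" .
    have dens: "density n \<rho>" "density n (real_diag n q)"
      using purifies_density[OF pur nm(3)] purifies_density[OF V(2) nm(3)] by auto
    show "\<exists>\<rho> \<sigma>. density n \<rho> \<and> density n \<sigma> \<and> mrank n \<rho> = r \<and> mrank n \<sigma> = r \<and>
      purifies n m (kron (plane_refl n r s) (1\<^sub>m m) * U) \<rho> \<and> purifies n m V \<sigma> \<and> fidelity n \<rho> \<sigma> = x * s"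
      using dens rank\<rho> rank\<sigma> pur V(2) fid unfolding T_def R_def by blast
  qed
qed

lemma solves_success:
  assumes "solves_fidelity n m r \<epsilon> W V0 steps est"
    and "density n \<rho>" "density n \<sigma>" "mrank n \<rho> = r" "mrank n \<sigma> = r" "purifies n m U \<rho>" "purifies n m V \<sigma>"
  shows "2/3 \<le> (\<Sum>k \<in> {k. k < n*m*W \<and> \<bar>est k - fidelity n \<rho> \<sigma>\<bar> \<le> \<epsilon>}.
      (cmod (final_state (n*m) W V0 steps U V $ k))\<^sup>2)"
  using assms unfolding solves_fidelity_def success_prob_def by blast

lemma queries_ge_inverse_eps:
  assumes solves: "solves_fidelity n m r \<epsilon> W V0 steps est"
    and r: "1 \<le> r" "2 * r < n" "2 * r < m" and \<epsilon>: "0 < \<epsilon>" "\<epsilon> < 1/10"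
  shows "1 / (50 * \<epsilon>) \<le> real (length steps)"
proof -
  obtain U V x where x: "1/2 \<le> x" "x \<le> 1" and UV: "unitary_mat (n*m) U" "unitary_mat (n*m) V"
    and inst: "\<And>s. 0 \<le> s \<Longrightarrow> s < 1 \<Longrightarrow> \<exists>\<rho> \<sigma>. density n \<rho> \<and> density n \<sigma> \<and> mrank n \<rho> = r \<and> mrank n \<sigma> = r \<and>
      purifies n m (kron (plane_refl n r s) (1\<^sub>m m) * U) \<rho> \<and> purifies n m V \<sigma> \<and> fidelity n \<rho> \<sigma> = x * s"
    by (rule rotated_state_instance[OF r]) (rule that)
  define N where "N = n * m"
  define R where "R s = kron (plane_refl n r s) (1\<^sub>m m)" for s
  \<comment> \<open>Since \<open>x \<ge> 1/2\<close>, the fidelities for \<open>s\<close> and 0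
    differ by at least \<open>5/2 * \<epsilon>\<close>, more than the \<open>2 * \<epsilon>\<close>
    that makes the two sets of accepted outcomes disjoint. A query then moves the state by at most
    \<open>2 * s = 10 * \<epsilon>\<close>.\<close>
  define s where "s = 5 * \<epsilon>"
  have s: "0 \<le> s" "s < 1" using \<epsilon> by (auto simp: s_def)
  have rn: "0 < r" "r < n" using r by auto
  have alg: "valid_alg N W V0 steps" using solves by (simp add: solves_fidelity_def N_def)
  hence V0: "unitary_mat (N*W) V0" and st: "valid_steps N W steps"
    by (auto simp: valid_alg_def valid_steps_def)
  define \<psi> where "\<psi> t = final_state N W V0 steps (R t * U) V" for t
  define S where "S t = {k. k < N*W \<and> \<bar>est k - x * t\<bar> \<le> \<epsilon>}" for t
  have succ: "2/3 \<le> (\<Sum>k\<in>S t. (cmod (\<psi> t $ k))\<^sup>2)" if t: "0 \<le> t" "t < 1" for t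
  proof -
    obtain \<rho> \<sigma> where i: "density n \<rho>" "density n \<sigma>" "mrank n \<rho> = r" "mrank n \<sigma> = r"
      "purifies n m (R t * U) \<rho>" "purifies n m V \<sigma>" and f: "fidelity n \<rho> \<sigma> = x * t"
      using inst[OF t] unfolding R_def by blast
    from solves_success[OF solves i] show ?thesis unfolding f S_def \<psi>_def N_def .
  qed
  have NW: "0 < N * W"
  proof (rule ccontr)
    assume "\<not> ?thesis"
    hence "S 0 = {}" by (auto simp: S_def)
    thus False using succ[of 0] by simp
  qed
  have Ru: "unitary_mat N (R t)" if "0 \<le> t" "t \<le> 1" for t
    unfolding R_def N_def using rn that by (intro kron_one_unitary plane_refl_unitary)
  have U: "unitary_mat N U" "unitary_mat N V" using UV by (auto simp: N_def)
  have RU: "unitary_mat N (R t * U)" if "0 \<le> t" "t \<le> 1" for t by (rule unitary_mult[OF Ru[OF that] U(1)])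
  have norm: "\<psi> t \<in> carrier_vec (N*W)" "vnorm (\<psi> t) = 1" if "0 \<le> t" "t \<le> 1" for t
    unfolding \<psi>_def by (rule final_state_norm[OF alg RU[OF that] U(2) NW])+
  have adjR: "adj (R t) = R t" for t unfolding R_def adj_kron adj_plane_refl by simp
  have Rc: "R t \<in> carrier_mat N N" for t unfolding R_def N_def by simp
  have Uc: "U \<in> carrier_mat N N" "adj U \<in> carrier_mat N N" using U by auto
  have "vnorm (foldl (alg_step N (R s * U) V) (V0 *\<^sub>v unit_vec (N*W) 0) steps
        - foldl (alg_step N (R 0 * U) V) (V0 *\<^sub>v unit_vec (N*W) 0) steps)
      \<le> vnorm (V0 *\<^sub>v unit_vec (N*W) 0 - V0 *\<^sub>v unit_vec (N*W) 0) + real (length steps) * (2 * s)"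
  proof (rule hybrid[OF st RU RU U(2)])
    fix P d and v :: "complex vec" assume P: "orth_proj W P" and v: "v \<in> carrier_vec (N*W)"
    have Pc: "P \<in> carrier_mat W W" using P by (simp add: orth_proj_def)
    have cR: "ctrl N P (R t) \<in> carrier_mat (N*W) (N*W)" for t using Rc Pc by simp
    show "vnorm (query_gate N (R s * U) V (False, d, P) *\<^sub>v v - query_gate N (R 0 * U) V (False, d, P) *\<^sub>v v) \<le> 2 * s * vnorm v"
    \<comment> \<open>In a forward query the controlled reflection comes after the controlled
      \<open>U\<close>, in an inverse query before its adjoint; in both cases the common gate
      preserves norms.\<close>
    proof (cases d)
      case False
      define v' where "v' = ctrl N P U *\<^sub>v v"
      have cU: "unitary_mat (N*W) (ctrl N P U)" by (rule ctrl_unitary[OF P U(1)])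
      have v': "v' \<in> carrier_vec (N*W)" "vnorm v' = vnorm v"
        unfolding v'_def using v cU by (auto intro!: mult_mat_vec_carrier[of _ "N*W" "N*W"] vnorm_unitary unitary_carrier)
      have e: "query_gate N (R t * U) V (False, d, P) *\<^sub>v v = ctrl N P (R t) *\<^sub>v v'" for t
        unfolding query_gate_ctrl v'_def using False ctrl_mult[OF P Rc Uc(1), of t]
          assoc_mult_mat_vec[OF cR unitary_carrier[OF cU] v, of t] by simp
      show ?thesis unfolding e using ctrl_plane_refl_diff[OF rn s(1) less_imp_le[OF s(2)] P, of v' m] v'
        by (simp add: R_def N_def)
    next
      case True
      have cU: "unitary_mat (N*W) (ctrl N P (adj U))" by (rule ctrl_unitary[OF P unitary_adj[OF U(1)]])
      have e: "query_gate N (R t * U) V (False, d, P) *\<^sub>v v = ctrl N P (adj U) *\<^sub>v (ctrl N P (R t) *\<^sub>v v)" for t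
        unfolding query_gate_ctrl using True ctrl_mult[OF P Uc(2) Rc, of t] adj_mult[OF Rc Uc(1), of t]
          assoc_mult_mat_vec[OF unitary_carrier[OF cU] cR v, of t] by (simp add: adjR)
      have w: "ctrl N P (R t) *\<^sub>v v \<in> carrier_vec (N*W)" for t by (rule mult_mat_vec_carrier[OF cR v])
      have "ctrl N P (adj U) *\<^sub>v (ctrl N P (R s) *\<^sub>v v) - ctrl N P (adj U) *\<^sub>v (ctrl N P (R 0) *\<^sub>v v)
        = ctrl N P (adj U) *\<^sub>v (ctrl N P (R s) *\<^sub>v v - ctrl N P (R 0) *\<^sub>v v)"
        by (rule mult_minus_distrib_mat_vec[OF unitary_carrier[OF cU] w w, symmetric])
      hence "vnorm (query_gate N (R s * U) V (False, d, P) *\<^sub>v v - query_gate N (R 0 * U) V (False, d, P) *\<^sub>v v)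
        = vnorm (ctrl N P (R s) *\<^sub>v v - ctrl N P (R 0) *\<^sub>v v)"
        unfolding e using vnorm_unitary[OF cU, of "ctrl N P (R s) *\<^sub>v v - ctrl N P (R 0) *\<^sub>v v"] w by simp
      thus ?thesis using ctrl_plane_refl_diff[OF rn s(1) less_imp_le[OF s(2)] P, of v m] v
        by (simp add: R_def N_def)
    qed
  qed (use s initial_norm[OF V0 NW] in auto)
  moreover have "vnorm (w - w) = 0" for w by (simp add: vnorm_def L2_set_def)
  ultimately have near: "vnorm (\<psi> s - \<psi> 0) \<le> real (length steps) * (10 * \<epsilon>)"
    unfolding \<psi>_def final_state_foldl by (simp add: s_def)
  have "S s \<inter> S 0 = {}"
  proof -
    have "5/2 * \<epsilon> \<le> x * s" using mult_right_mono[OF x(1) s(1)] by (simp add: s_def)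
    thus ?thesis unfolding S_def using \<epsilon> by auto
  qed
  hence "1/5 \<le> vnorm (\<psi> s - \<psi> 0)"
    using norm[of s] norm[of 0] succ[of s] succ[of 0] s
    by (intro distinguishing_norm[of _ "N*W" _ "S s" "S 0"]) (auto simp: S_def)
  hence "1/5 \<le> real (length steps) * (10 * \<epsilon>)" using near by linarith
  thus ?thesis using \<epsilon> by (simp add: field_simps)
qed

section \<open>The bound of order sqrt(r/epsilon)\<close>

text \<open>\<open>U\<close> prepares the uniform superposition of e_0 \<otimes> e_l for
  \<open>l < L\<close>, which are the indices below \<open>L \<le> m\<close>, and the oracle turns 0
  into \<open>w l\<close>. \<sigma> is uniform on \<open>{1..G+1}\<close>: it avoids the filler
  letter 0, and the index \<open>G + 1\<close>, which no word uses, gives it the same rank as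
  \<rho>.\<close>

lemma word_state_instance:
  assumes G: "G + 2 \<le> n" "G + 2 \<le> m" and L: "0 < L" "L \<le> m"
  obtains U V where "unitary_mat (n*m) U" "unitary_mat (n*m) V"
    "\<And>w y. (\<forall>l. w l \<le> G) \<Longrightarrow> (\<forall>j\<in>{1..G}. card {l. l < L \<and> w l = j} = y j \<and> 1 \<le> y j) \<Longrightarrow> letter_sum G y < L \<Longrightarrow>
      \<exists>\<rho> \<sigma>. density n \<rho> \<and> density n \<sigma> \<and> mrank n \<rho> = G + 1 \<and> mrank n \<sigma> = G + 1 \<and>
        purifies n m (word_oracle n m L G w * U) \<rho> \<and> purifies n m V \<sigma> \<and>
        fidelity n \<rho> \<sigma> = (\<Sum>j=1..G. sqrt (real (y j))) / sqrt (real L * real (G + 1))"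
proof -
  define q where "q i = (if 1 \<le> i \<and> i \<le> G + 1 then 1 / real (G + 1) else 0)" for i
  have nm: "0 < n" "0 < m" "0 < n * m" using G by auto
  have qn: "0 \<le> q i" for i by (simp add: q_def)
  have qs: "(\<Sum>i<n. q i) = 1"
  proof -
    have "(\<Sum>i<n. q i) = (\<Sum>i\<in>{1..G+1}. q i)" using G by (intro sum.mono_neutral_right) (auto simp: q_def)
    also have "\<dots> = (\<Sum>i\<in>{1..G+1}. 1 / real (G + 1))" by (intro sum.cong) (auto simp: q_def)
    also have "\<dots> = 1" by simp
    finally show ?thesis .
  qed
  have "\<exists>U. unitary_mat (n*m) U \<and> (\<forall>a<n. \<forall>b<m. U $$ (a*m+b, 0) = (if a = b then complex_of_real (sqrt (q a)) else 0))
    \<and> purifies n m U (real_diag n q)"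
    by (rule purification_exists[OF qn qs nm(1,2)]) (use G in \<open>auto simp: q_def\<close>)
  then obtain V where V: "unitary_mat (n*m) V" "purifies n m V (real_diag n q)" by blast
  define u where "u x = (if x < L then 1 / sqrt (real L) else 0)" for x
  have Ln: "L \<le> n * m"
  proof -
    have "m \<le> n * m" using nm by simp
    thus ?thesis by (rule order_trans[OF L(2)])
  qed
  have "(\<Sum>x<n*m. (u x)\<^sup>2) = (\<Sum>x<L. 1 / real L)"
  proof -
    have "(\<Sum>x<n*m. (u x)\<^sup>2) = (\<Sum>x<L. (u x)\<^sup>2)"
      using Ln by (intro sum.mono_neutral_right) (auto simp: u_def)
    also have "\<dots> = (\<Sum>x<L. 1 / real L)" by (intro sum.cong refl) (simp add: u_def power_divide)
    finally show ?thesis .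
  qed
  also have "\<dots> = 1" using L by simp
  finally obtain U where U: "unitary_mat (n*m) U" "\<forall>x<n*m. U $$ (x, 0) = complex_of_real (u x)"
    using unitary_with_column[OF nm(3), of u] by auto
  show ?thesis
  proof (rule that[OF U(1) V(1)])
    fix w y :: "nat \<Rightarrow> nat"
    assume w: "\<forall>l. w l \<le> G" and y: "\<forall>j\<in>{1..G}. card {l. l < L \<and> w l = j} = y j \<and> 1 \<le> y j" and S: "letter_sum G y < L"
    define cnt where "cnt a = card {l. l < L \<and> w l = a}" for a
    define p where "p a = real (cnt a) / real L" for a
    define T where "T = word_oracle n m L G w * U"
    have Gn: "G < n" using G by simp
    have Ou: "unitary_mat (n*m) (word_oracle n m L G w)" by (rule word_oracle_unitary[OF Gn])
    have Tu: "unitary_mat (n*m) T" unfolding T_def by (rule unitary_mult[OF Ou U(1)])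
    have col: "T $$ (a*m+b, 0) = (if b < L \<and> w b = a then complex_of_real (1 / sqrt (real L)) else 0)" if ab: "a < n" "b < m" for a b
    proof -
      define x where "x = a * m + b"
      have x: "x < n * m" unfolding x_def by (rule pair_less[OF ab])
      have px: "word_perm m L G w x < n * m" by (rule word_perm_less[OF Gn x])
      have pp: "x = word_perm m L G w z \<longleftrightarrow> z = word_perm m L G w x" if "z < n * m" for z
        using word_perm_involution[OF x, of L G w] word_perm_involution[OF that, of L G w] by metis
      have "T $$ (x, 0) = (\<Sum>z<n*m. word_oracle n m L G w $$ (x, z) * U $$ (z, 0))"
        unfolding T_def using Ou U(1) x nm by (intro mult_index[of _ "n*m" "n*m" _ "n*m"]) auto
      also have "\<dots> = (\<Sum>z<n*m. if z = word_perm m L G w x then U $$ (z, 0) else 0)"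
        using x pp by (intro sum.cong refl) (auto simp: word_oracle_def)
      also have "\<dots> = complex_of_real (u (word_perm m L G w x))" using px U(2) by (simp add: sum.delta)
      also have "word_perm m L G w x = flip0 (letter L G w b) a * m + b" unfolding word_perm_def x_def using ab by simp
      also have "u \<dots> = (if b < L \<and> w b = a then 1 / sqrt (real L) else 0)"
      proof (cases "flip0 (letter L G w b) a = 0")
        case True
        hence "letter L G w b = a" by (auto simp: flip0_def split: if_splits)
        thus ?thesis using True w by (auto simp: u_def letter_def)
      next
        case False
        have "flip0 t t = 0" for t by (simp add: flip0_def)
        hence "letter L G w b \<noteq> a" using False by metis
        hence "\<not> (b < L \<and> w b = a)" using w by (auto simp: letter_def)
        moreover have "1 * m \<le> flip0 (letter L G w b) a * m" using False by (intro mult_le_mono1) simp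
        hence "\<not> flip0 (letter L G w b) a * m + b < L" using L by linarith
        ultimately show ?thesis unfolding u_def by (simp only: if_False)
      qed
      finally show ?thesis unfolding x_def by auto
    qed
    have "ptrace_B n m (T * proj0 (n*m) * adj T) = real_diag n p"
    proof (rule eq_matI)
      fix a a' assume "a < dim_row (real_diag n p)" "a' < dim_col (real_diag n p)"
      hence a: "a < n" "a' < n" by (auto simp: real_diag_def)
      have "ptrace_B n m (T * proj0 (n*m) * adj T) $$ (a, a') = (\<Sum>b<m. T $$ (a*m+b, 0) * cnj (T $$ (a'*m+b, 0)))"
        using Tu by (intro ptrace_pure a) simp
      also have "\<dots> = (\<Sum>b<m. if b < L \<and> w b = a then (if a = a' then complex_of_real (1 / real L) else 0) else 0)"
        using a by (intro sum.cong refl) (auto simp: col simp flip: of_real_mult)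
      also have "\<dots> = (\<Sum>b\<in>{l. l < L \<and> w l = a}. (if a = a' then complex_of_real (1 / real L) else 0))"
        using L by (intro sum.mono_neutral_cong_right) auto
      also have "\<dots> = (if a = a' then complex_of_real (p a) else 0)" by (simp add: p_def cnt_def)
      finally show "ptrace_B n m (T * proj0 (n*m) * adj T) $$ (a, a') = real_diag n p $$ (a, a')" using a by (simp add: real_diag_index)
    qed (auto simp: ptrace_B_def real_diag_def)
    hence pur: "purifies n m T (real_diag n p)" using Tu by (simp add: purifies_def)
    \<comment> \<open>The strict bound on \<open>letter_sum\<close> leaves a position for the
      filler, whose eigenvalue brings the rank of \<rho> up to \<open>G + 1\<close>.\<close>
    have cnt0: "cnt 0 \<noteq> 0"
    proof
      assume "cnt 0 = 0"
      hence "{l. l < L \<and> w l = 0} = {}" by (simp add: cnt_def)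
      hence "{..<L} \<subseteq> (\<Union>j\<in>{1..G}. {l. l < L \<and> w l = j})" using w by (force simp: Suc_le_eq)
      hence "L \<le> card (\<Union>j\<in>{1..G}. {l. l < L \<and> w l = j})" using card_mono[of "\<Union>j\<in>{1..G}. {l. l < L \<and> w l = j}" "{..<L}"] by simp
      also have "\<dots> \<le> (\<Sum>j=1..G. card {l. l < L \<and> w l = j})" by (rule card_UN_le) simp
      also have "\<dots> = letter_sum G y" unfolding letter_sum_def using y by (intro sum.cong) auto
      finally show False using S by simp
    qed
    have cntG: "cnt a = 0" if "a > G" for a
    proof -
      have "{l. l < L \<and> w l = a} = {}" using w that by (auto simp: not_le[symmetric])
      thus ?thesis by (simp only: cnt_def card.empty)
    qed
    have cnty: "cnt j = y j" "y j \<ge> 1" if "j \<in> {1..G}" for j using y that by (auto simp: cnt_def)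
    have "{i. i < n \<and> p i \<noteq> 0} = {..G}"
    proof (intro equalityI subsetI)
      fix i assume "i \<in> {i. i < n \<and> p i \<noteq> 0}"
      thus "i \<in> {..G}" using cntG[of i] by (cases "i \<le> G") (auto simp: p_def)
    next
      fix i assume i: "i \<in> {..G}"
      have "cnt i \<noteq> 0" using cnt0 cnty[of i] i by (cases "i = 0") auto
      thus "i \<in> {i. i < n \<and> p i \<noteq> 0}" using i Gn L by (simp add: p_def)
    qed
    hence rank1: "mrank n (real_diag n p) = G + 1" unfolding mrank_real_diag by simp
    have "{i. i < n \<and> q i \<noteq> 0} = {1..G+1}" using G by (auto simp: q_def)
    hence rank2: "mrank n (real_diag n q) = G + 1" unfolding mrank_real_diag by simp
    define c where "c i = sqrt (p i) * sqrt (q i)" for i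
    have pn: "0 \<le> p i" for i by (simp add: p_def)
    have "fidelity n (real_diag n p) (real_diag n q) = (\<Sum>i<n. c i)"
    proof (rule fidelity_real_diag_right[OF qn])
      fix i j assume ij: "i < n" "j < n"
      have "sqrt (q i) * p i * sqrt (q i) = c i * c i"
      proof -
        have "c i * c i = (sqrt (p i) * sqrt (p i)) * (sqrt (q i) * sqrt (q i))" unfolding c_def by (simp only: mult_ac)
        also have "sqrt (p i) * sqrt (p i) = p i" using pn by simp
        finally show ?thesis by (simp only: mult_ac)
      qed
      hence "complex_of_real (sqrt (q i)) * complex_of_real (p i) * complex_of_real (sqrt (q i)) = complex_of_real (c i * c i)"
        by (simp only: of_real_mult[symmetric])
      thus "complex_of_real (sqrt (q i)) * real_diag n p $$ (i, j) * complex_of_real (sqrt (q j))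
         = (if i = j then complex_of_real (c i * c i) else 0)" using ij by (cases "i = j") (auto simp: real_diag_index)
    qed (use pn qn in \<open>auto simp: c_def\<close>)
    also have "\<dots> = (\<Sum>i\<in>{1..G}. c i)"
    proof (intro sum.mono_neutral_right)
      show "\<forall>i\<in>{..<n} - {1..G}. c i = 0"
      proof
        fix i assume "i \<in> {..<n} - {1..G}"
        hence "i = 0 \<or> i > G" by auto
        thus "c i = 0" using cntG[of i] by (auto simp: c_def q_def p_def)
      qed
    qed (use Gn in auto)
    also have "\<dots> = (\<Sum>j=1..G. sqrt (real (y j)) / sqrt (real L * real (G + 1)))"
    proof (intro sum.cong refl)
      fix j assume j: "j \<in> {1..G}"
      hence "q j = 1 / real (G + 1)" by (simp add: q_def)
      thus "c j = sqrt (real (y j)) / sqrt (real L * real (G + 1))"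
        unfolding c_def p_def cnty(1)[OF j] by (simp add: real_sqrt_divide real_sqrt_mult)
    qed
    also have "\<dots> = (\<Sum>j=1..G. sqrt (real (y j))) / sqrt (real L * real (G + 1))" by (rule sum_divide_distrib[symmetric])
    finally have fid: "fidelity n (real_diag n p) (real_diag n q) = (\<Sum>j=1..G. sqrt (real (y j))) / sqrt (real L * real (G + 1))" .
    have dens: "density n (real_diag n p)" "density n (real_diag n q)"
      using purifies_density[OF pur nm(3)] purifies_density[OF V(2) nm(3)] by auto
    show "\<exists>\<rho> \<sigma>. density n \<rho> \<and> density n \<sigma> \<and> mrank n \<rho> = G + 1 \<and> mrank n \<sigma> = G + 1 \<and>
        purifies n m (word_oracle n m L G w * U) \<rho> \<and> purifies n m V \<sigma> \<and>
        fidelity n \<rho> \<sigma> = (\<Sum>j=1..G. sqrt (real (y j))) / sqrt (real L * real (G + 1))"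
      using dens rank1 rank2 pur V(2) fid unfolding T_def by blast
  qed
qed

text \<open>Thresholding the estimate at the fidelity \<theta> midway between the two mean values
  turns the algorithm into a test. Its acceptance probability is a polynomial in the word of degree
  twice the number of queries, the factor 2 coming from the squared amplitudes.\<close>

lemma degree_lower_bound:
  assumes solves: "solves_fidelity n m (G + 1) \<epsilon> W V0 steps est"
    and n: "G + 2 \<le> n" and m: "G + 2 \<le> m" "12200 * D\<^sup>2 \<le> m" and D: "1 \<le> D" "G \<le> D\<^sup>2"
    and G: "960000 / sqrt_gap\<^sup>2 \<le> real G"
    and gap: "\<epsilon> < real G * (sqrt_gap / 4) / sqrt (real (12200 * D\<^sup>2) * real (G + 1))"
  shows "D < 2 * length steps"
proof (rule ccontr)
  assume "\<not> ?thesis"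
  hence deg: "length steps + length steps \<le> D" by simp
  define L where "L = 12200 * D\<^sup>2"
  have L: "0 < L" "L \<le> m" using D m by (auto simp: L_def)
  obtain U V where UV: "unitary_mat (n*m) U" "unitary_mat (n*m) V"
    and inst: "\<And>w y. (\<forall>l. w l \<le> G) \<Longrightarrow> (\<forall>j\<in>{1..G}. card {l. l < L \<and> w l = j} = y j \<and> 1 \<le> y j) \<Longrightarrow> letter_sum G y < L \<Longrightarrow>
      \<exists>\<rho> \<sigma>. density n \<rho> \<and> density n \<sigma> \<and> mrank n \<rho> = G + 1 \<and> mrank n \<sigma> = G + 1 \<and>
        purifies n m (word_oracle n m L G w * U) \<rho> \<and> purifies n m V \<sigma> \<and>
        fidelity n \<rho> \<sigma> = (\<Sum>j=1..G. sqrt (real (y j))) / sqrt (real L * real (G + 1))"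
    by (rule word_state_instance[OF n m(1) L]) (rule that)
  define N where "N = n * m"
  define O' where "O' w = word_oracle n m L G w * U" for w
  have Gn: "G < n" using n by simp
  have Ou: "unitary_mat N (O' w)" for w unfolding O'_def N_def by (rule unitary_mult[OF word_oracle_unitary[OF Gn] UV(1)])
  have alg: "valid_alg N W V0 steps" using solves by (simp add: solves_fidelity_def N_def)
  define \<psi> where "\<psi> w = final_state N W V0 steps (O' w) V" for w
  define A where "A = sqrt (real L * real (G + 1))"
  have A: "A > 0" using L by (simp add: A_def)
  define \<tau> where "\<tau> = ((\<Sum>x\<in>sq_nodes D. pos_measure D x * sqrt (real x)) + (\<Sum>x\<in>sq_nodes D. neg_measure D x * sqrt (real x))) / 2"
  define \<theta> where "\<theta> = real G * \<tau> / A"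
  \<comment> \<open>The distance in fidelity that \<open>low_degree_cannot_distinguish\<close>
    guarantees between \<theta> and a typical instance; as it exceeds \<epsilon>, a correct estimate
    falls on the right side of \<theta>.\<close>
  define \<delta> where "\<delta> = real G * (sqrt_gap / 4) / A"
  have \<delta>: "\<epsilon> < \<delta>" using gap by (simp add: \<delta>_def A_def L_def)
  define K where "K = {k. k < N*W \<and> \<theta> \<le> est k}"
  define acc where "acc w = (\<Sum>k\<in>K. \<psi> w $ k * cnj (\<psi> w $ k))" for w
  have acc: "Re (acc w) = (\<Sum>k\<in>K. (cmod (\<psi> w $ k))\<^sup>2)" for w
  proof -
    have "acc w = complex_of_real (\<Sum>k\<in>K. (cmod (\<psi> w $ k))\<^sup>2)"
      unfolding acc_def of_real_sum by (simp only: complex_norm_square)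
    thus ?thesis by simp
  qed
  have succ: "2/3 \<le> (\<Sum>k | k < N*W \<and> \<bar>est k - (\<Sum>j=1..G. sqrt (real (y j))) / A\<bar> \<le> \<epsilon>. (cmod (\<psi> w $ k))\<^sup>2)"
    if w: "\<forall>l. w l \<le> G" "\<forall>j\<in>{1..G}. card {l. l < L \<and> w l = j} = y j \<and> 1 \<le> y j" "letter_sum G y < L" for w y
  proof -
    obtain \<rho> \<sigma> where i: "density n \<rho>" "density n \<sigma>" "mrank n \<rho> = G + 1" "mrank n \<sigma> = G + 1"
      "purifies n m (O' w) \<rho>" "purifies n m V \<sigma>" and f: "fidelity n \<rho> \<sigma> = (\<Sum>j=1..G. sqrt (real (y j))) / A"
      using inst[OF w] unfolding O'_def A_def by blast
    from solves_success[OF solves i] show ?thesis unfolding f \<psi>_def N_def .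
  qed
  have finK: "finite {k. k < N*W \<and> Q k}" for Q by simp
  show False
  proof (cases "N * W = 0")
    \<comment> \<open>A register of dimension 0 has no outcomes, so a single admissible instance
      refutes the success probability: the word 0, 1, ..., G, 0, 0, ... with all counts 1.\<close>
    case True
    have "\<exists>w y. (\<forall>l. w l \<le> G) \<and> (\<forall>j\<in>{1..G}. card {l. l < L \<and> w l = j} = y j \<and> 1 \<le> y j) \<and> letter_sum G y < L"
    proof (intro exI conjI)
      define w where "w l = (if l \<le> G then l else 0)" for l :: nat
      have "1 \<le> D\<^sup>2" using D(1) by simp
      hence GL: "G < L" using D(2) unfolding L_def by linarith
      show "\<forall>l. w l \<le> G" by (simp add: w_def)
      have "{l. l < L \<and> w l = j} = {j}" if "j \<in> {1..G}" for j using that GL by (auto simp: w_def)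
      thus "\<forall>j\<in>{1..G}. card {l. l < L \<and> w l = j} = (\<lambda>_. 1) j \<and> 1 \<le> (\<lambda>_. 1 :: nat) j" by simp
      show "letter_sum G (\<lambda>_. 1) < L" using GL by (simp add: letter_sum_def)
    qed
    then obtain w y where "\<forall>l. w l \<le> G" "\<forall>j\<in>{1..G}. card {l. l < L \<and> w l = j} = y j \<and> 1 \<le> y j" "letter_sum G y < L" by blast
    from succ[OF this] show False using True by simp
  next
    case False
    hence NW: "0 < N * W" by simp
    have nrm: "\<psi> w \<in> carrier_vec (N*W)" "vnorm (\<psi> w) = 1" for w
      unfolding \<psi>_def using UV(2) by (intro final_state_norm[OF alg Ou _ NW]; simp add: N_def)+
    have one: "(\<Sum>k<N*W. (cmod (\<psi> w $ k))\<^sup>2) = 1" for w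
      using vnorm_sq[of "\<psi> w"] nrm[of w] by simp
    have "word_poly G L (length steps + length steps) acc"
      unfolding acc_def
    proof (intro word_poly_sum word_poly_mult word_poly_cnj)
      fix k assume "k \<in> K"
      hence k: "k < N * W" by (simp add: K_def)
      show "word_poly G L (length steps) (\<lambda>w. \<psi> w $ k)" unfolding \<psi>_def
      proof (rule word_poly_final_state[OF _ _ _ alg k])
        fix x y assume xy: "x < N" "y < N"
        have "O' w $$ (x, y) = (\<Sum>z<N. word_oracle n m L G w $$ (x, z) * U $$ (z, y))" for w
          unfolding O'_def using word_oracle_unitary[OF Gn, of m L w] UV(1) xy
          by (intro mult_index[of _ N N _ N]) (auto simp: N_def)
        moreover have "word_poly G L (1 + 0) (\<lambda>w. \<Sum>z<N. word_oracle n m L G w $$ (x, z) * U $$ (z, y))"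
          using xy by (intro word_poly_sum word_poly_mult word_poly_const word_poly_word_oracle) (auto simp: N_def)
        ultimately show "word_poly G L 1 (\<lambda>w. O' w $$ (x, y))" by simp
      qed (use Ou UV in \<open>auto simp: N_def\<close>)
      thus "word_poly G L (length steps) (\<lambda>w. \<psi> w $ k)" .
    qed
    from word_poly_repr[OF this] obtain F c where F: "finite F" "\<forall>\<mu>\<in>F. is_monomial G L (length steps + length steps) \<mu>"
      "\<And>w. Re (acc w) = (\<Sum>\<mu>\<in>F. c \<mu> * mono_ind \<mu> w)" by blast
    show False
    proof (rule low_degree_cannot_distinguish[of F G L D c 12200 \<tau>])
      show "is_monomial G L D \<mu>" if "\<mu> \<in> F" for \<mu> using F(2) that deg unfolding is_monomial_def by fastforce
      show "finite F" by (rule F(1))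
      fix w :: "nat \<Rightarrow> nat"
      have "Re (acc w) \<le> (\<Sum>k<N*W. (cmod (\<psi> w $ k))\<^sup>2)" unfolding acc by (intro sum_mono2) (auto simp: K_def)
      moreover have "0 \<le> Re (acc w)" unfolding acc by (intro sum_nonneg) simp
      ultimately show "0 \<le> (\<Sum>\<mu>\<in>F. c \<mu> * mono_ind \<mu> w) \<and> (\<Sum>\<mu>\<in>F. c \<mu> * mono_ind \<mu> w) \<le> 1"
        unfolding F(3)[symmetric] one by simp
    next
      fix w y :: "nat \<Rightarrow> nat"
      assume w: "\<forall>l. w l \<le> G" "\<forall>j\<in>{1..G}. card {l. l < L \<and> w l = j} = y j \<and> 1 \<le> y j" "letter_sum G y < L"
        and hi: "real G * (\<tau> + sqrt_gap / 4) \<le> (\<Sum>j=1..G. sqrt (real (y j)))"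
      have "\<theta> + \<delta> = real G * (\<tau> + sqrt_gap / 4) / A" by (simp add: \<theta>_def \<delta>_def distrib_left add_divide_distrib)
      also have "\<dots> \<le> (\<Sum>j=1..G. sqrt (real (y j))) / A" using hi A by (intro divide_right_mono) auto
      finally have "{k. k < N*W \<and> \<bar>est k - (\<Sum>j=1..G. sqrt (real (y j))) / A\<bar> \<le> \<epsilon>} \<subseteq> K"
        using \<delta> by (auto simp: K_def abs_le_iff)
      hence "(\<Sum>k | k < N*W \<and> \<bar>est k - (\<Sum>j=1..G. sqrt (real (y j))) / A\<bar> \<le> \<epsilon>. (cmod (\<psi> w $ k))\<^sup>2) \<le> Re (acc w)"
        unfolding acc by (intro sum_mono2) (auto simp: K_def)
      thus "2/3 \<le> (\<Sum>\<mu>\<in>F. c \<mu> * mono_ind \<mu> w)" using succ[OF w] unfolding F(3)[symmetric] by linarith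
    next
      fix w y :: "nat \<Rightarrow> nat"
      assume w: "\<forall>l. w l \<le> G" "\<forall>j\<in>{1..G}. card {l. l < L \<and> w l = j} = y j \<and> 1 \<le> y j" "letter_sum G y < L"
        and lo: "(\<Sum>j=1..G. sqrt (real (y j))) \<le> real G * (\<tau> - sqrt_gap / 4)"
      define S where "S = {k. k < N*W \<and> \<bar>est k - (\<Sum>j=1..G. sqrt (real (y j))) / A\<bar> \<le> \<epsilon>}"
      have "(\<Sum>j=1..G. sqrt (real (y j))) / A \<le> real G * (\<tau> - sqrt_gap / 4) / A" using lo A by (intro divide_right_mono) auto
      also have "\<dots> = \<theta> - \<delta>" by (simp add: \<theta>_def \<delta>_def right_diff_distrib diff_divide_distrib)
      finally have "S \<inter> K = {}" using \<delta> by (auto simp: S_def K_def abs_le_iff)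
      hence "(\<Sum>k\<in>S. (cmod (\<psi> w $ k))\<^sup>2) + Re (acc w) = (\<Sum>k\<in>S \<union> K. (cmod (\<psi> w $ k))\<^sup>2)"
        unfolding acc by (intro sum.union_disjoint[symmetric]) (auto simp: S_def K_def)
      also have "\<dots> \<le> (\<Sum>k<N*W. (cmod (\<psi> w $ k))\<^sup>2)" by (intro sum_mono2) (auto simp: S_def K_def)
      finally have "(\<Sum>k\<in>S. (cmod (\<psi> w $ k))\<^sup>2) + Re (acc w) \<le> 1" unfolding one .
      thus "(\<Sum>\<mu>\<in>F. c \<mu> * mono_ind \<mu> w) \<le> 1/3" using succ[OF w] unfolding F(3)[symmetric] S_def by linarith
    qed (use D G in \<open>auto simp: L_def \<tau>_def\<close>)
  qed
qed

theorem theorem2p42: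
  shows "\<exists>c>0. \<exists>\<epsilon>\<^sub>0>0. \<forall>r::nat. r \<ge> 1 \<longrightarrow> (\<exists>N::nat. \<forall>\<epsilon>::real. 0 < \<epsilon> \<and> \<epsilon> < \<epsilon>\<^sub>0 \<longrightarrow>
     (\<forall>n m W V0 steps est. n \<ge> N \<and> m \<ge> N \<and> solves_fidelity n m r \<epsilon> W V0 steps est \<longrightarrow>
        c * (sqrt (real r) / sqrt \<epsilon> + 1 / \<epsilon>) \<le> real (length steps)))"
proof -
  \<comment> \<open>The summand 2 ensures that \<open>r > r0\<close> leaves \<open>G = r - 1\<close>
    large enough for the concentration and at least 1.\<close>
  define r0 where "r0 = 960000 / sqrt_gap\<^sup>2 + 2"
  have r0: "r0 \<ge> 2" unfolding r0_def by simp
  \<comment> \<open>For small \<open>r\<close> or \<open>r * \<epsilon> \<le> 1\<close> the bound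
    \<open>1 / (50 * \<epsilon>)\<close> has to carry both summands, which together are at most
    \<open>(sqrt r0 + 1) / \<epsilon>\<close>.\<close>
  define c where "c = 1 / (50 * (sqrt r0 + 1))"
  \<comment> \<open>\<open>1/10\<close> serves \<open>queries_ge_inverse_eps\<close>. The other
    entry gives \<open>sqrt \<epsilon> < sqrt_gap / 2000\<close>, by which a fidelity gap of order
    \<open>sqrt \<epsilon>\<close> exceeds \<epsilon>.\<close>
  define \<epsilon>0 where "\<epsilon>0 = min (1/10) ((sqrt_gap / 2000)\<^sup>2)"
  have sr0: "sqrt r0 \<ge> 1" using r0 by simp
  define q where "q = 50 * (sqrt r0 + 1)"
  have "100 \<le> q" using sr0 by (simp add: q_def)
  hence c: "c > 0" "c \<le> 1/100" unfolding c_def q_def[symmetric] using frac_le[of 1 1 100 q] by auto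
  have \<epsilon>0: "\<epsilon>0 > 0" using sqrt_gap_pos by (simp add: \<epsilon>0_def)
  show ?thesis
  proof (rule exI[of _ c], intro conjI c(1), rule exI[of _ \<epsilon>0], intro conjI \<epsilon>0 allI impI)
    fix r :: nat assume r: "1 \<le> r"
    show "\<exists>N. \<forall>\<epsilon>. 0 < \<epsilon> \<and> \<epsilon> < \<epsilon>0 \<longrightarrow> (\<forall>n m W V0 steps est. N \<le> n \<and> N \<le> m \<and> solves_fidelity n m r \<epsilon> W V0 steps est \<longrightarrow>
        c * (sqrt (real r) / sqrt \<epsilon> + 1 / \<epsilon>) \<le> real (length steps))"
    \<comment> \<open>Room for a word of length \<open>12200 * D\<^sup>2\<close> with
      \<open>D \<le> r + 1\<close>, and for the supports of the rotated states.\<close>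
    proof (rule exI[of _ "12200 * (r + 1)\<^sup>2 + 2 * r + 1"], intro allI impI, elim conjE)
      fix \<epsilon> n m W V0 steps est
      assume \<epsilon>: "0 < \<epsilon>" "\<epsilon> < \<epsilon>0" and nm: "12200 * (r + 1)\<^sup>2 + 2 * r + 1 \<le> n" "12200 * (r + 1)\<^sup>2 + 2 * r + 1 \<le> m"
        and solves: "solves_fidelity n m r \<epsilon> W V0 steps est"
      have \<epsilon>1: "\<epsilon> < 1/10" "\<epsilon> < (sqrt_gap / 2000)\<^sup>2" using \<epsilon> by (auto simp: \<epsilon>0_def)
      have inv: "1 / (50 * \<epsilon>) \<le> real (length steps)"
        using nm by (intro queries_ge_inverse_eps[OF solves r _ _ \<epsilon>(1) \<epsilon>1(1)]) auto
      have s\<epsilon>: "sqrt \<epsilon> > 0" "sqrt \<epsilon> * sqrt \<epsilon> = \<epsilon>" using \<epsilon> by auto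
      show "c * (sqrt (real r) / sqrt \<epsilon> + 1 / \<epsilon>) \<le> real (length steps)"
      \<comment> \<open>In the first case sqrt(r / \<epsilon>) is at most a constant times 1 /
        \<epsilon> and the hybrid bound suffices; the polynomial method is used only in the
        second.\<close>
      proof (cases "real r \<le> r0 \<or> real r * \<epsilon> \<le> 1")
        case True
        have "sqrt (real r) / sqrt \<epsilon> \<le> sqrt r0 / \<epsilon>"
        proof (cases "real r * \<epsilon> \<le> 1")
          case True
          have "sqrt (real r) / sqrt \<epsilon> = sqrt (real r * \<epsilon>) / \<epsilon>"
            using s\<epsilon> \<epsilon>(1) by (simp add: real_sqrt_mult field_simps)
          also have "\<dots> \<le> sqrt r0 / \<epsilon>"
          proof (rule divide_right_mono)
            have "sqrt (real r * \<epsilon>) \<le> 1" using True by (simp add: real_sqrt_le_1_iff)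
            thus "sqrt (real r * \<epsilon>) \<le> sqrt r0" using sr0 by linarith
          qed (use \<epsilon> in simp)
          finally show ?thesis .
        next
          case False
          hence "real r \<le> r0" using \<open>real r \<le> r0 \<or> real r * \<epsilon> \<le> 1\<close> by simp
          have "\<epsilon> \<le> sqrt \<epsilon>" using \<epsilon>(1) \<epsilon>1(1) real_le_rsqrt[of \<epsilon> \<epsilon>] by (simp add: power2_eq_square mult_left_le)
          hence "sqrt (real r) / sqrt \<epsilon> \<le> sqrt (real r) / \<epsilon>" using \<epsilon>(1) s\<epsilon> by (intro divide_left_mono) auto
          also have "\<dots> \<le> sqrt r0 / \<epsilon>" using \<open>real r \<le> r0\<close> \<epsilon>(1) by (intro divide_right_mono) auto
          finally show ?thesis .
        qed
        hence "c * (sqrt (real r) / sqrt \<epsilon> + 1 / \<epsilon>) \<le> c * (sqrt r0 / \<epsilon> + 1 / \<epsilon>)" using c by (intro mult_left_mono) auto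
        also have "\<dots> = 1 / (50 * \<epsilon>)"
        proof -
          have gen: "1 / (50 * t) * (t / \<epsilon>) = 1 / (50 * \<epsilon>)" if "t \<noteq> 0" for t using that by simp
          show ?thesis unfolding c_def add_divide_distrib[symmetric] by (rule gen) (use sr0 in linarith)
        qed
        finally show ?thesis using inv by linarith
      next
        case False
        hence rr: "real r > r0" "real r * \<epsilon> > 1" by auto
        define G where "G = r - 1"
        have rG: "r = G + 1" using r by (simp add: G_def)
        have G1: "G \<ge> 1" using rr(1) r0 rG by linarith
        define X where "X = sqrt (real r / \<epsilon>)"
        have X: "X = sqrt (real r) / sqrt \<epsilon>" by (simp add: X_def real_sqrt_divide)
        define D where "D = nat \<lceil>X\<rceil>"
        have r\<epsilon>: "real r \<le> real r / \<epsilon>" using \<epsilon>(1) \<epsilon>1(1) by (simp add: le_divide_eq mult_left_le)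
        have X1: "X \<ge> 1" using r\<epsilon> r unfolding X_def by (intro real_le_rsqrt) (simp add: order_trans[OF _ r\<epsilon>])
        have D: "X \<le> real D" "real D \<le> X + 1" using X1 by (auto simp: D_def of_nat_nat)
        have D1: "D \<ge> 1" using D(1) X1 by linarith
        have GD: "G \<le> D\<^sup>2"
        proof -
          have "real G \<le> real r / \<epsilon>" using r\<epsilon> rG by simp
          also have "\<dots> = X\<^sup>2" unfolding X_def using \<epsilon>(1) by simp
          also have "\<dots> \<le> (real D)\<^sup>2" using D(1) X1 by (intro power_mono) auto
          finally show ?thesis by (metis of_nat_le_iff of_nat_power)
        qed
        \<comment> \<open>The dimension bound is fixed before \<epsilon>, so \<open>D\<close> must
          be bounded in terms of \<open>r\<close> alone; \<open>r * \<epsilon> > 1\<close> gives r /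
          \<epsilon> \<le> r^2.\<close>
        have Dr: "D \<le> r + 1"
        proof -
          have "1 / \<epsilon> \<le> real r" using rr(2) \<epsilon>(1) by (simp add: divide_le_eq)
          hence "real r * (1 / \<epsilon>) \<le> real r * real r" by (intro mult_left_mono) auto
          hence "X \<le> real r" unfolding X_def by (intro real_le_lsqrt) (auto simp: power2_eq_square)
          thus ?thesis using D(2) by linarith
        qed
        have m: "12200 * D\<^sup>2 \<le> m"
        proof -
          have "12200 * D\<^sup>2 \<le> 12200 * (r + 1)\<^sup>2" using Dr by (intro mult_left_mono power_mono) auto
          also have "\<dots> \<le> m" using nm(2) by linarith
          finally show ?thesis .
        qed
        \<comment> \<open>With L of order r / \<epsilon> the fidelity gap is of order sqrt(G / L),
          that is \<open>sqrt \<epsilon>\<close>. The constants: 111 bounds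
          \<open>sqrt 12200\<close>, \<open>2 * X\<close> bounds \<open>D\<close>,
          \<open>2 * G\<close> bounds \<open>r\<close>, and 4 * 444 is below 2000.\<close>
        have gap: "\<epsilon> < real G * (sqrt_gap / 4) / sqrt (real (12200 * D\<^sup>2) * real (G + 1))"
        proof -
          have "sqrt (real (12200 * D\<^sup>2) * real (G + 1)) = sqrt 12200 * real D * sqrt (real r)"
            by (simp add: real_sqrt_mult rG)
          also have "\<dots> \<le> 111 * (2 * X) * sqrt (real r)"
          proof -
            have "sqrt 12200 \<le> 111" by (rule real_le_lsqrt) auto
            thus ?thesis using D X1 by (intro mult_mono) auto
          qed
          also have "\<dots> = 222 * real r / sqrt \<epsilon>" unfolding X using r by (simp flip: power2_eq_square)
          also have "\<dots> \<le> 444 * real G / sqrt \<epsilon>" using rG G1 s\<epsilon> by (intro divide_right_mono) auto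
          finally have A: "sqrt (real (12200 * D\<^sup>2) * real (G + 1)) \<le> 444 * real G / sqrt \<epsilon>" .
          have "sqrt \<epsilon> < sqrt_gap / 2000" using \<epsilon>1(2) sqrt_gap_pos by (intro real_less_lsqrt) auto
          hence "\<epsilon> < sqrt_gap / 2000 * sqrt \<epsilon>" using s\<epsilon> by (metis mult_strict_right_mono)
          also have "\<dots> \<le> sqrt_gap / 4 * sqrt \<epsilon> / 444" using sqrt_gap_pos s\<epsilon> by simp
          also have "\<dots> = real G * (sqrt_gap / 4) / (444 * real G / sqrt \<epsilon>)" using G1 s\<epsilon> by (simp add: field_simps)
          also have "\<dots> \<le> real G * (sqrt_gap / 4) / sqrt (real (12200 * D\<^sup>2) * real (G + 1))"
            using A D1 sqrt_gap_pos s\<epsilon> G1 by (intro divide_left_mono) auto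
          finally show ?thesis .
        qed
        have "D < 2 * length steps"
        proof (rule degree_lower_bound[OF solves[unfolded rG] _ _ m D1 GD _ gap])
          show "G + 2 \<le> n" "G + 2 \<le> m" using nm rG by auto
          show "960000 / sqrt_gap\<^sup>2 \<le> real G" using rr(1) rG unfolding r0_def by simp
        qed
        hence T: "X \<le> 2 * real (length steps)" using D(1) by linarith
        \<comment> \<open>In this case X = sqrt(r / \<epsilon>) dominates the other summand, so both
          together are at most \<open>2 * X\<close>.\<close>
        have "1 / \<epsilon> \<le> X"
        proof -
          have "1 / \<epsilon> * 1 \<le> 1 / \<epsilon> * (real r * \<epsilon>)" using rr(2) \<epsilon>(1) by (intro mult_left_mono) auto
          hence "(1 / \<epsilon>)\<^sup>2 \<le> real r / \<epsilon>" using \<epsilon>(1) by (simp add: power2_eq_square divide_simps)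
          thus ?thesis unfolding X_def by (rule real_le_rsqrt)
        qed
        hence "c * (sqrt (real r) / sqrt \<epsilon> + 1 / \<epsilon>) \<le> c * (X + X)" unfolding X[symmetric] using c by (intro mult_left_mono) auto
        also have "\<dots> \<le> 1/100 * (X + X)" using c X1 by (intro mult_right_mono) auto
        also have "1/100 * (X + X) = X / 50" by simp
        also have "\<dots> \<le> real (length steps)" using T X1 by linarith
        finally show ?thesis .
      qed
    qed
  qed
qed

end
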